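(* Let $\Delta\ge 3$ be an integer, $\lambda>0$, and let $\boldsymbol\theta=(\theta_0,\ldots,\theta_\Delta)$ be a strictly positive log-convex vector. Define, for $x\ge 0$, $$f_{\boldsymbol\theta}(x) = \frac{\sum_{k=0}^{\Delta-1}\theta_{k+1}\binom{\Delta-1}{k}x^k}{\sum_{k=0}^{\Delta-1}\theta_{k}\binom{\Delta-1}{k}x^k},\qquad g_{\boldsymbol\theta}(x) = \frac{1}{\sum_{k=0}^{\Delta-1}\theta_k\binom{\Delta-1}{k}x^k}.$$ Then the system of equations $$x = \lambda\, g_{\boldsymbol\theta}(y)\, f_{\boldsymbol\theta}(x)^{\Delta-1},\qquad y = \lambda\, g_{\boldsymbol\theta}(x)\, f_{\boldsymbol\theta}(y)^{\Delta-1}$$ always has at least one solution $(x,y)\in[0,\infty)\times[0,\infty)$. Moreover, $(\lambda,\boldsymbol\theta)$ belongs to the uniqueness regime if and only if this solution is unique in $[0,\infty)\times[0,\infty)$.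
   Context: Log-convexity: a strictly positive sequence $(x_0,\ldots,x_n)$ is log-convex if $x_{i+1}/x_i \ge x_i/x_{i-1}$ for all $i \in \{1,\ldots,n-1\}$. Model. $T_\infty$ is the infinite $\Delta$-regular tree, rooted at a node $0$, with graph distance $d(\cdot,\cdot)$; $T_\infty$ also denotes its node set. For $S \subseteq T_\infty$, $\Omega_S = \{0,1\}^S$ and $\Omega=\Omega_{T_\infty}$; for $\omega\in\Omega_S$ write $\omega_{\{i\}}$ for the spin at $i$, $\omega_{S'}$ for the restriction to $S'\subseteq S$, and $|\omega| = \sum_{i\in S}\omega_{\{i\}}$. $\tilde\Omega_S \subseteq \Omega_S$ is the set of $\omega$ with no two adjacent nodes of $S$ both having spin $1$. For disjoint $S_1,S_2$, $\omega^1\cdot\omega^2$ denotes the combined configuration. $\partial S$ is the set of nodes not in $S$ at distance at most $2$ from $S$. For a node $i$, $N(i)$ is the set consisting of $i$ and its $\Delta$ neighbors. For $\lambda>0$ and strictly positive $\boldsymbol\theta$, define for each node $i$ and $\omega\in\Omega_{N(i)}$ the potential $\Phi_{N(i)}(\omega) = -\log\lambda$ if $\omega_{\{i\}}=1$ and $|\omega_{N(i)}|=1$; $\Phi_{N(i)}(\omega)=-\log\theta_k$ if $\omega_{\{i\}}=0$ and $|\omega_{N(i)}|=k$; $\Phi_{N(i)}(\omega)=\infty$ otherwise. All other potentials are zero. This family of potentials is denoted $(\lambda,\boldsymbol\theta)$. For finite $\Lambda\subseteq T_\infty$ and $\omega\in\Omega_{\Lambda\cup\partial\Lambda}$, the Hamiltonian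 is $\mathcal{H}_\Lambda(\omega) = \sum_{i:\,N(i)\cap\Lambda\ne\emptyset}\Phi_{N(i)}(\omega_{N(i)})$. For finite $S\subseteq\Lambda$, $\omega\in\Omega_S$ and $\eta\in\tilde\Omega_{\partial\Lambda}$, $$\mathbb{P}_{\lambda,\boldsymbol\theta,\Lambda}(S=\omega\mid\eta) = \frac{\sum_{\nu\in\Omega_\Lambda:\,\nu_S=\omega}\exp(-\mathcal{H}_\Lambda(\nu\cdot\eta))}{\sum_{\nu\in\Omega_\Lambda}\exp(-\mathcal{H}_\Lambda(\nu\cdot\eta))},\qquad \exp(-\infty)=0.$$ Uniqueness regime. An infinite-volume Gibbs measure consistent with $(\lambda,\boldsymbol\theta)$ is a probability measure $\mu$ on $\Omega$ (product $\sigma$-algebra), concentrated on configurations with no two adjacent nodes both having spin $1$, such that for all finite $S\subseteq\Lambda\subseteq T_\infty$ and $\omega\in\Omega_S$, $\mu(S=\omega) = \sum_{\eta\in\tilde\Omega_{\partial\Lambda}}\mathbb{P}_{\lambda,\boldsymbol\theta,\Lambda}(S=\omega\mid\eta)\,\mu(\partial\Lambda=\eta)$, where $\{S=\omega\}$ is the event that the nodes of $S$ receive the spins $\omega$. $(\lambda,\boldsymbol\theta)$ belongs to the uniqueness regime if there is exactly one such measure. *)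

theory Defs
  imports "HOL-Probability.Probability"
begin

type_synonym node = "nat list"

text \<open>
  A node is the list of child indices on the way from the root, the empty list, to it: the root
  has \<open>\<Delta>\<close> children and every other node has \<open>\<Delta> - 1\<close> children (and one parent).
  The lemma \<open>regular_tree_tree_nodes\<close> below confirms that this is a \<open>\<Delta>\<close>-regular tree.
\<close>

definition tree_nodes :: "nat \<Rightarrow> node set" where
  "tree_nodes \<Delta> = {w. set w \<subseteq> {..<\<Delta>} \<and> set (tl w) \<subseteq> {..<\<Delta> - 1}}"

definition tree_adj :: "nat \<Rightarrow> node \<Rightarrow> node \<Rightarrow> bool" where
  "tree_adj \<Delta> u v \<longleftrightarrow>
     u \<in> tree_nodes \<Delta> \<and> v \<in> tree_nodes \<Delta> \<and> (\<exists>a. v = u @ [a] \<or> u = v @ [a])"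

definition regular_tree :: "nat \<Rightarrow> 'a set \<Rightarrow> ('a \<Rightarrow> 'a \<Rightarrow> bool) \<Rightarrow> bool" where
  "regular_tree \<Delta> V E \<longleftrightarrow>
     V \<noteq> {} \<and>
     (\<forall>u v. E u v \<longrightarrow> u \<in> V \<and> v \<in> V) \<and>
     (\<forall>u v. E u v \<longrightarrow> E v u) \<and>
     (\<forall>u. \<not> E u u) \<and>
     (\<forall>u\<in>V. finite {v. E u v} \<and> card {v. E u v} = \<Delta>) \<and>
     (\<forall>u\<in>V. \<forall>v\<in>V. \<exists>n. (E ^^ n) u v) \<and>
     \<not> (\<exists>c. 3 \<le> length c \<and> distinct c \<and> successively E c \<and> E (last c) (hd c))"

lemma snoc_in_tree_nodes:
  "w @ [a] \<in> tree_nodes \<Delta> \<longleftrightarrow> w \<in> tree_nodes \<Delta> \<and> a < (if w = [] then \<Delta> else \<Delta> - 1)"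
  by (cases w) (auto simp: tree_nodes_def)

lemma Nil_in_tree_nodes: "[] \<in> tree_nodes \<Delta>"
  by (simp add: tree_nodes_def)

lemma tree_adj_sym: "tree_adj \<Delta> u v \<Longrightarrow> tree_adj \<Delta> v u"
  by (auto simp: tree_adj_def)

lemma tree_adj_nbrs:
  assumes "\<Delta> > 0" "u \<in> tree_nodes \<Delta>"
  shows "finite {v. tree_adj \<Delta> u v} \<and> card {v. tree_adj \<Delta> u v} = \<Delta>"
proof (cases u rule: rev_cases)
  case Nil
  have "{v. tree_adj \<Delta> u v} = (\<lambda>a. u @ [a]) ` {..<\<Delta>}"
    using Nil assms by (auto simp: tree_adj_def snoc_in_tree_nodes tree_nodes_def)
  then show ?thesis
    by (simp add: card_image inj_on_def)
next
  case (snoc w b)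
  have eq: "{v. tree_adj \<Delta> u v} = insert w ((\<lambda>a. u @ [a]) ` {..<\<Delta> - 1})"
    using assms snoc snoc_in_tree_nodes[of w b \<Delta>] snoc_in_tree_nodes[of u _ \<Delta>]
    by (auto simp: tree_adj_def)
  have "w \<notin> (\<lambda>a. u @ [a]) ` {..<\<Delta> - 1}"
    using snoc by auto
  then show ?thesis
    unfolding eq using assms by (simp add: card_image inj_on_def)
qed

lemma tree_adj_root:
  "w \<in> tree_nodes \<Delta> \<Longrightarrow> \<exists>n. (tree_adj \<Delta> ^^ n) [] w \<and> (tree_adj \<Delta> ^^ n) w []"
proof (induction w rule: rev_induct)
  case Nil
  show ?case by (rule exI[of _ 0]) simp
next
  case (snoc a w)
  then have w: "w \<in> tree_nodes \<Delta>"
    by (simp add: snoc_in_tree_nodes)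
  with snoc.IH obtain n where n: "(tree_adj \<Delta> ^^ n) [] w" "(tree_adj \<Delta> ^^ n) w []"
    by blast
  have adj: "tree_adj \<Delta> w (w @ [a])"
    using w snoc.prems by (simp add: tree_adj_def)
  have "(tree_adj \<Delta> ^^ Suc n) [] (w @ [a])"
    using n(1) adj by (rule relpowp_Suc_I)
  moreover have "(tree_adj \<Delta> ^^ Suc n) (w @ [a]) []"
    using tree_adj_sym[OF adj] n(2) by (rule relpowp_Suc_I2)
  ultimately show ?case by blast
qed

lemma tree_adj_acyclic:
  assumes len: "3 \<le> length c" and dist: "distinct c"
    and succ: "successively (tree_adj \<Delta>) c" and close: "tree_adj \<Delta> (last c) (hd c)"
  shows False
proof -
  define n where "n = length c"
  have n3: "3 \<le> n"
    using len by (simp add: n_def)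
  have next_adj: "tree_adj \<Delta> (c ! i) (c ! (Suc i mod n))" if "i < n" for i
  proof (cases "Suc i < n")
    case True
    then show ?thesis
      using successively_nth[OF succ, of i] by (simp add: n_def)
  next
    case False
    with that have eq: "Suc i = n" by simp
    have "c \<noteq> []"
      using len by auto
    then have "c ! i = last c" "c ! (Suc i mod n) = hd c"
      using eq by (auto simp: last_conv_nth hd_conv_nth n_def[symmetric] eq[symmetric])
    then show ?thesis
      using close by simp
  qed
  obtain i where i: "i < n" and imax: "\<And>j. j < n \<Longrightarrow> length (c ! j) \<le> length (c ! i)"
  proof -
    let ?L = "(\<lambda>j. length (c ! j)) ` {..<n}"
    have "Max ?L \<in> ?L"
      using n3 by (intro Max_in) (auto simp: lessThan_empty_iff)
    then obtain i where "i < n" "Max ?L = length (c ! i)" by auto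
    moreover have "length (c ! j) \<le> Max ?L" if "j < n" for j
      using that by (intro Max_ge) auto
    ultimately show ?thesis
      using that by metis
  qed
  have up: "v = butlast (c ! i)" if "tree_adj \<Delta> (c ! i) v" "length v \<le> length (c ! i)" for v
    using that by (auto simp: tree_adj_def)
  define p where "p = (if i = 0 then n - 1 else i - 1)"
  define s where "s = Suc i mod n"
  have p: "p < n" "Suc p mod n = i"
    using i n3 by (auto simp: p_def)
  have s: "s < n"
    using n3 by (simp add: s_def)
  have "p \<noteq> s"
    using i n3 by (cases "Suc i = n") (auto simp: p_def s_def)
  have "c ! s = butlast (c ! i)"
    using next_adj[OF i] imax[OF s] by (intro up) (simp_all add: s_def)
  moreover have "c ! p = butlast (c ! i)"
    using next_adj[OF p(1)] imax[OF p(1)] p(2) by (intro up) (simp_all add: tree_adj_sym)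
  ultimately have "c ! p = c ! s" by simp
  then show False
    using dist p(1) s \<open>p \<noteq> s\<close> by (simp add: n_def nth_eq_iff_index_eq)
qed

lemma regular_tree_tree_nodes:
  assumes "\<Delta> > 0"
  shows "regular_tree \<Delta> (tree_nodes \<Delta>) (tree_adj \<Delta>)"
proof -
  have "\<exists>n. (tree_adj \<Delta> ^^ n) u v" if "u \<in> tree_nodes \<Delta>" "v \<in> tree_nodes \<Delta>" for u v
    using tree_adj_root[OF that(1)] tree_adj_root[OF that(2)] relpowp_trans by metis
  moreover have "tree_nodes \<Delta> \<noteq> {}"
    using Nil_in_tree_nodes by blast
  moreover have "\<not> tree_adj \<Delta> u u" for u
    by (simp add: tree_adj_def)
  moreover have "u \<in> tree_nodes \<Delta> \<and> v \<in> tree_nodes \<Delta>" if "tree_adj \<Delta> u v" for u v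
    using that by (simp add: tree_adj_def)
  ultimately show ?thesis
    unfolding regular_tree_def
    using tree_adj_nbrs[OF assms] tree_adj_sym tree_adj_acyclic by (intro conjI) blast+
qed

definition tree_dist :: "nat \<Rightarrow> node \<Rightarrow> node \<Rightarrow> nat" where
  "tree_dist \<Delta> u v = (LEAST n. (tree_adj \<Delta> ^^ n) u v)"

definition bdry :: "nat \<Rightarrow> node set \<Rightarrow> node set" where
  "bdry \<Delta> S = {j \<in> tree_nodes \<Delta> - S. \<exists>i\<in>S. tree_dist \<Delta> i j \<le> 2}"

definition nbhd :: "nat \<Rightarrow> node \<Rightarrow> node set" where
  "nbhd \<Delta> i = insert i {j. tree_adj \<Delta> i j}"

definition configs :: "node set \<Rightarrow> (node \<Rightarrow> nat) set" where
  "configs S = (S \<rightarrow>\<^sub>E {0, 1})"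

definition hardcore_configs :: "nat \<Rightarrow> node set \<Rightarrow> (node \<Rightarrow> nat) set" where
  "hardcore_configs \<Delta> S =
     {\<omega> \<in> configs S. \<forall>i\<in>S. \<forall>j\<in>S. tree_adj \<Delta> i j \<longrightarrow> \<not> (\<omega> i = 1 \<and> \<omega> j = 1)}"

definition potential :: "nat \<Rightarrow> real \<Rightarrow> (nat \<Rightarrow> real) \<Rightarrow> node \<Rightarrow> (node \<Rightarrow> nat) \<Rightarrow> ereal" where
  "potential \<Delta> lam \<theta> i \<omega> =
     (if \<omega> i = 1 \<and> (\<Sum>j\<in>nbhd \<Delta> i. \<omega> j) = 1 then ereal (- ln lam)
      else if \<omega> i = 0 then ereal (- ln (\<theta> (\<Sum>j\<in>nbhd \<Delta> i. \<omega> j)))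
      else \<infinity>)"

definition hamiltonian ::
    "nat \<Rightarrow> real \<Rightarrow> (nat \<Rightarrow> real) \<Rightarrow> node set \<Rightarrow> (node \<Rightarrow> nat) \<Rightarrow> ereal" where
  "hamiltonian \<Delta> lam \<theta> \<Lambda> \<omega> =
     (\<Sum>i | i \<in> tree_nodes \<Delta> \<and> nbhd \<Delta> i \<inter> \<Lambda> \<noteq> {}. potential \<Delta> lam \<theta> i (restrict \<omega> (nbhd \<Delta> i)))"

text \<open>\<open>exp (-h)\<close> with \<open>exp (-\<infinity>) = 0\<close>; Hamiltonians never take the value \<open>-\<infinity>\<close>.\<close>

definition exp_neg :: "ereal \<Rightarrow> real" where
  "exp_neg h = (if h = \<infinity> then 0 else exp (- real_of_ereal h))"

text \<open>\<open>finite_volume_prob \<Delta> lam \<theta> \<Lambda> \<eta> S \<omega>\<close> is the probability of \<open>S = \<omega>\<close> in the volume \<open>\<Lambda>\<close>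
  given the boundary condition \<open>\<eta>\<close> on \<open>bdry \<Delta> \<Lambda>\<close>.\<close>

definition finite_volume_prob ::
    "nat \<Rightarrow> real \<Rightarrow> (nat \<Rightarrow> real) \<Rightarrow> node set \<Rightarrow> (node \<Rightarrow> nat) \<Rightarrow> node set \<Rightarrow> (node \<Rightarrow> nat) \<Rightarrow> real"
  where
  "finite_volume_prob \<Delta> lam \<theta> \<Lambda> \<eta> S \<omega> =
     (\<Sum>\<nu> | \<nu> \<in> configs \<Lambda> \<and> restrict \<nu> S = \<omega>.
        exp_neg (hamiltonian \<Delta> lam \<theta> \<Lambda> (merge \<Lambda> (bdry \<Delta> \<Lambda>) (\<nu>, \<eta>)))) /
     (\<Sum>\<nu>\<in>configs \<Lambda>.
        exp_neg (hamiltonian \<Delta> lam \<theta> \<Lambda> (merge \<Lambda> (bdry \<Delta> \<Lambda>) (\<nu>, \<eta>))))"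

definition config_space :: "nat \<Rightarrow> (node \<Rightarrow> nat) measure" where
  "config_space \<Delta> = Pi\<^sub>M (tree_nodes \<Delta>) (\<lambda>_. count_space {0, 1})"

lemma space_config_space: "space (config_space \<Delta>) = configs (tree_nodes \<Delta>)"
  by (simp add: config_space_def configs_def space_PiM)

definition gibbs_measure ::
    "nat \<Rightarrow> real \<Rightarrow> (nat \<Rightarrow> real) \<Rightarrow> (node \<Rightarrow> nat) measure \<Rightarrow> bool" where
  "gibbs_measure \<Delta> lam \<theta> \<mu> \<longleftrightarrow>
     prob_space \<mu> \<and> sets \<mu> = sets (config_space \<Delta>) \<and>
     (AE \<sigma> in \<mu>. \<sigma> \<in> hardcore_configs \<Delta> (tree_nodes \<Delta>)) \<and>
     (\<forall>\<Lambda> S. finite \<Lambda> \<and> \<Lambda> \<subseteq> tree_nodes \<Delta> \<and> S \<subseteq> \<Lambda> \<longrightarrow>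
        (\<forall>\<omega>\<in>configs S.
           measure \<mu> {\<sigma> \<in> space \<mu>. restrict \<sigma> S = \<omega>} =
           (\<Sum>\<eta>\<in>hardcore_configs \<Delta> (bdry \<Delta> \<Lambda>).
              finite_volume_prob \<Delta> lam \<theta> \<Lambda> \<eta> S \<omega> *
              measure \<mu> {\<sigma> \<in> space \<mu>. restrict \<sigma> (bdry \<Delta> \<Lambda>) = \<eta>})))"

definition uniqueness_regime :: "nat \<Rightarrow> real \<Rightarrow> (nat \<Rightarrow> real) \<Rightarrow> bool" where
  "uniqueness_regime \<Delta> lam \<theta> \<longleftrightarrow> (\<exists>!\<mu>. gibbs_measure \<Delta> lam \<theta> \<mu>)"

text \<open>A vector \<open>(x\<^sub>0, \<dots>, x\<^sub>n)\<close> is a function on the naturals of which only the values at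
  \<open>0, \<dots>, n\<close> matter.\<close>

definition log_convex :: "nat \<Rightarrow> (nat \<Rightarrow> real) \<Rightarrow> bool" where
  "log_convex n x \<longleftrightarrow> (\<forall>i\<in>{1..n - 1}. x (i + 1) / x i \<ge> x i / x (i - 1))"

definition f_fun :: "nat \<Rightarrow> (nat \<Rightarrow> real) \<Rightarrow> real \<Rightarrow> real" where
  "f_fun \<Delta> \<theta> x =
     (\<Sum>k=0..\<Delta>-1. \<theta> (k + 1) * real ((\<Delta> - 1) choose k) * x ^ k) /
     (\<Sum>k=0..\<Delta>-1. \<theta> k * real ((\<Delta> - 1) choose k) * x ^ k)"

definition g_fun :: "nat \<Rightarrow> (nat \<Rightarrow> real) \<Rightarrow> real \<Rightarrow> real" where
  "g_fun \<Delta> \<theta> x = 1 / (\<Sum>k=0..\<Delta>-1. \<theta> k * real ((\<Delta> - 1) choose k) * x ^ k)"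

definition system_solutions :: "nat \<Rightarrow> real \<Rightarrow> (nat \<Rightarrow> real) \<Rightarrow> (real \<times> real) set" where
  "system_solutions \<Delta> lam \<theta> =
     {(x, y). 0 \<le> x \<and> 0 \<le> y \<and>
        x = lam * g_fun \<Delta> \<theta> y * f_fun \<Delta> \<theta> x ^ (\<Delta> - 1) \<and>
        y = lam * g_fun \<Delta> \<theta> x * f_fun \<Delta> \<theta> y ^ (\<Delta> - 1)}"

end

theory Submission
  imports Defs
begin

text \<open>
  Cut the tree at the edge between a node \<open>v\<close> and its parent, and let \<open>Z v s t\<close> be the total weight of
  the branch below \<open>v\<close> when the parent has spin \<open>s\<close> and \<open>v\<close> has spin \<open>t\<close>. The weight of a node depends
  on the spins of all its neighbors, so the message across an edge has to record both spins. As
  \<open>Z v 1 1 = 0\<close>, up to a factor it is a pair of ratios \<open>a = Z v 0 1 / Z v 0 0\<close> and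
  \<open>b = Z v 1 0 / Z v 0 0\<close>. If all \<open>\<Delta> - 1\<close> children of \<open>v\<close> send \<open>(a, b)\<close>, then \<open>v\<close> sends
  \<open>(lam * b ^ (\<Delta> - 1) / D a, f a)\<close>, where \<open>f\<close> is the function of the system of equations and \<open>1 / D\<close>
  is its function \<open>g\<close>. A pair \<open>(x, y)\<close> solves the system iff the messages \<open>(x, f y)\<close> and \<open>(y, f x)\<close>
  are exchanged by this map, so the solutions are the 2-periodic messages.

  Log-convexity of \<open>\<theta>\<close> makes \<open>f\<close> increasing, and more generally makes the second ratio sent by \<open>v\<close>
  increasing in the first ratio of each child (\<open>child_sum_ratio_mono\<close>, from the log-convexity of the
  sums over the children in \<open>child_sum_log_convex\<close>). Hence the message map is antitone for the order
  in which \<open>a\<close> grows and \<open>b\<close> decreases. Starting from bounds that hold under every boundary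
  condition (\<open>msg_bounds_boundary\<close>), its iterates give an increasing sequence of lower bounds and a
  decreasing sequence of upper bounds for all messages, also inhomogeneous ones (\<open>msg_bounds_step\<close>).
  The limits of the two sequences form a solution (\<open>bounds_limits\<close>), which proves existence.

  If the solution is unique, then it equals its own mirror image \<open>(y, x)\<close>, the bounds meet, and the
  finite-volume probabilities on a fixed ball converge to one limit whatever the boundary condition
  is. So two Gibbs measures agree on all balls (\<open>gibbs_measure_unique\<close>). Conversely, every solution
  \<open>(x, y)\<close> yields a Gibbs measure, in which the messages at even and at odd levels are \<open>(x, f y)\<close> and
  \<open>(y, f x)\<close>: its marginals on balls are consistent and extend to the tree (\<open>solution_measure\<close>,
  \<open>gibbs_of_message_density\<close>). On an edge at the root this measure has
  \<open>P(1, 0) / P(0, 0) = x * f x\<close> and \<open>P(0, 1) / P(0, 0) = y * f y\<close>. As \<open>x * f x\<close> is strictly increasing,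
  the measure determines the solution (\<open>solution_determined\<close>), and so a unique Gibbs measure forces
  a unique solution.
\<close>

section \<open>Sums over spin configurations\<close>

lemma configs_insert: "c \<notin> C \<Longrightarrow> configs (insert c C) = (\<lambda>(y, g). g(c := y)) ` ({0, 1} \<times> configs C)"
  unfolding configs_def by (rule PiE_insert_eq)

lemma finite_configs: "finite S \<Longrightarrow> finite (configs S)"
  by (simp add: configs_def finite_PiE)

lemma configs_empty: "configs {} = {\<lambda>_. undefined}"
  by (simp add: configs_def)

lemma sum_configs_insert:
  assumes "c \<notin> C" "finite C"
  shows "(\<Sum>\<zeta>\<in>configs (insert c C). F \<zeta>) =
    (\<Sum>\<zeta>\<in>configs C. F (\<zeta>(c := 0))) + (\<Sum>\<zeta>\<in>configs C. F (\<zeta>(c := 1)))"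
proof -
  have inj: "inj_on (\<lambda>(y, g). g(c := y)) ({0, 1::nat} \<times> configs C)"
    using assms(1) unfolding configs_def by (rule inj_combinator)
  have "(\<Sum>\<zeta>\<in>configs (insert c C). F \<zeta>) = (\<Sum>(y, g)\<in>{0, 1::nat} \<times> configs C. F (g(c := y)))"
    unfolding configs_insert[OF assms(1)]
    by (subst sum.reindex[OF inj]) (simp add: case_prod_beta)
  also have "\<dots> = (\<Sum>y\<in>{0, 1::nat}. \<Sum>g\<in>configs C. F (g(c := y)))"
    using assms(2) by (subst sum.cartesian_product) simp
  finally show ?thesis by simp
qed

lemma restrict_configs: "A \<subseteq> U \<Longrightarrow> \<xi> \<in> configs U \<Longrightarrow> restrict \<xi> A \<in> configs A"
  by (auto simp: configs_def PiE_iff)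

lemma merge_configs: "x \<in> configs A \<Longrightarrow> y \<in> configs B \<Longrightarrow> merge A B (x, y) \<in> configs (A \<union> B)"
  by (auto simp: configs_def PiE_iff merge_def extensional_def)

lemma configs_spin: "\<xi> \<in> configs U \<Longrightarrow> i \<in> U \<Longrightarrow> \<xi> i = 0 \<or> \<xi> i = 1"
  by (auto simp: configs_def PiE_iff)

lemma configs_eqI: "x \<in> configs A \<Longrightarrow> y \<in> configs A \<Longrightarrow> (\<And>i. i \<in> A \<Longrightarrow> x i = y i) \<Longrightarrow> x = y"
  unfolding configs_def by (rule PiE_ext)

lemma restrict_id_configs: "\<xi> \<in> configs A \<Longrightarrow> restrict \<xi> A = \<xi>"
  by (auto simp: configs_def PiE_iff extensional_restrict)

lemma sum_configs_Un:
  assumes "A \<inter> B = {}"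
  shows "(\<Sum>\<xi>\<in>configs (A \<union> B). F \<xi>) = (\<Sum>\<nu>\<in>configs A. \<Sum>\<zeta>\<in>configs B. F (merge A B (\<nu>, \<zeta>)))"
proof -
  have m: "merge A B (restrict \<xi> A, restrict \<xi> B) = \<xi>" if "\<xi> \<in> configs (A \<union> B)" for \<xi>
    using that by (auto simp: configs_def PiE_iff extensional_def merge_def fun_eq_iff)
  have r: "restrict (merge A B (x, y)) A = x" "restrict (merge A B (x, y)) B = y"
    if "x \<in> configs A" "y \<in> configs B" for x y
    using that assms by (auto simp: configs_def PiE_iff extensional_def merge_def fun_eq_iff)
  have "(\<Sum>\<xi>\<in>configs (A \<union> B). F \<xi>) = (\<Sum>p\<in>configs A \<times> configs B. F (merge A B p))"
    by (intro sum.reindex_bij_witness[where i = "merge A B" and j =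
      "\<lambda>\<xi>. (restrict \<xi> A, restrict \<xi> B)"])
      (auto simp: m r restrict_id_configs intro: merge_configs restrict_configs)
  then show ?thesis by (simp add: sum.cartesian_product)
qed

lemma sum_configs_restrict:
  assumes "A \<subseteq> U" "\<omega> \<in> configs A"
  shows "(\<Sum>\<xi> | \<xi> \<in> configs U \<and> restrict \<xi> A = \<omega>. F \<xi>) =
    (\<Sum>\<zeta>\<in>configs (U - A). F (merge A (U - A) (\<omega>, \<zeta>)))"
proof -
  have m: "merge A (U - A) (\<omega>, restrict \<xi> (U - A)) = \<xi>" if "\<xi> \<in> configs U" "restrict \<xi> A = \<omega>" for \<xi>
    using that(1) assms(1) unfolding that(2)[symmetric]
    by (auto simp: configs_def PiE_iff extensional_def merge_def fun_eq_iff)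
  have r1: "restrict (merge A (U - A) (\<omega>, y)) A = \<omega>" for y
    using assms(2) by (simp add: restrict_id_configs)
  have r2: "restrict (merge A (U - A) (\<omega>, y)) (U - A) = y" if "y \<in> configs (U - A)" for y
    using that by (simp add: restrict_id_configs)
  have r3: "merge A (U - A) (\<omega>, y) \<in> configs U" if "y \<in> configs (U - A)" for y
    using merge_configs[OF assms(2) that] assms(1) by (simp add: Un_absorb1)
  show ?thesis
  proof (rule sum.reindex_bij_witness[where j = "\<lambda>\<xi>. restrict \<xi> (U - A)" and i =
    "\<lambda>\<zeta>. merge A (U - A) (\<omega>, \<zeta>)"])
    fix \<xi> assume \<xi>: "\<xi> \<in> {\<xi>. \<xi> \<in> configs U \<and> restrict \<xi> A = \<omega>}"
    then show "merge A (U - A) (\<omega>, restrict \<xi> (U - A)) = \<xi>" using m by blast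
    then show "F (merge A (U - A) (\<omega>, restrict \<xi> (U - A))) = F \<xi>" by (rule arg_cong)
    show "restrict \<xi> (U - A) \<in> configs (U - A)" using \<xi> by (auto intro: restrict_configs)
  next
    fix \<zeta> assume "\<zeta> \<in> configs (U - A)"
    then show "restrict (merge A (U - A) (\<omega>, \<zeta>)) (U - A) = \<zeta>"
      and "merge A (U - A) (\<omega>, \<zeta>) \<in> {\<xi>. \<xi> \<in> configs U \<and> restrict \<xi> A = \<omega>}"
      using r1 r2 r3 by blast+
  qed
qed

text \<open>Summing over the extensions of \<open>\<omega>\<close> to \<open>U\<close> can be done in two stages, through \<open>A'\<close>; this is
  what makes marginals of marginals marginals.\<close>

lemma sum_configs_tower:
  assumes "A \<subseteq> A'" "A' \<subseteq> U" "finite U"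
  shows "(\<Sum>\<xi> | \<xi> \<in> configs U \<and> restrict \<xi> A = \<omega>. F \<xi>) =
    (\<Sum>\<omega>' | \<omega>' \<in> configs A' \<and> restrict \<omega>' A = \<omega>. \<Sum>\<xi> | \<xi> \<in> configs U \<and> restrict \<xi> A' = \<omega>'. F \<xi>)"
proof -
  let ?S = "{\<xi>. \<xi> \<in> configs U \<and> restrict \<xi> A = \<omega>}"
  let ?T = "{\<omega>'. \<omega>' \<in> configs A' \<and> restrict \<omega>' A = \<omega>}"
  have f: "finite ?S" "finite ?T"
    using assms by (auto intro!: finite_subset[OF _ finite_configs] intro: finite_subset)
  have rr: "restrict (restrict \<xi> A') A = restrict \<xi> A" for \<xi> :: "node \<Rightarrow> nat"
    using assms(1) by (auto simp: fun_eq_iff)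
  have "sum F ?S = (\<Sum>\<omega>'\<in>?T. \<Sum>\<xi> | \<xi> \<in> ?S \<and> restrict \<xi> A' = \<omega>'. F \<xi>)"
    using assms(2) by (intro sum.group[symmetric] f) (auto intro: restrict_configs simp: rr simp
      del: restrict_restrict)
  also have "\<dots> = (\<Sum>\<omega>'\<in>?T. \<Sum>\<xi> | \<xi> \<in> configs U \<and> restrict \<xi> A' = \<omega>'. F \<xi>)"
    using rr by (intro sum.cong refl Collect_cong) auto
  finally show ?thesis .
qed

lemma sum_configs_fibres:
  assumes "A \<subseteq> U" "finite U"
  shows "(\<Sum>\<xi>\<in>configs U. F \<xi>) = (\<Sum>\<omega>\<in>configs A. \<Sum>\<xi> | \<xi> \<in> configs U \<and> restrict \<xi> A = \<omega>. F \<xi>)"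
  using assms by (intro sum.group[symmetric]) (auto intro: restrict_configs finite_configs
    finite_subset)

text \<open>Distributivity for spins on disjoint blocks. It is applied to the sets of children of the
  nodes of one level, which become independent once the spins of the levels above are fixed.\<close>

lemma sum_configs_UN_prod:
  assumes "finite I" "\<And>i. i \<in> I \<Longrightarrow> finite (C i)" "disjoint_family_on C I"
  shows "(\<Sum>\<zeta>\<in>configs (\<Union>i\<in>I. C i). \<Prod>i\<in>I. F i (restrict \<zeta> (C i))) =
    (\<Prod>i\<in>I. \<Sum>\<zeta>\<in>configs (C i). F i \<zeta> :: real)"
  using assms
proof (induction I rule: finite_induct)
  case (insert i I)
  have disj: "C i \<inter> (\<Union>i\<in>I. C i) = {}"
    using insert.prems(2) insert.hyps by (auto simp: disjoint_family_on_def)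
  have d: "disjoint_family_on C I"
    using insert.prems(2) by (auto simp: disjoint_family_on_def)
  have IH: "(\<Sum>\<zeta>\<in>configs (\<Union>i\<in>I. C i). \<Prod>i\<in>I. F i (restrict \<zeta> (C i))) = (\<Prod>i\<in>I. \<Sum>\<zeta>\<in>configs (C i). F i \<zeta>)"
    using insert.prems d by (intro insert.IH) auto
  have 1: "restrict (merge (C i) (\<Union>i\<in>I. C i) (\<nu>, \<zeta>)) (C i) = \<nu>" if "\<nu> \<in> configs (C i)" for \<nu> \<zeta>
    using that by (auto simp: configs_def PiE_iff extensional_def merge_def restrict_def fun_eq_iff)
  have 2: "restrict (merge (C i) (\<Union>i\<in>I. C i) (\<nu>, \<zeta>)) (C j) = restrict \<zeta> (C j)" if "j \<in> I" for \<nu> \<zeta> j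
    using that disj by (auto simp: merge_def restrict_def fun_eq_iff)
  have 3: "restrict \<nu> (C i) = \<nu>" if "\<nu> \<in> configs (C i)" for \<nu>
    using that by (rule restrict_id_configs)
  have "(\<Sum>\<zeta>\<in>configs (\<Union>i\<in>insert i I. C i). \<Prod>i\<in>insert i I. F i (restrict \<zeta> (C i))) =
    (\<Sum>\<nu>\<in>configs (C i). \<Sum>\<zeta>\<in>configs (\<Union>i\<in>I. C i). F i \<nu> * (\<Prod>i\<in>I. F i (restrict \<zeta> (C i))))"
    using insert.hyps disj by (simp add: sum_configs_Un 1 2 3 cong: sum.cong prod.cong)
  also have "\<dots> = (\<Sum>\<nu>\<in>configs (C i). F i \<nu>) * (\<Prod>i\<in>I. \<Sum>\<zeta>\<in>configs (C i). F i \<zeta>)"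
    unfolding IH[symmetric] sum_product ..
  also have "\<dots> = (\<Prod>i\<in>insert i I. \<Sum>\<zeta>\<in>configs (C i). F i \<zeta>)"
    using insert.hyps by simp
  finally show ?case .
qed (simp add: configs_empty)

section \<open>Log-convexity of the sums over the children of a node\<close>

text \<open>Up to a factor, the weight of a branch whose root is unoccupied: \<open>j\<close> is the spin of the parent
  and \<open>Y u t\<close> the weight of the branch at the child \<open>u\<close> when \<open>u\<close> has spin \<open>t\<close>.\<close>

definition child_sum :: "(nat \<Rightarrow> real) \<Rightarrow> node set \<Rightarrow> (node \<Rightarrow> nat \<Rightarrow> real) \<Rightarrow> nat \<Rightarrow> real" where
  "child_sum \<theta> C Y j = (\<Sum>\<zeta>\<in>configs C. \<theta> (j + (\<Sum>u\<in>C. \<zeta> u)) * (\<Prod>u\<in>C. Y u (\<zeta> u)))"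

lemma child_sum_empty [simp]: "child_sum \<theta> {} Y j = \<theta> j"
  by (simp add: child_sum_def configs_empty)

text \<open>Splitting by the spin of one child: an occupied child shifts the index of \<open>\<theta>\<close> by one. All
  estimates below are inductions along this recursion.\<close>

lemma child_sum_insert:
  assumes "c \<notin> C" "finite C"
  shows "child_sum \<theta> (insert c C) Y j = Y c 0 * child_sum \<theta> C Y j + Y c 1 * child_sum \<theta> C Y (Suc j)"
proof -
  have s: "(\<Sum>u\<in>C. (\<zeta>(c := t)) u) = (\<Sum>u\<in>C. \<zeta> u)" for \<zeta> :: "node \<Rightarrow> nat" and t
    using assms by (intro sum.cong) auto
  have p: "(\<Prod>u\<in>C. Y u ((\<zeta>(c := t)) u)) = (\<Prod>u\<in>C. Y u (\<zeta> u))" for \<zeta> :: "node \<Rightarrow> nat" and t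
    using assms by (intro prod.cong) auto
  show ?thesis
    unfolding child_sum_def sum_configs_insert[OF assms]
    using assms by (simp add: s p sum_distrib_left del: fun_upd_apply)
      (intro arg_cong2[of _ _ _ _ "(+)"] sum.cong refl; simp add: mult_ac)
qed

text \<open>The value of \<open>child_sum\<close> for \<open>n\<close> children that all send the ratio \<open>x\<close>; \<open>j = 0\<close> and \<open>j = 1\<close>
  give the denominator and the numerator of \<open>f_fun\<close>.\<close>

definition binomial_sum :: "(nat \<Rightarrow> real) \<Rightarrow> nat \<Rightarrow> real \<Rightarrow> nat \<Rightarrow> real" where
  "binomial_sum \<theta> n x j = (\<Sum>k=0..n. \<theta> (k + j) * real (n choose k) * x ^ k)"

lemma binomial_sum_0 [simp]: "binomial_sum \<theta> 0 x j = \<theta> j"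
  by (simp add: binomial_sum_def)

lemma binomial_sum_Suc: "binomial_sum \<theta> (Suc n) x j = binomial_sum \<theta> n x j + x *
  binomial_sum \<theta> n x (Suc j)"
proof -
  let ?g = "\<lambda>k. \<theta> (k + j) * x ^ k"
  have "binomial_sum \<theta> (Suc n) x j = (\<Sum>k\<le>Suc n. real (Suc n choose k) * ?g k)"
    unfolding binomial_sum_def by (simp add: atLeast0AtMost mult_ac)
  also have "\<dots> = ?g 0 + (\<Sum>k\<le>n. real (Suc n choose Suc k) * ?g (Suc k))"
    by (subst sum.atMost_Suc_shift) simp
  also have "\<dots> = (?g 0 + (\<Sum>k\<le>n. real (n choose Suc k) * ?g (Suc k))) + (\<Sum>k\<le>n. real (n choose k) *
    ?g (Suc k))"
    by (simp add: algebra_simps sum.distrib)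
  also have "?g 0 + (\<Sum>k\<le>n. real (n choose Suc k) * ?g (Suc k)) = (\<Sum>k\<le>Suc n. real (n choose k) * ?g k)"
    by (subst sum.atMost_Suc_shift) simp
  also have "\<dots> = binomial_sum \<theta> n x j"
    by (simp add: binomial_sum_def atLeast0AtMost mult_ac)
  also have "(\<Sum>k\<le>n. real (n choose k) * ?g (Suc k)) = x * binomial_sum \<theta> n x (Suc j)"
    by (simp add: binomial_sum_def atLeast0AtMost sum_distrib_left mult_ac)
  finally show ?thesis .
qed

lemma child_sum_const:
  assumes "finite C" "\<And>c. c \<in> C \<Longrightarrow> Y c 0 = 1" "\<And>c. c \<in> C \<Longrightarrow> Y c 1 = x"
  shows "child_sum \<theta> C Y j = binomial_sum \<theta> (card C) x j"
  using assms
proof (induction C arbitrary: j rule: finite_induct)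
  case (insert c C)
  then show ?case
    by (simp add: child_sum_insert binomial_sum_Suc)
qed simp

lemma tendsto_binomial_sum [tendsto_intros]: "(g \<longlongrightarrow> x) F \<Longrightarrow>
  ((\<lambda>k. binomial_sum \<theta> n (g k) j) \<longlongrightarrow> binomial_sum \<theta> n x j) F"
  unfolding binomial_sum_def by (intro tendsto_intros)

locale log_convex_model =
  fixes \<Delta> :: nat and lam :: real and \<theta> :: "nat \<Rightarrow> real"
  assumes Delta: "3 \<le> \<Delta>" and lam_pos: "0 < lam"
    and theta_pos: "\<And>k. k \<le> \<Delta> \<Longrightarrow> 0 < \<theta> k"
    and theta_log_convex: "\<And>k. k + 2 \<le> \<Delta> \<Longrightarrow> (\<theta> (Suc k))\<^sup>2 \<le> \<theta> k * \<theta> (Suc (Suc k))"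
begin

lemma child_sum_pos:
  assumes "finite C" "\<And>c. c \<in> C \<Longrightarrow> Y c 0 > 0" "\<And>c. c \<in> C \<Longrightarrow> Y c 1 \<ge> 0" "j + card C \<le> \<Delta>"
  shows "child_sum \<theta> C Y j > 0"
  using assms
proof (induction C arbitrary: j rule: finite_induct)
  case (insert c C)
  have "child_sum \<theta> C Y j > 0" "child_sum \<theta> C Y (Suc j) > 0"
    using insert by auto
  moreover have "Y c 0 > 0" "Y c 1 \<ge> 0"
    using insert.prems by auto
  ultimately show ?case
    using insert.hyps by (simp add: child_sum_insert add_pos_nonneg)
qed (simp add: theta_pos)

lemma binomial_sum_pos: "x \<ge> 0 \<Longrightarrow> j + n \<le> \<Delta> \<Longrightarrow> binomial_sum \<theta> n x j > 0"
proof (induction n arbitrary: j)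
  case (Suc n)
  have "binomial_sum \<theta> n x j > 0" "binomial_sum \<theta> n x (Suc j) > 0"
    using Suc by auto
  then show ?case
    using Suc.prems by (simp add: binomial_sum_Suc add_pos_nonneg)
qed (simp add: theta_pos)

text \<open>By the recursion, adding a child replaces a sequence \<open>e\<^sub>j\<close> by \<open>p * e\<^sub>j + q *
  e\<^sub>j\<^sub>+\<^sub>1\<close> with nonnegative \<open>p\<close>
  and \<open>q\<close>. Log-convexity survives, as a sum of two log-convex sequences is log-convex; the mixed
  terms are controlled by \<open>e\<^sub>1 * e\<^sub>2 \<le> e\<^sub>0 * e\<^sub>3\<close>.\<close>

lemma child_sum_log_convex:
  assumes "finite C" "\<And>c. c \<in> C \<Longrightarrow> Y c 0 > 0" "\<And>c. c \<in> C \<Longrightarrow> Y c 1 \<ge> 0" "j + 2 + card C \<le> \<Delta>"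
  shows "(child_sum \<theta> C Y (Suc j))\<^sup>2 \<le> child_sum \<theta> C Y j * child_sum \<theta> C Y (Suc (Suc j))"
  using assms
proof (induction C arbitrary: j rule: finite_induct)
  case empty
  then show ?case using theta_log_convex by simp
next
  case (insert c C)
  define p q where "p = Y c 0" and "q = Y c 1"
  define e0 e1 e2 e3 where "e0 = child_sum \<theta> C Y j" and "e1 = child_sum \<theta> C Y (Suc j)"
    and "e2 = child_sum \<theta> C Y (Suc (Suc j))" and "e3 = child_sum \<theta> C Y (Suc (Suc (Suc j)))"
  have pq: "p > 0" "q \<ge> 0" using insert by (auto simp: p_def q_def)
  have pos: "e0 > 0" "e1 > 0" "e2 > 0" "e3 > 0"
    unfolding e0_def e1_def e2_def e3_def using insert by (auto intro!: child_sum_pos)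
  have c1: "e1\<^sup>2 \<le> e0 * e2"
    unfolding e0_def e1_def e2_def using insert by auto
  have c2: "e2\<^sup>2 \<le> e1 * e3"
    unfolding e1_def e2_def e3_def using insert by auto
  have "(e1 * e2) * (e1 * e2) \<le> (e0 * e3) * (e1 * e2)"
    using mult_mono[OF c1 c2] pos by (simp add: power2_eq_square mult_ac)
  then have c3: "e1 * e2 \<le> e0 * e3"
    using pos by (metis mult_le_cancel_right_pos mult_pos_pos)
  have "(p * e1 + q * e2)\<^sup>2 = p\<^sup>2 * e1\<^sup>2 + 2 * (p * q) * (e1 * e2) + q\<^sup>2 * e2\<^sup>2"
    by (simp add: power2_eq_square algebra_simps)
  also have "\<dots> \<le> p\<^sup>2 * (e0 * e2) + (p * q) * (e1 * e2 + e0 * e3) + q\<^sup>2 * (e1 * e3)"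
  proof -
    have "p\<^sup>2 * e1\<^sup>2 \<le> p\<^sup>2 * (e0 * e2)" "q\<^sup>2 * e2\<^sup>2 \<le> q\<^sup>2 * (e1 * e3)"
      using c1 c2 by (auto intro: mult_left_mono)
    moreover have "(p * q) * (e1 * e2) \<le> (p * q) * (e0 * e3)"
      using c3 pq by (intro mult_left_mono) auto
    ultimately show ?thesis by (simp add: algebra_simps)
  qed
  also have "\<dots> = (p * e0 + q * e1) * (p * e2 + q * e3)"
    by (simp add: power2_eq_square algebra_simps)
  finally show ?case
    using insert.hyps by (simp add: child_sum_insert p_def q_def e0_def e1_def e2_def e3_def)
qed

text \<open>The point where log-convexity enters the theorem. Adding a child with ratio \<open>x\<close> turns
  consecutive quotients \<open>r \<le> R\<close> of the sums into \<open>r * (1 + x * R) / (1 + x * r)\<close>. This expression is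
  increasing in \<open>r\<close> and \<open>R\<close>, and because of \<open>r \<le> R\<close> also in \<open>x\<close>.\<close>

lemma child_sum_ratio_mono:
  assumes "finite C"
    and Y: "\<And>c. c \<in> C \<Longrightarrow> Y c 0 > 0" "\<And>c. c \<in> C \<Longrightarrow> Y c 1 \<ge> 0"
    and Y': "\<And>c. c \<in> C \<Longrightarrow> Y' c 0 > 0" "\<And>c. c \<in> C \<Longrightarrow> Y' c 1 \<ge> 0"
    and le: "\<And>c. c \<in> C \<Longrightarrow> Y c 1 / Y c 0 \<le> Y' c 1 / Y' c 0"
    and "Suc j + card C \<le> \<Delta>"
  shows "child_sum \<theta> C Y (Suc j) / child_sum \<theta> C Y j \<le> child_sum \<theta> C Y' (Suc j) / child_sum \<theta> C Y' j"
  using assms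
proof (induction C arbitrary: j rule: finite_induct)
  case (insert c C)
  have cd: "card (insert c C) = Suc (card C)" using insert by simp
  define x x' where "x = Y c 1 / Y c 0" and "x' = Y' c 1 / Y' c 0"
  define e0 e1 e2 where "e0 = child_sum \<theta> C Y j" and "e1 = child_sum \<theta> C Y (Suc j)"
    and "e2 = child_sum \<theta> C Y (Suc (Suc j))"
  define d0 d1 d2 where "d0 = child_sum \<theta> C Y' j" and "d1 = child_sum \<theta> C Y' (Suc j)"
    and "d2 = child_sum \<theta> C Y' (Suc (Suc j))"
  have Yc: "Y c 0 > 0" "Y c 1 \<ge> 0" "Y' c 0 > 0" "Y' c 1 \<ge> 0" using insert.prems by auto
  have x: "0 \<le> x" "x \<le> x'" using Yc insert.prems(5)[of c] by (auto simp: x_def x'_def)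
  have pos: "e0 > 0" "e1 > 0" "e2 > 0" "d0 > 0" "d1 > 0" "d2 > 0"
    unfolding e0_def e1_def e2_def d0_def d1_def d2_def using insert cd
      by (auto intro!: child_sum_pos)
  define r R r' R' where "r = e1 / e0" and "R = e2 / e1" and "r' = d1 / d0" and "R' = d2 / d1"
  have rpos: "r > 0" "R > 0" "r' > 0" "R' > 0" using pos by (auto simp: r_def R_def r'_def R'_def)
  have rr: "r \<le> r'" unfolding r_def r'_def e0_def e1_def d0_def d1_def
    using insert cd by auto
  have RR: "R \<le> R'" unfolding R_def R'_def e2_def e1_def d2_def d1_def
    using insert cd by auto
  have "e1\<^sup>2 \<le> e0 * e2" unfolding e0_def e1_def e2_def
    using insert cd by (intro child_sum_log_convex) auto
  then have rR: "r \<le> R" unfolding r_def R_def using pos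
    by (simp add: divide_simps power2_eq_square mult_ac)
  \<comment> \<open>the ratio for \<open>insert c C\<close> is \<open>r (1 + x R) / (1 + x r)\<close>\<close>
  have form: "child_sum \<theta> (insert c C) Y (Suc j) / child_sum \<theta> (insert c C) Y j =
    r * (1 + x * R) / (1 + x * r)"
  proof -
    have "r * (1 + x * R) / (1 + x * r) = (e1 + x * e2) / (e0 + x * e1)"
      using pos x(1) by (simp add: r_def R_def divide_simps add_pos_nonneg)
    also have "\<dots> = (Y c 0 * (e1 + x * e2)) / (Y c 0 * (e0 + x * e1))"
      using Yc by simp
    also have "Y c 0 * (e1 + x * e2) = Y c 0 * e1 + Y c 1 * e2"
      using Yc by (simp add: x_def algebra_simps)
    also have "Y c 0 * (e0 + x * e1) = Y c 0 * e0 + Y c 1 * e1"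
      using Yc by (simp add: x_def algebra_simps)
    finally show ?thesis
      using insert.hyps by (simp add: child_sum_insert e0_def e1_def e2_def)
  qed
  have form': "child_sum \<theta> (insert c C) Y' (Suc j) / child_sum \<theta> (insert c C) Y' j =
    r' * (1 + x' * R') / (1 + x' * r')"
  proof -
    have "r' * (1 + x' * R') / (1 + x' * r') = (d1 + x' * d2) / (d0 + x' * d1)"
      using pos x by (simp add: r'_def R'_def divide_simps add_pos_nonneg)
    also have "\<dots> = (Y' c 0 * (d1 + x' * d2)) / (Y' c 0 * (d0 + x' * d1))"
      using Yc by simp
    also have "Y' c 0 * (d1 + x' * d2) = Y' c 0 * d1 + Y' c 1 * d2"
      using Yc by (simp add: x'_def algebra_simps)
    also have "Y' c 0 * (d0 + x' * d1) = Y' c 0 * d0 + Y' c 1 * d1"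
      using Yc by (simp add: x'_def algebra_simps)
    finally show ?thesis
      using insert.hyps by (simp add: child_sum_insert d0_def d1_def d2_def)
  qed
  have den: "1 + x * r > 0" "1 + x' * r > 0" "1 + x' * r' > 0"
    using x rpos by (auto intro!: add_pos_nonneg)
  have "(1 + x * R) / (1 + x * r) \<le> (1 + x' * R) / (1 + x' * r)"
  proof -
    have "(1 + x' * R) * (1 + x * r) - (1 + x * R) * (1 + x' * r) = (x' - x) * (R - r)"
      by (simp add: algebra_simps)
    moreover have "(x' - x) * (R - r) \<ge> 0" using x rR by simp
    ultimately show ?thesis using den by (simp add: divide_simps)
  qed
  then have "r * (1 + x * R) / (1 + x * r) \<le> r / (1 + x' * r) * (1 + x' * R)"
    using rpos mult_left_mono[of _ _ r] by fastforce
  also have "\<dots> \<le> r' / (1 + x' * r') * (1 + x' * R')"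
  proof (intro mult_mono)
    show "r / (1 + x' * r) \<le> r' / (1 + x' * r')"
      using den rr by (simp add: divide_simps algebra_simps)
    show "1 + x' * R \<le> 1 + x' * R'" using RR x by (simp add: mult_left_mono)
    show "0 \<le> r' / (1 + x' * r')" using den rpos by simp
    show "0 \<le> 1 + x' * R" using x rpos by simp
  qed
  finally show ?case unfolding form form' by simp
qed simp

text \<open>Bounds on the ratios of the children reduce the inhomogeneous sums to homogeneous ones.\<close>

lemma child_sum_ge:
  assumes "finite C" "\<And>c. c \<in> C \<Longrightarrow> Y c 0 > 0" "\<And>c. c \<in> C \<Longrightarrow> l * Y c 0 \<le> Y c 1" "0 \<le> l" "j + card C \<le> \<Delta>"
  shows "(\<Prod>c\<in>C. Y c 0) * binomial_sum \<theta> (card C) l j \<le> child_sum \<theta> C Y j"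
  using assms
proof (induction C arbitrary: j rule: finite_induct)
  case (insert c C)
  let ?P = "\<Prod>c\<in>C. Y c 0"
  have P: "?P > 0" using insert by (intro prod_pos) auto
  have i: "?P * binomial_sum \<theta> (card C) l j \<le> child_sum \<theta> C Y j"
    "?P * binomial_sum \<theta> (card C) l (Suc j) \<le> child_sum \<theta> C Y (Suc j)"
    using insert by auto
  have h: "binomial_sum \<theta> (card C) l (Suc j) > 0" using insert by (intro binomial_sum_pos) auto
  have "Y c 0 * (?P * binomial_sum \<theta> (card C) l j) \<le> Y c 0 * child_sum \<theta> C Y j"
    using i insert.prems(1)[of c] by (intro mult_left_mono) auto
  moreover have "(l * Y c 0) * (?P * binomial_sum \<theta> (card C) l (Suc j)) \<le>
    Y c 1 * child_sum \<theta> C Y (Suc j)"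
    using i insert.prems(1,2)[of c] insert.prems(3) P h
    by (intro mult_mono) (auto intro: order_trans[of 0 "l * Y c 0"])
  ultimately show ?case
    using insert.hyps by (simp add: child_sum_insert binomial_sum_Suc algebra_simps)
qed simp

lemma child_sum_le:
  assumes "finite C" "\<And>c. c \<in> C \<Longrightarrow> Y c 0 > 0" "\<And>c. c \<in> C \<Longrightarrow> Y c 1 \<ge> 0" "\<And>c. c \<in> C \<Longrightarrow> Y c 1 \<le> u * Y c 0"
    "j + card C \<le> \<Delta>"
  shows "child_sum \<theta> C Y j \<le> (\<Prod>c\<in>C. Y c 0) * binomial_sum \<theta> (card C) u j"
  using assms
proof (induction C arbitrary: j rule: finite_induct)
  case (insert c C)
  let ?P = "\<Prod>c\<in>C. Y c 0"
  have P: "?P > 0" using insert by (intro prod_pos) auto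
  have i: "child_sum \<theta> C Y j \<le> ?P * binomial_sum \<theta> (card C) u j"
    "child_sum \<theta> C Y (Suc j) \<le> ?P * binomial_sum \<theta> (card C) u (Suc j)"
    using insert by auto
  have e: "child_sum \<theta> C Y (Suc j) > 0" using insert by (intro child_sum_pos) auto
  have "Y c 0 * child_sum \<theta> C Y j \<le> Y c 0 * (?P * binomial_sum \<theta> (card C) u j)"
    using i insert.prems(1)[of c] by (intro mult_left_mono) auto
  moreover have "Y c 1 * child_sum \<theta> C Y (Suc j) \<le> (u * Y c 0) * (?P *
    binomial_sum \<theta> (card C) u (Suc j))"
    using i insert.prems(1,2,3)[of c] P e
    by (intro mult_mono) (auto intro: order_trans[of 0 "Y c 1"])
  ultimately show ?case
    using insert.hyps by (simp add: child_sum_insert binomial_sum_Suc algebra_simps)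
qed simp

lemma binomial_sum_mono: "0 \<le> x \<Longrightarrow> x \<le> y \<Longrightarrow> j + n \<le> \<Delta> \<Longrightarrow> binomial_sum \<theta> n x j \<le> binomial_sum \<theta> n y j"
  unfolding binomial_sum_def
  by (intro sum_mono mult_mono power_mono mult_nonneg_nonneg less_imp_le[OF theta_pos])
    (auto intro: less_imp_le[OF theta_pos])

definition D :: "real \<Rightarrow> real" where "D x = binomial_sum \<theta> (\<Delta> - 1) x 0"
definition f :: "real \<Rightarrow> real" where "f x = binomial_sum \<theta> (\<Delta> - 1) x 1 / binomial_sum \<theta> (\<Delta> - 1) x 0"

lemma f_fun_eq: "f_fun \<Delta> \<theta> x = f x"
  by (simp add: f_fun_def f_def binomial_sum_def)

lemma g_fun_eq: "g_fun \<Delta> \<theta> x = 1 / D x"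
  by (simp add: g_fun_def D_def binomial_sum_def)

lemma D_pos: "0 \<le> x \<Longrightarrow> D x > 0"
  by (simp add: D_def binomial_sum_pos)

lemma D_mono: "0 \<le> x \<Longrightarrow> x \<le> y \<Longrightarrow> D x \<le> D y"
  by (simp add: D_def binomial_sum_mono)

lemma f_pos: "0 \<le> x \<Longrightarrow> f x > 0"
  using Delta by (simp add: f_def binomial_sum_pos)

lemma f_mono:
  assumes "0 \<le> x" "x \<le> y"
  shows "f x \<le> f y"
proof -
  obtain C :: "node set" where C: "finite C" "card C = \<Delta> - 1"
    using infinite_arbitrarily_large[OF infinite_UNIV_listI] by blast
  have e: "child_sum \<theta> C (\<lambda>_ t. if t = 1 then x else 1) j = binomial_sum \<theta> (\<Delta> - 1) x j" for x j
    using C by (subst child_sum_const) auto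
  show ?thesis
    using child_sum_ratio_mono[of C "\<lambda>_ t. if t = 1 then x else 1"
      "\<lambda>_ t. if t = 1 then y else 1" 0] C assms Delta
    unfolding f_def e by simp
qed

lemma tendsto_D [tendsto_intros]: "(g \<longlongrightarrow> x) F \<Longrightarrow> ((\<lambda>k. D (g k)) \<longlongrightarrow> D x) F"
  unfolding D_def by (intro tendsto_intros)

lemma tendsto_f: "(g \<longlongrightarrow> x) F \<Longrightarrow> 0 \<le> x \<Longrightarrow> ((\<lambda>k. f (g k)) \<longlongrightarrow> f x) F"
  unfolding f_def using binomial_sum_pos[of x 0 "\<Delta> - 1"] by (intro tendsto_intros) auto

section \<open>Monotone bounds on messages and their limits\<close>

text \<open>Bounds for the ratios \<open>a\<close> and \<open>b\<close> of every message. Quotients of consecutive entries of \<open>\<theta>\<close>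
  increase, and so \<open>b\<close>, a weighted mean of such quotients, lies between the first and the last one.
  The bound on \<open>a\<close> keeps only the term \<open>\<theta> 0\<close> of the denominator \<open>D\<close>.\<close>

definition bmin :: real where "bmin = \<theta> 1 / \<theta> 0"
definition bmax :: real where "bmax = \<theta> \<Delta> / \<theta> (\<Delta> - 1)"
definition amax :: real where "amax = lam * bmax ^ (\<Delta> - 1) / \<theta> 0"

lemma theta_ratio_mono:
  assumes "j \<le> k" "Suc k \<le> \<Delta>"
  shows "\<theta> (Suc j) / \<theta> j \<le> \<theta> (Suc k) / \<theta> k"
  using assms
proof (induction k rule: dec_induct)
  case (step k)
  have "\<theta> (Suc k) / \<theta> k \<le> \<theta> (Suc (Suc k)) / \<theta> (Suc k)"
    using theta_log_convex[of k] theta_pos[of k] theta_pos[of "Suc k"] step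
    by (simp add: divide_simps power2_eq_square mult_ac)
  then show ?case using step by simp
qed simp

lemma theta_ratio_bounds:
  assumes "Suc k \<le> \<Delta>"
  shows "bmin \<le> \<theta> (Suc k) / \<theta> k" "\<theta> (Suc k) / \<theta> k \<le> bmax"
  using theta_ratio_mono[of 0 k] theta_ratio_mono[of k "\<Delta> - 1"] assms
    by (auto simp: bmin_def bmax_def)

lemma bmin_pos: "bmin > 0" and bmax_pos: "bmax > 0" and amax_pos: "amax > 0"
proof -
  have "\<theta> 0 > 0" "\<theta> 1 > 0" "\<theta> \<Delta> > 0" "\<theta> (\<Delta> - 1) > 0"
    using Delta by (auto intro: theta_pos)
  then show "bmin > 0" "bmax > 0" "amax > 0"
    using lam_pos by (auto simp: bmin_def bmax_def amax_def)
qed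

lemma bmin_le_bmax: "bmin \<le> bmax"
  using theta_ratio_bounds[of 0] Delta by simp

lemma f_0: "f 0 = bmin"
proof -
  have "binomial_sum \<theta> n 0 j = \<theta> j" for n j
    by (induction n arbitrary: j) (auto simp: binomial_sum_Suc)
  then show ?thesis by (simp add: f_def bmin_def)
qed

lemma D_0: "D 0 = \<theta> 0"
proof -
  have "binomial_sum \<theta> n 0 j = \<theta> j" for n j
    by (induction n arbitrary: j) (auto simp: binomial_sum_Suc)
  then show ?thesis by (simp add: D_def)
qed

lemma f_le_bmax:
  assumes "0 \<le> x" shows "f x \<le> bmax"
proof -
  have "binomial_sum \<theta> n x (Suc j) \<le> bmax * binomial_sum \<theta> n x j" if "Suc j + n \<le> \<Delta>" for n j
    using that
  proof (induction n arbitrary: j)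
    case 0
    then show ?case using theta_ratio_bounds[of j] theta_pos[of j] by (simp add: divide_simps)
  next
    case (Suc n)
    have "binomial_sum \<theta> n x (Suc j) \<le> bmax * binomial_sum \<theta> n x j"
      "binomial_sum \<theta> n x (Suc (Suc j)) \<le> bmax * binomial_sum \<theta> n x (Suc j)"
      using Suc by auto
    then show ?case using mult_left_mono[OF _ assms] by (fastforce simp: binomial_sum_Suc
      algebra_simps)
  qed
  from this[of 0 "\<Delta> - 1"] show ?thesis
    using Delta binomial_sum_pos[OF assms, of 0 "\<Delta> - 1"] by (simp add: f_def divide_simps mult_ac)
qed

text \<open>The effect of the message map on bounds \<open>l \<le> a \<le> u\<close> and \<open>al \<le> b \<le> be\<close>. In the order
  in which \<open>a\<close> grows and \<open>b\<close> decreases the bounds are the pairs \<open>(l, be)\<close> and \<open>(u, al)\<close>. The map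
  is antitone, so it sends the upper pair to the new lower pair and vice versa.\<close>

fun bound_step :: "real \<times> real \<times> real \<times> real \<Rightarrow> real \<times> real \<times> real \<times> real" where
  "bound_step (l, u, al, be) = (lam * al ^ (\<Delta> - 1) / D u, lam * be ^ (\<Delta> - 1) / D l, f l, f u)"

definition bounds :: "nat \<Rightarrow> real \<times> real \<times> real \<times> real" where
  "bounds k = (bound_step ^^ k) (0, amax, bmin, bmax)"

definition "lo k = fst (bounds k)"
definition "up k = fst (snd (bounds k))"
definition "al k = fst (snd (snd (bounds k)))"
definition "be k = snd (snd (snd (bounds k)))"

lemma bounds_0: "lo 0 = 0" "up 0 = amax" "al 0 = bmin" "be 0 = bmax"
  by (auto simp: lo_def up_def al_def be_def bounds_def)

lemma bounds_Suc:
  "lo (Suc k) = lam * al k ^ (\<Delta> - 1) / D (up k)"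
  "up (Suc k) = lam * be k ^ (\<Delta> - 1) / D (lo k)"
  "al (Suc k) = f (lo k)" "be (Suc k) = f (up k)"
  unfolding lo_def up_def al_def be_def by (cases "bounds k"; simp add: bounds_def)+

lemma bounds_order: "0 \<le> lo k \<and> lo k \<le> up k \<and> 0 < al k \<and> al k \<le> be k"
proof (induction k)
  case 0
  then show ?case using amax_pos bmin_pos bmin_le_bmax by (simp add: bounds_0)
next
  case (Suc k)
  then have "D (lo k) \<le> D (up k)" "0 < D (lo k)" by (auto simp: D_mono D_pos)
  moreover have "al k ^ (\<Delta> - 1) \<le> be k ^ (\<Delta> - 1)" "0 \<le> al k ^ (\<Delta> - 1)"
    using Suc by (auto intro: power_mono)
  ultimately show ?case
    using Suc lam_pos by (auto simp: bounds_Suc f_pos f_mono intro!: frac_le mult_left_mono)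
qed

lemma bounds_step_mono:
  "lo k \<le> lo (Suc k) \<and> up (Suc k) \<le> up k \<and> al k \<le> al (Suc k) \<and> be (Suc k) \<le> be k"
proof (induction k)
  case 0
  show ?case
    using amax_pos bmin_pos bmin_le_bmax lam_pos D_pos[of amax] f_le_bmax[of amax]
    by (auto simp: bounds_0 bounds_Suc f_0 D_0 amax_def)
next
  case (Suc k)
  note o = bounds_order[of k] bounds_order[of "Suc k"]
  have D: "D (up (Suc k)) \<le> D (up k)" "D (lo k) \<le> D (lo (Suc k))" "0 < D (up (Suc k))" "0 < D (lo k)"
    using Suc o by (auto intro!: D_mono D_pos)
  have "al k ^ (\<Delta> - 1) \<le> al (Suc k) ^ (\<Delta> - 1)" "be (Suc k) ^ (\<Delta> - 1) \<le> be k ^ (\<Delta> - 1)"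
    using Suc o by (auto intro!: power_mono)
  then have "lo (Suc k) \<le> lo (Suc (Suc k))" "up (Suc (Suc k)) \<le> up (Suc k)"
    unfolding bounds_Suc(1,2)[of "Suc k"] unfolding bounds_Suc(1)[of k] bounds_Suc(2)[of k]
      using D o lam_pos
    by - (intro frac_le mult_left_mono mult_nonneg_nonneg; simp add: bounds_Suc)+
  moreover have "al (Suc k) \<le> al (Suc (Suc k))" "be (Suc (Suc k)) \<le> be (Suc k)"
    unfolding bounds_Suc(3,4)[of "Suc k"] unfolding bounds_Suc(3)[of k] bounds_Suc(4)[of k]
      using Suc o by (auto intro!: f_mono)
  ultimately show ?case by simp
qed

lemma solutions_iff:
  "(x, y) \<in> system_solutions \<Delta> lam \<theta> \<longleftrightarrow> 0 \<le> x \<and> 0 \<le> y \<and>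
     x = lam * f x ^ (\<Delta> - 1) / D y \<and> y = lam * f y ^ (\<Delta> - 1) / D x"
  by (simp add: system_solutions_def f_fun_eq g_fun_eq)

text \<open>The bounds are monotone and bounded, hence convergent. In the limit the recursion
  \<open>bounds_Suc\<close> becomes the system of equations.\<close>

lemma bounds_limits:
  obtains x y where "lo \<longlonglongrightarrow> x" "up \<longlonglongrightarrow> y" "al \<longlonglongrightarrow> f x" "be \<longlonglongrightarrow> f y"
    "(x, y) \<in> system_solutions \<Delta> lam \<theta>"
proof -
  have m: "incseq lo" "decseq up" "incseq al" "decseq be"
    using bounds_step_mono by (auto simp: incseq_Suc_iff decseq_Suc_iff)
  have "lo k \<le> up 0" for k
    using bounds_order[of k] decseqD[OF m(2), of 0 k] by simp
  with m(1) obtain x where x: "lo \<longlonglongrightarrow> x" "\<And>k. lo k \<le> x" using incseq_convergent by metis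
  have "0 \<le> up k" for k
    using bounds_order[of k] by simp
  with m(2) obtain y where y: "up \<longlonglongrightarrow> y" "\<And>k. y \<le> up k" using decseq_convergent by metis
  have x0: "0 \<le> x" using x(2)[of 0] by (simp add: bounds_0)
  have y0: "0 \<le> y" by (rule LIMSEQ_le_const[OF y(1)]) (use bounds_order order_trans in blast)
  have "(\<lambda>k. al (Suc k)) \<longlonglongrightarrow> f x" "(\<lambda>k. be (Suc k)) \<longlonglongrightarrow> f y"
    unfolding bounds_Suc using x y x0 y0 by (auto intro: tendsto_f)
  then have ab: "al \<longlonglongrightarrow> f x" "be \<longlonglongrightarrow> f y" by (simp_all only: filterlim_sequentially_Suc)
  have "(\<lambda>k. lo (Suc k)) \<longlonglongrightarrow> lam * f x ^ (\<Delta> - 1) / D y"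
    unfolding bounds_Suc using D_pos[OF y0] by (intro tendsto_intros ab y) simp
  then have ex: "x = lam * f x ^ (\<Delta> - 1) / D y"
    using LIMSEQ_Suc[OF x(1)] LIMSEQ_unique by blast
  have "(\<lambda>k. up (Suc k)) \<longlonglongrightarrow> lam * f y ^ (\<Delta> - 1) / D x"
    unfolding bounds_Suc using D_pos[OF x0] by (intro tendsto_intros ab x) simp
  then have ey: "y = lam * f y ^ (\<Delta> - 1) / D x"
    using LIMSEQ_Suc[OF y(1)] LIMSEQ_unique by blast
  show ?thesis
    using that x(1) y(1) ab ex ey x0 y0 by (simp add: solutions_iff)
qed

end

section \<open>Levels of the tree and the weights of the nodes\<close>

lemma exp_neg_add: "a \<noteq> -\<infinity> \<Longrightarrow> b \<noteq> -\<infinity> \<Longrightarrow> exp_neg (a + b) = exp_neg a * exp_neg b"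
  by (cases a; cases b) (auto simp: exp_neg_def exp_add[symmetric])

lemma exp_neg_sum:
  assumes "finite I" "\<And>i. i \<in> I \<Longrightarrow> F i \<noteq> -\<infinity>"
  shows "exp_neg (\<Sum>i\<in>I. F i) = (\<Prod>i\<in>I. exp_neg (F i)) \<and> (\<Sum>i\<in>I. F i) \<noteq> -\<infinity>"
  using assms
proof (induction I rule: finite_induct)
  case empty
  then show ?case by (simp add: exp_neg_def)
next
  case (insert i I)
  then show ?case by (simp add: exp_neg_add)
qed

context log_convex_model
begin

abbreviation "T \<equiv> tree_nodes \<Delta>"
text \<open>The ball and the sphere of radius \<open>n\<close> around the root.\<close>

definition "B n = {v \<in> T. length v \<le> n}"
definition "L n = {v \<in> T. length v = n}"
definition children :: "node \<Rightarrow> node set" where "children v = {u \<in> T. \<exists>a. u = v @ [a]}"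
definition neighbors :: "node \<Rightarrow> node set" where "neighbors v = {u. tree_adj \<Delta> v u}"

lemma finite_L: "finite (L n)"
proof -
  have "L n \<subseteq> {xs. set xs \<subseteq> {..<\<Delta>} \<and> length xs = n}"
    by (auto simp: L_def tree_nodes_def)
  then show ?thesis by (rule finite_subset) (rule finite_lists_length_eq, simp)
qed

lemma B_Suc: "B (Suc n) = B n \<union> L (Suc n)"
  by (auto simp: B_def L_def)

lemma B_0: "B 0 = {[]}"
  by (auto simp: B_def Nil_in_tree_nodes)

lemma finite_B: "finite (B n)"
  by (induction n) (auto simp: B_0 B_Suc finite_L)

lemma B_subset_T: "B n \<subseteq> T" and L_subset_T: "L n \<subseteq> T"
  by (auto simp: B_def L_def)

lemma B_mono: "m \<le> n \<Longrightarrow> B m \<subseteq> B n"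
  by (auto simp: B_def)

lemma B_L_disjoint: "B n \<inter> L (Suc n) = {}"
  by (auto simp: B_def L_def)

lemma B_diff: "B (Suc n) - B n = L (Suc n)"
  by (auto simp: B_def L_def)

lemma prefix_in_T: "v @ [a] \<in> T \<Longrightarrow> v \<in> T"
  by (simp add: snoc_in_tree_nodes)

lemma L_Suc: "L (Suc n) = (\<Union>v\<in>L n. children v)"
proof (intro set_eqI iffI)
  fix u assume u: "u \<in> L (Suc n)"
  then obtain v a where "u = v @ [a]" by (cases u rule: rev_cases) (auto simp: L_def)
  then show "u \<in> (\<Union>v\<in>L n. children v)"
    using u by (auto simp: L_def children_def intro: prefix_in_T)
qed (auto simp: L_def children_def)

lemma children_disjoint: "disjoint_family_on children A"
  by (auto simp: disjoint_family_on_def children_def)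

lemma finite_children: "finite (children v)"
  by (rule finite_subset[OF _ finite_L[of "Suc (length v)"]]) (auto simp: L_def children_def)

lemma butlast_children: "u \<in> children v \<Longrightarrow> butlast u = v"
  by (auto simp: children_def)

lemma card_children:
  assumes "v \<in> T"
  shows "card (children v) = (if v = [] then \<Delta> else \<Delta> - 1)"
proof -
  have "children v = (\<lambda>a. v @ [a]) ` {..<(if v = [] then \<Delta> else \<Delta> - 1)}"
  proof (intro set_eqI iffI)
    fix u assume "u \<in> children v"
    then obtain a where "u = v @ [a]" "v @ [a] \<in> T" unfolding children_def by blast
    then show "u \<in> (\<lambda>a. v @ [a]) ` {..<(if v = [] then \<Delta> else \<Delta> - 1)}"
      unfolding snoc_in_tree_nodes by blast
  next
    fix u assume "u \<in> (\<lambda>a. v @ [a]) ` {..<(if v = [] then \<Delta> else \<Delta> - 1)}"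
    then obtain a where "u = v @ [a]" "a < (if v = [] then \<Delta> else \<Delta> - 1)" by blast
    then show "u \<in> children v" using assms snoc_in_tree_nodes[of v a \<Delta>] unfolding children_def by
      blast
  qed
  then show ?thesis by (simp add: card_image inj_on_def)
qed

lemma butlast_in_T: "v \<in> T \<Longrightarrow> butlast v \<in> T"
  by (cases v rule: rev_cases) (auto intro: prefix_in_T)

lemma neighbors_eq: "v \<in> T \<Longrightarrow> neighbors v = children v \<union> (if v = [] then {} else {butlast v})"
  by (cases v rule: rev_cases) (auto simp: neighbors_def children_def tree_adj_def intro: prefix_in_T)

lemma finite_neighbors: "v \<in> T \<Longrightarrow> finite (neighbors v)"
  by (simp add: neighbors_eq finite_children)

lemma card_neighbors: "v \<in> T \<Longrightarrow> card (neighbors v) = \<Delta>"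
  using tree_adj_nbrs[of \<Delta> v] Delta by (simp add: neighbors_def)

lemma neighbors_subset_T: "neighbors v \<subseteq> T"
  by (auto simp: neighbors_def tree_adj_def)

lemma self_not_neighbors: "v \<notin> neighbors v"
  by (auto simp: neighbors_def tree_adj_def)

lemma neighbors_sym: "u \<in> neighbors v \<longleftrightarrow> v \<in> neighbors u"
  by (auto simp: neighbors_def tree_adj_sym)

lemma nbhd_eq: "nbhd \<Delta> v = insert v (neighbors v)"
  by (simp add: nbhd_def neighbors_def)

lemma neighbors_length: "u \<in> neighbors v \<Longrightarrow> length u \<le> Suc (length v) \<and> length v \<le> Suc (length u)"
  by (auto simp: neighbors_def tree_adj_def)

lemma neighbors_B: "v \<in> B n \<Longrightarrow> neighbors v \<subseteq> B (Suc n)"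
  using neighbors_length neighbors_subset_T by (fastforce simp: B_def)

lemma bdry_iff:
  assumes "\<Lambda> \<subseteq> T"
  shows "j \<in> bdry \<Delta> \<Lambda> \<longleftrightarrow> j \<in> T - \<Lambda> \<and> (\<exists>i\<in>\<Lambda>. j \<in> neighbors i \<or> (\<exists>k. k \<in> neighbors i \<and> j \<in> neighbors k))"
proof -
  have "tree_dist \<Delta> i j \<le> 2 \<longleftrightarrow> j \<in> neighbors i \<or> (\<exists>k. k \<in> neighbors i \<and> j \<in> neighbors k)"
    if i: "i \<in> T" and j: "j \<in> T" and ne: "i \<noteq> j" for i j
  proof
    assume d: "tree_dist \<Delta> i j \<le> 2"
    have "\<exists>n. (tree_adj \<Delta> ^^ n) i j"
      using regular_tree_tree_nodes[of \<Delta>] Delta i j unfolding regular_tree_def by auto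
    then have "(tree_adj \<Delta> ^^ tree_dist \<Delta> i j) i j"
      unfolding tree_dist_def by (rule LeastI_ex)
    moreover have "tree_dist \<Delta> i j = 0 \<or> tree_dist \<Delta> i j = Suc 0 \<or> tree_dist \<Delta> i j = Suc (Suc 0)"
      using d by auto
    ultimately show "j \<in> neighbors i \<or> (\<exists>k. k \<in> neighbors i \<and> j \<in> neighbors k)"
      using ne by (auto simp: neighbors_def)
  next
    assume "j \<in> neighbors i \<or> (\<exists>k. k \<in> neighbors i \<and> j \<in> neighbors k)"
    then have "(tree_adj \<Delta> ^^ 1) i j \<or> (tree_adj \<Delta> ^^ (Suc (Suc 0))) i j"
      by (auto simp: neighbors_def)
    then show "tree_dist \<Delta> i j \<le> 2"
      unfolding tree_dist_def by (metis Least_le One_nat_def Suc_1 le_SucI order_refl le_trans)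
  qed
  then show ?thesis
    unfolding bdry_def using assms by blast
qed

text \<open>The nodes whose potential enters the Hamiltonian of the volume \<open>\<Lambda>\<close>.\<close>

definition affected :: "node set \<Rightarrow> node set" where "affected \<Lambda> = {i \<in> T. nbhd \<Delta> i \<inter> \<Lambda> \<noteq> {}}"

lemma affected_subset: 
  assumes "\<Lambda> \<subseteq> T"
  shows "affected \<Lambda> \<subseteq> \<Lambda> \<union> (\<Union>i\<in>\<Lambda>. neighbors i)"
  using neighbors_sym by (auto simp: affected_def nbhd_eq)

lemma finite_affected: "finite \<Lambda> \<Longrightarrow> \<Lambda> \<subseteq> T \<Longrightarrow> finite (affected \<Lambda>)"
  by (rule finite_subset[OF affected_subset]) (auto intro!: finite_neighbors)

lemma nbhd_affected_subset:
  assumes "\<Lambda> \<subseteq> T" "i \<in> affected \<Lambda>"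
  shows "nbhd \<Delta> i \<subseteq> \<Lambda> \<union> bdry \<Delta> \<Lambda>"
proof
  fix j assume j: "j \<in> nbhd \<Delta> i"
  obtain k where k: "k \<in> \<Lambda>" "k = i \<or> k \<in> neighbors i" and iT: "i \<in> T"
    using assms by (auto simp: affected_def nbhd_eq)
  have jT: "j \<in> T" using j iT neighbors_subset_T by (auto simp: nbhd_eq)
  show "j \<in> \<Lambda> \<union> bdry \<Delta> \<Lambda>"
    using j k jT neighbors_sym by (auto simp: bdry_iff[OF assms(1)] nbhd_eq)
qed

lemma finite_bdry:
  assumes "finite \<Lambda>" "\<Lambda> \<subseteq> T" shows "finite (bdry \<Delta> \<Lambda>)"
proof (rule finite_subset)
  show "bdry \<Delta> \<Lambda> \<subseteq> (\<Union>i\<in>\<Lambda>. neighbors i) \<union> (\<Union>i\<in>\<Lambda>. \<Union>k\<in>neighbors i. neighbors k)"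
    by (auto simp: bdry_iff[OF assms(2)])
  show "finite ((\<Union>i\<in>\<Lambda>. neighbors i) \<union> (\<Union>i\<in>\<Lambda>. \<Union>k\<in>neighbors i. neighbors k))"
    using assms neighbors_subset_T by (auto intro!: finite_neighbors)
qed

lemma bdry_subset_T: "bdry \<Delta> \<Lambda> \<subseteq> T - \<Lambda>"
  by (auto simp: bdry_def)

lemma bdry_B: "bdry \<Delta> (B n) = L (Suc n) \<union> L (Suc (Suc n))"
proof (intro set_eqI iffI)
  fix j assume "j \<in> bdry \<Delta> (B n)"
  then have j: "j \<in> T" "j \<notin> B n" and "\<exists>i\<in>B n. j \<in> neighbors i \<or> (\<exists>k. k \<in> neighbors i \<and>
    j \<in> neighbors k)"
    by (auto simp: bdry_iff[OF B_subset_T])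
  then obtain i where i: "i \<in> B n" "j \<in> neighbors i \<or> (\<exists>k. k \<in> neighbors i \<and> j \<in> neighbors k)"
    by blast
  have "length j \<le> Suc (Suc (length i))"
    using i(2) by (auto dest!: neighbors_length)
  then have "length j \<le> Suc (Suc n)" using i(1) by (auto simp: B_def)
  with j have "j \<in> T" "j \<notin> B n" "length j \<le> Suc (Suc n)" by auto
  then show "j \<in> L (Suc n) \<union> L (Suc (Suc n))"
    by (auto simp: B_def L_def)
next
  fix j assume "j \<in> L (Suc n) \<union> L (Suc (Suc n))"
  then consider "j \<in> L (Suc n)" | "j \<in> L (Suc (Suc n))" by blast
  then show "j \<in> bdry \<Delta> (B n)"
  proof cases
    case 1
    then obtain v where v: "v \<in> L n" "j \<in> children v" by (auto simp: L_Suc)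
    then have "v \<in> B n" "j \<in> neighbors v" by (auto simp: L_def B_def neighbors_eq)
    moreover have "j \<in> T - B n" using 1 by (auto simp: L_def B_def)
    ultimately show ?thesis unfolding bdry_iff[OF B_subset_T] by blast
  next
    case 2
    then obtain w where w: "w \<in> L (Suc n)" "j \<in> children w" by (auto simp: L_Suc[of "Suc n"])
    then obtain v where v: "v \<in> L n" "w \<in> children v" by (auto simp: L_Suc)
    have "v \<in> B n" "w \<in> neighbors v" using v by (auto simp: L_def B_def neighbors_eq)
    moreover have "j \<in> neighbors w" using w by (auto simp: L_def neighbors_eq)
    moreover have "j \<in> T - B n" using 2 by (auto simp: L_def B_def)
    ultimately show ?thesis unfolding bdry_iff[OF B_subset_T] by blast
  qed
qed

text \<open>The exponential of minus the potential of a node with spin \<open>t\<close> and \<open>k\<close> occupied neighbors.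
  Only \<open>t = 0\<close> and \<open>t = 1\<close> occur.\<close>

definition spin_weight :: "nat \<Rightarrow> nat \<Rightarrow> real" where
  "spin_weight t k = (if t = 1 then (if k = 0 then lam else 0) else \<theta> k)"

definition node_weight :: "node \<Rightarrow> (node \<Rightarrow> nat) \<Rightarrow> real" where
  "node_weight v \<xi> = spin_weight (\<xi> v) (\<Sum>u\<in>neighbors v. \<xi> u)"

lemma sum_spins_le:
  assumes "\<And>u. u \<in> C \<Longrightarrow> \<xi> u = 0 \<or> \<xi> u = (1::nat)"
  shows "(\<Sum>u\<in>C. \<xi> u) \<le> card C"
proof -
  have "(\<Sum>u\<in>C. \<xi> u) \<le> (\<Sum>u\<in>C. 1)" using assms by (intro sum_mono) fastforce
  then show ?thesis by simp
qed

lemma exp_neg_potential: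
  assumes "v \<in> T" "\<And>u. u \<in> nbhd \<Delta> v \<Longrightarrow> \<xi> u = 0 \<or> \<xi> u = 1"
  shows "exp_neg (potential \<Delta> lam \<theta> v (restrict \<xi> (nbhd \<Delta> v))) = node_weight v \<xi>"
    and "potential \<Delta> lam \<theta> v (restrict \<xi> (nbhd \<Delta> v)) \<noteq> -\<infinity>"
proof -
  have s: "(\<Sum>j\<in>nbhd \<Delta> v. restrict \<xi> (nbhd \<Delta> v) j) = \<xi> v + (\<Sum>u\<in>neighbors v. \<xi> u)"
    using finite_neighbors[OF assms(1)] self_not_neighbors by (simp add: nbhd_eq)
  have v: "\<xi> v = 0 \<or> \<xi> v = 1" using assms(2) by (simp add: nbhd_eq)
  have "(\<Sum>u\<in>neighbors v. \<xi> u) \<le> card (neighbors v)" using assms(2)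
    by (intro sum_spins_le) (simp add: nbhd_eq)
  then have "\<theta> (\<Sum>u\<in>neighbors v. \<xi> u) > 0" using card_neighbors[OF assms(1)] by (simp add: theta_pos)
  then show "exp_neg (potential \<Delta> lam \<theta> v (restrict \<xi> (nbhd \<Delta> v))) = node_weight v \<xi>"
    and "potential \<Delta> lam \<theta> v (restrict \<xi> (nbhd \<Delta> v)) \<noteq> -\<infinity>"
    using v lam_pos unfolding potential_def s by (auto simp: nbhd_eq node_weight_def spin_weight_def
      exp_neg_def)
qed

lemma exp_neg_hamiltonian:
  assumes "finite \<Lambda>" "\<Lambda> \<subseteq> T" "\<And>u. u \<in> \<Lambda> \<union> bdry \<Delta> \<Lambda> \<Longrightarrow> \<xi> u = 0 \<or> \<xi> u = 1"
  shows "exp_neg (hamiltonian \<Delta> lam \<theta> \<Lambda> \<xi>) = (\<Prod>i\<in>affected \<Lambda>. node_weight i \<xi>)"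
proof -
  have s: "\<xi> u = 0 \<or> \<xi> u = 1" if "i \<in> affected \<Lambda>" "u \<in> nbhd \<Delta> i" for i u
    using nbhd_affected_subset[OF assms(2) that(1)] that(2) assms(3) by auto
  have "exp_neg (hamiltonian \<Delta> lam \<theta> \<Lambda> \<xi>) = (\<Prod>i\<in>affected \<Lambda>.
    exp_neg (potential \<Delta> lam \<theta> i (restrict \<xi> (nbhd \<Delta> i))))"
    unfolding hamiltonian_def affected_def[symmetric]
    using exp_neg_sum[OF finite_affected[OF assms(1,2)]] exp_neg_potential(2) s
      by (auto simp: affected_def)
  also have "\<dots> = (\<Prod>i\<in>affected \<Lambda>. node_weight i \<xi>)"
    using exp_neg_potential(1) s by (intro prod.cong) (auto simp: affected_def)
  finally show ?thesis .
qed

lemma node_weight_cong: "(\<And>u. u \<in> nbhd \<Delta> v \<Longrightarrow> \<xi> u = \<xi>' u) \<Longrightarrow> node_weight v \<xi> = node_weight v \<xi>'"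
  unfolding node_weight_def by (intro arg_cong2[of _ _ _ _ spin_weight] sum.cong) (auto simp: nbhd_eq)

lemma node_weight_nonneg:
  assumes "v \<in> T" "\<And>u. u \<in> nbhd \<Delta> v \<Longrightarrow> \<xi> u = 0 \<or> \<xi> u = 1"
  shows "node_weight v \<xi> \<ge> 0"
proof -
  have "(\<Sum>u\<in>neighbors v. \<xi> u) \<le> card (neighbors v)" using assms(2)
    by (intro sum_spins_le) (simp add: nbhd_eq)
  then have "\<theta> (\<Sum>u\<in>neighbors v. \<xi> u) > 0" using card_neighbors[OF assms(1)] by (simp add: theta_pos)
  then show ?thesis using lam_pos by (simp add: node_weight_def spin_weight_def)
qed

lemma node_weight_nonneg_B:
  assumes "\<xi> \<in> configs (B (Suc n))" "v \<in> B n"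
  shows "0 \<le> node_weight v \<xi>"
proof (rule node_weight_nonneg)
  show "v \<in> T" using assms(2) by (auto simp: B_def)
  show "\<xi> u = 0 \<or> \<xi> u = 1" if "u \<in> nbhd \<Delta> v" for u
    using configs_spin[OF assms(1)] neighbors_B[OF assms(2)] assms(2) B_mono[of n "Suc n"] that
    by (auto simp: nbhd_eq)
qed

lemma node_weight_child:
  assumes "v \<in> T" "v \<noteq> []"
  shows "node_weight v \<xi> = spin_weight (\<xi> v) (\<xi> (butlast v) + (\<Sum>u\<in>children v. \<xi> u))"
proof -
  have "butlast v \<notin> children v" using assms by (auto simp: children_def dest: arg_cong[of _ _ length])
  then show ?thesis using assms by (simp add: node_weight_def neighbors_eq finite_children)
qed

section \<open>Messages and marginals on balls\<close>

text \<open>The message that a node sends to the neighbor of spin \<open>s\<close>, its own spin being \<open>t\<close>, if it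
  receives
  \<open>Z u\<close> from each \<open>u\<close> in the set \<open>C\<close> of its other neighbors. For a node other than the root, \<open>C\<close> is
  the set of its children; at the root, \<open>C\<close> can omit any one child.\<close>

definition msg :: "(node \<Rightarrow> nat \<Rightarrow> nat \<Rightarrow> real) \<Rightarrow> node set \<Rightarrow> nat \<Rightarrow> nat \<Rightarrow> real" where
  "msg Z C s t = (\<Sum>\<zeta>\<in>configs C. spin_weight t (s + (\<Sum>u\<in>C. \<zeta> u)) * (\<Prod>u\<in>C. Z u t (\<zeta> u)))"

definition msg_step :: "(node \<Rightarrow> nat \<Rightarrow> nat \<Rightarrow> real) \<Rightarrow> node \<Rightarrow> nat \<Rightarrow> nat \<Rightarrow> real" where
  "msg_step Z v = msg Z (children v)"

text \<open>The weight of a configuration on the ball of radius \<open>n + 1\<close>. The weights of the outermost nodes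
  involve spins outside the ball and are replaced by incoming messages.\<close>

definition ball_weight :: "nat \<Rightarrow> (node \<Rightarrow> nat \<Rightarrow> nat \<Rightarrow> real) \<Rightarrow> (node \<Rightarrow> nat) \<Rightarrow> real" where
  "ball_weight n Z \<xi> = (\<Prod>v\<in>B n. node_weight v \<xi>) * (\<Prod>u\<in>L (Suc n). Z u (\<xi> (butlast u)) (\<xi> u))"

text \<open>Given the spins up to level \<open>n + 1\<close>, the families of children of the nodes of that level do not
  interact. Summing each family out turns the messages that it sends into one message of its
  parent.\<close>

lemma ball_weight_marginal:
  assumes "\<omega> \<in> configs (B (Suc n))"
  shows "(\<Sum>\<xi> | \<xi> \<in> configs (B (Suc (Suc n))) \<and> restrict \<xi> (B (Suc n)) =
    \<omega>. ball_weight (Suc n) Z \<xi>) = ball_weight n (msg_step Z) \<omega>"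
proof -
  let ?m = "\<lambda>\<zeta>. merge (B (Suc n)) (L (Suc (Suc n))) (\<omega>, \<zeta>)"
  define F where "F v \<zeta> = spin_weight (\<omega> v) (\<omega> (butlast v) + (\<Sum>u\<in>children v. \<zeta> u)) *
    (\<Prod>u\<in>children v. Z u (\<omega> v) (\<zeta> u))" for v \<zeta>
  have inB: "?m \<zeta> v = \<omega> v" if "v \<in> B (Suc n)" for \<zeta> v using that by (simp add: merge_def)
  have inL: "?m \<zeta> v = \<zeta> v" if "v \<in> L (Suc (Suc n))" for \<zeta> v
    using that B_L_disjoint[of "Suc n"] by (auto simp: merge_def)
  have W1: "node_weight v (?m \<zeta>) = node_weight v \<omega>" if "v \<in> B n" for v \<zeta>
    using neighbors_B[OF that] that B_mono[of n "Suc n"]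
      by (intro node_weight_cong inB) (auto simp: nbhd_eq)
  have W2: "node_weight v (?m \<zeta>) = spin_weight (\<omega> v) (\<omega> (butlast v) +
    (\<Sum>u\<in>children v. \<zeta> u))" if v: "v \<in> L (Suc n)" for v \<zeta>
  proof -
    have vT: "v \<in> T" "v \<noteq> []" "v \<in> B (Suc n)" using v by (auto simp: L_def B_def)
    have bv: "butlast v \<in> B (Suc n)" using vT butlast_in_T by (auto simp: B_def)
    have "(\<Sum>u\<in>children v. ?m \<zeta> u) = (\<Sum>u\<in>children v. \<zeta> u)"
      using v by (intro sum.cong inL) (auto simp: L_Suc[of "Suc n"])
    then show ?thesis using node_weight_child[OF vT(1,2)] inB[OF vT(3)] inB[OF bv] by simp
  qed
  have P: "(\<Prod>u\<in>L (Suc (Suc n)). Z u (?m \<zeta> (butlast u)) (?m \<zeta> u)) =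
    (\<Prod>v\<in>L (Suc n). \<Prod>u\<in>children v. Z u (\<omega> v) (\<zeta> u))" for \<zeta>
  proof -
    have "(\<Prod>u\<in>L (Suc (Suc n)). Z u (?m \<zeta> (butlast u)) (?m \<zeta> u)) =
      (\<Prod>v\<in>L (Suc n). \<Prod>u\<in>children v. Z u (?m \<zeta> (butlast u)) (?m \<zeta> u))"
      unfolding L_Suc[of "Suc n"] using children_disjoint[of "L (Suc n)"]
      by (intro prod.UNION_disjoint finite_L ballI finite_children)
        (auto simp: disjoint_family_on_def)
    also have "\<dots> = (\<Prod>v\<in>L (Suc n). \<Prod>u\<in>children v. Z u (\<omega> v) (\<zeta> u))"
    proof (intro prod.cong refl)
      fix v u assume vu: "v \<in> L (Suc n)" "u \<in> children v"
      then have "v \<in> B (Suc n)" "u \<in> L (Suc (Suc n))" unfolding L_Suc[of "Suc n"]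
        by (auto simp: L_def B_def)
      then show "Z u (?m \<zeta> (butlast u)) (?m \<zeta> u) = Z u (\<omega> v) (\<zeta> u)"
        using inB inL butlast_children[OF vu(2)] by simp
    qed
    finally show ?thesis .
  qed
  have "(\<Sum>\<xi> | \<xi> \<in> configs (B (Suc (Suc n))) \<and> restrict \<xi> (B (Suc n)) = \<omega>. ball_weight (Suc n) Z \<xi>)
    = (\<Sum>\<zeta>\<in>configs (L (Suc (Suc n))). ball_weight (Suc n) Z (?m \<zeta>))"
    using sum_configs_restrict[OF B_mono assms, of "Suc (Suc n)"] by (simp add: B_diff)
  also have "\<dots> = (\<Sum>\<zeta>\<in>configs (L (Suc (Suc n))). (\<Prod>v\<in>B n. node_weight v \<omega>) * (\<Prod>v\<in>L (Suc n). F v \<zeta>))"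
  proof (intro sum.cong refl)
    fix \<zeta>
    have "(\<Prod>v\<in>B (Suc n). node_weight v (?m \<zeta>)) = (\<Prod>v\<in>B n. node_weight v (?m \<zeta>)) *
      (\<Prod>v\<in>L (Suc n). node_weight v (?m \<zeta>))"
      unfolding B_Suc by (intro prod.union_disjoint finite_B finite_L B_L_disjoint)
    also have "\<dots> = (\<Prod>v\<in>B n. node_weight v \<omega>) * (\<Prod>v\<in>L (Suc n). spin_weight (\<omega> v) (\<omega> (butlast v) +
      (\<Sum>u\<in>children v. \<zeta> u)))"
      using W1 W2 by (intro arg_cong2[of _ _ _ _ "(*)"] prod.cong refl) auto
    finally show "ball_weight (Suc n) Z (?m \<zeta>) = (\<Prod>v\<in>B n. node_weight v \<omega>) * (\<Prod>v\<in>L (Suc n). F v \<zeta>)"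
      unfolding ball_weight_def P by (simp add: F_def prod.distrib mult_ac)
  qed
  also have "\<dots> = (\<Prod>v\<in>B n. node_weight v \<omega>) * (\<Sum>\<zeta>\<in>configs (\<Union>v\<in>L (Suc n). children v). \<Prod>v\<in>L (Suc n).
    F v (restrict \<zeta> (children v)))"
  proof -
    have "F v (restrict \<zeta> (children v)) = F v \<zeta>" for v \<zeta> by (simp add: F_def)
    then show ?thesis by (simp add: sum_distrib_left L_Suc[of "Suc n"])
  qed
  also have "\<dots> = (\<Prod>v\<in>B n. node_weight v \<omega>) * (\<Prod>v\<in>L (Suc n). \<Sum>\<zeta>\<in>configs (children v). F v \<zeta>)"
    by (subst sum_configs_UN_prod) (auto simp: finite_L finite_children children_disjoint)
  also have "\<dots> = ball_weight n (msg_step Z) \<omega>"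
    by (simp add: ball_weight_def msg_step_def msg_def F_def)
  finally show ?thesis .
qed

lemma ball_weight_marginal_iterate:
  assumes "\<omega> \<in> configs (B (Suc n))"
  shows "(\<Sum>\<xi> | \<xi> \<in> configs (B (Suc (n + k))) \<and> restrict \<xi> (B (Suc n)) =
    \<omega>. ball_weight (n + k) Z \<xi>) = ball_weight n ((msg_step ^^ k) Z) \<omega>"
proof (induction k arbitrary: Z)
  case 0
  have "{\<xi>. \<xi> \<in> configs (B (Suc n)) \<and> restrict \<xi> (B (Suc n)) = \<omega>} = {\<omega>}"
    using assms restrict_id_configs by auto
  then show ?case unfolding add_0_right funpow_0 by (simp only: sum.insert finite.emptyI empty_iff
    not_False_eq_True sum.empty add_0_right)
next
  case (Suc k)
  have "(\<Sum>\<xi> | \<xi> \<in> configs (B (Suc (n + Suc k))) \<and> restrict \<xi> (B (Suc n)) =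
    \<omega>. ball_weight (n + Suc k) Z \<xi>) =
    (\<Sum>\<omega>' | \<omega>' \<in> configs (B (Suc (n + k))) \<and> restrict \<omega>' (B (Suc n)) = \<omega>.
      \<Sum>\<xi> | \<xi> \<in> configs (B (Suc (n + Suc k))) \<and> restrict \<xi> (B (Suc (n + k))) =
        \<omega>'. ball_weight (n + Suc k) Z \<xi>)"
    by (intro sum_configs_tower B_mono finite_B) auto
  also have "\<dots> = (\<Sum>\<omega>' | \<omega>' \<in> configs (B (Suc (n + k))) \<and> restrict \<omega>' (B (Suc n)) =
    \<omega>. ball_weight (n + k) (msg_step Z) \<omega>')"
    by (intro sum.cong refl) (simp add: ball_weight_marginal)
  also have "\<dots> = ball_weight n ((msg_step ^^ Suc k) Z) \<omega>"
    by (simp add: Suc.IH funpow_swap1)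
  finally show ?case .
qed

lemma msg_0: "msg Z C s 0 = child_sum \<theta> C (\<lambda>u. Z u 0) s"
  by (simp add: msg_def child_sum_def spin_weight_def)

lemma msg_1:
  assumes fin: "finite C"
  shows "msg Z C s 1 = (if s = 0 then lam * (\<Prod>u\<in>C. Z u 1 0) else 0)"
proof (cases "s = 0")
  case True
  let ?z = "restrict (\<lambda>_. 0) C :: node \<Rightarrow> nat"
  have z: "?z \<in> configs C" by (auto simp: configs_def)
  have "msg Z C s 1 = (\<Sum>\<zeta>\<in>{?z}. spin_weight 1 (s + (\<Sum>u\<in>C. \<zeta> u)) * (\<Prod>u\<in>C. Z u 1 (\<zeta> u)))"
    unfolding msg_def
  proof (intro sum.mono_neutral_right ballI)
    fix \<zeta> assume "\<zeta> \<in> configs C - {?z}"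
    then have \<zeta>: "\<zeta> \<in> configs C" "\<zeta> \<noteq> ?z" by auto
    have "(\<Sum>u\<in>C. \<zeta> u) \<noteq> 0"
    proof
      assume "(\<Sum>u\<in>C. \<zeta> u) = 0"
      then have "\<zeta> u = ?z u" if "u \<in> C" for u using that fin by simp
      then show False using \<zeta> configs_eqI[OF \<zeta>(1) z] by blast
    qed
    then show "spin_weight 1 (s + (\<Sum>u\<in>C. \<zeta> u)) * (\<Prod>u\<in>C. Z u 1 (\<zeta> u)) = 0"
      by (simp add: spin_weight_def)
  qed (use z finite_configs fin in auto)
  then show ?thesis using True by (simp add: spin_weight_def)
next
  case False
  then show ?thesis by (simp add: msg_def spin_weight_def)
qed

lemma msg_step_0: "msg_step Z v s 0 = child_sum \<theta> (children v) (\<lambda>u. Z u 0) s"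
  by (simp add: msg_step_def msg_0)

lemma msg_step_1: "msg_step Z v s 1 = (if s = 0 then lam * (\<Prod>u\<in>children v. Z u 1 0) else 0)"
  unfolding msg_step_def by (rule msg_1[OF finite_children])

text \<open>The inequalities \<open>l \<le> a \<le> u\<close> and \<open>al \<le> b \<le> be\<close> for the messages of level \<open>n\<close>, multiplied by
  \<open>Z v 0 0\<close> as messages are not normalized.\<close>

definition msg_bounds :: "nat \<Rightarrow> real \<times> real \<times> real \<times> real \<Rightarrow> (node \<Rightarrow> nat \<Rightarrow> nat \<Rightarrow> real) \<Rightarrow> bool" where
  "msg_bounds n = (\<lambda>(l, u, a, b) Z. \<forall>v\<in>L n. 0 < Z v 0 0 \<and> l * Z v 0 0 \<le> Z v 0 1 \<and> Z v 0 1 \<le>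
    u * Z v 0 0 \<and>
     a * Z v 0 0 \<le> Z v 1 0 \<and> Z v 1 0 \<le> b * Z v 0 0 \<and> Z v 1 1 = 0)"

text \<open>Bounds on the messages of one level imply the bounds given by \<open>bound_step\<close> one level up: the
  ratio \<open>b\<close> is handled by \<open>child_sum_ratio_mono\<close>, the ratio \<open>a\<close> by \<open>child_sum_ge\<close> and
  \<open>child_sum_le\<close>.\<close>

lemma msg_bounds_step:
  assumes g: "msg_bounds (Suc n) (l, u, a, b) Z" and pos: "0 \<le> l" "l \<le> u" "0 \<le> a" and n: "n \<noteq> 0"
  shows "msg_bounds n (bound_step (l, u, a, b)) (msg_step Z)"
  unfolding msg_bounds_def bound_step.simps prod.case
proof (intro ballI)
  fix v assume v: "v \<in> L n"
  define C where "C = children v"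
  have C: "finite C" "card C = \<Delta> - 1"
    using v n card_children[of v] finite_children by (auto simp: C_def L_def)
  have Z: "0 < Z w 0 0" "l * Z w 0 0 \<le> Z w 0 1" "Z w 0 1 \<le> u * Z w 0 0" "a * Z w 0 0 \<le> Z w 1 0"
    "Z w 1 0 \<le> b * Z w 0 0"
    "0 \<le> Z w 0 1" if "w \<in> C" for w
  proof -
    have "w \<in> L (Suc n)" using that v by (auto simp: C_def L_Suc)
    then show "0 < Z w 0 0" "l * Z w 0 0 \<le> Z w 0 1" "Z w 0 1 \<le> u * Z w 0 0" "a * Z w 0 0 \<le> Z w 1 0"
      "Z w 1 0 \<le> b * Z w 0 0"
      using g by (auto simp: msg_bounds_def)
    then show "0 \<le> Z w 0 1" using pos by (meson less_imp_le mult_nonneg_nonneg order_trans)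
  qed
  let ?P = "\<Prod>w\<in>C. Z w 0 0"
  let ?e = "child_sum \<theta> C (\<lambda>w. Z w 0)"
  have P: "?P > 0" using Z by (intro prod_pos) auto
  have D: "D l > 0" "D u > 0" using pos by (auto intro: D_pos)
  have e0: "?e 0 > 0" using Z C by (intro child_sum_pos) auto
  have lower: "?P * D l \<le> ?e 0"
    unfolding D_def C(2)[symmetric] using Z C pos by (intro child_sum_ge) auto
  have upper: "?e 0 \<le> ?P * D u"
    unfolding D_def C(2)[symmetric] using Z C pos by (intro child_sum_le) auto
  have f_eq: "f x = child_sum \<theta> C (\<lambda>_ t. if t = 1 then x else 1) (Suc 0) / child_sum \<theta> C (\<lambda>_ t.
    if t = 1 then x else 1) 0" for x
    unfolding f_def using C by (simp add: child_sum_const[where x = x])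
  have fl: "f l \<le> ?e (Suc 0) / ?e 0"
    unfolding f_eq using Z C pos Delta by (intro child_sum_ratio_mono)
      (auto simp: divide_simps mult_ac)
  have fu: "?e (Suc 0) / ?e 0 \<le> f u"
    unfolding f_eq using Z C pos Delta by (intro child_sum_ratio_mono)
      (auto simp: divide_simps mult_ac)
  have pl: "a ^ (\<Delta> - 1) * ?P \<le> (\<Prod>w\<in>C. Z w 1 0)"
  proof -
    have "a ^ (\<Delta> - 1) * ?P = (\<Prod>w\<in>C. a * Z w 0 0)" using C by (simp add: prod.distrib)
    also have "\<dots> \<le> (\<Prod>w\<in>C. Z w 1 0)"
      using Z pos by (intro prod_mono) (auto simp: less_imp_le)
    finally show ?thesis .
  qed
  have pu: "(\<Prod>w\<in>C. Z w 1 0) \<le> b ^ (\<Delta> - 1) * ?P"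
  proof -
    have "0 \<le> Z w 1 0" if "w \<in> C" for w
      using Z[OF that] pos by (meson less_imp_le mult_nonneg_nonneg order_trans)
    then have "(\<Prod>w\<in>C. Z w 1 0) \<le> (\<Prod>w\<in>C. b * Z w 0 0)"
      using Z by (intro prod_mono) auto
    then show ?thesis using C by (simp add: prod.distrib)
  qed
  have b0: "0 \<le> b ^ (\<Delta> - 1) * ?P"
    using pl pu P pos by (meson less_imp_le mult_nonneg_nonneg order_trans zero_le_power)
  have "lam * a ^ (\<Delta> - 1) / D u * ?e 0 \<le> lam * a ^ (\<Delta> - 1) / D u * (?P * D u)"
    using upper D lam_pos pos by (intro mult_left_mono) auto
  also have "\<dots> = lam * (a ^ (\<Delta> - 1) * ?P)" using D by simp
  also have "\<dots> \<le> lam * (\<Prod>w\<in>C. Z w 1 0)" using pl lam_pos by simp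
  finally have A1: "lam * a ^ (\<Delta> - 1) / D u * ?e 0 \<le> lam * (\<Prod>w\<in>C. Z w 1 0)" .
  have b1: "0 \<le> b ^ (\<Delta> - 1)" using b0 P by (simp add: zero_le_mult_iff)
  have "lam * (\<Prod>w\<in>C. Z w 1 0) \<le> lam * (b ^ (\<Delta> - 1) * ?P)" using pu lam_pos by simp
  also have "\<dots> = lam * b ^ (\<Delta> - 1) / D l * (?P * D l)" using D by simp
  also have "\<dots> \<le> lam * b ^ (\<Delta> - 1) / D l * ?e 0"
    using lower D lam_pos b1 by (intro mult_left_mono) auto
  finally have A2: "lam * (\<Prod>w\<in>C. Z w 1 0) \<le> lam * b ^ (\<Delta> - 1) / D l * ?e 0" .
  show "0 < msg_step Z v 0 0 \<and> lam * a ^ (\<Delta> - 1) / D u * msg_step Z v 0 0 \<le> msg_step Z v 0 1 \<and>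
    msg_step Z v 0 1 \<le> lam * b ^ (\<Delta> - 1) / D l * msg_step Z v 0 0 \<and>
    f l * msg_step Z v 0 0 \<le> msg_step Z v 1 0 \<and> msg_step Z v 1 0 \<le>
      f u * msg_step Z v 0 0 \<and> msg_step Z v 1 1 = 0"
    unfolding msg_step_0 msg_step_1 C_def[symmetric] using e0 A1 A2 fl fu
    by (simp add: divide_simps mult_ac)
qed

text \<open>The normalized message with ratios \<open>a\<close> and \<open>b\<close>.\<close>

definition edge_msg :: "real \<Rightarrow> real \<Rightarrow> nat \<Rightarrow> nat \<Rightarrow> real" where
  "edge_msg a b s t = (if s = 0 then (if t = 0 then 1 else a) else (if t = 0 then b else 0))"

text \<open>The weight of a ball is a product with nonnegative factors, so it is monotone in the incoming
  messages. The product of the \<open>Z w 0 0\<close> is the normalization and cancels in probabilities.\<close>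

lemma ball_weight_bounds:
  assumes g: "msg_bounds (Suc n) (l, u, a, b) Z" and pos: "0 \<le> l"
    "0 \<le> a" and \<omega>: "\<omega> \<in> configs (B (Suc n))"
  shows "(\<Prod>w\<in>L (Suc n). Z w 0 0) * ball_weight n (\<lambda>_. edge_msg l a) \<omega> \<le> ball_weight n Z \<omega>"
    and "ball_weight n Z \<omega> \<le> (\<Prod>w\<in>L (Suc n). Z w 0 0) * ball_weight n (\<lambda>_. edge_msg u b) \<omega>"
    and "0 \<le> ball_weight n (\<lambda>_. edge_msg l a) \<omega>"
proof -
  have sp: "\<omega> v = 0 \<or> \<omega> v = 1" if "v \<in> B (Suc n)" for v using configs_spin[OF \<omega> that] .
  have "0 \<le> node_weight v \<omega>" if "v \<in> B n" for v
    using \<omega> that by (rule node_weight_nonneg_B)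
  then have Wp: "0 \<le> (\<Prod>v\<in>B n. node_weight v \<omega>)" by (intro prod_nonneg) auto
  have z: "0 < Z w 0 0" "l * Z w 0 0 \<le> Z w 0 1" "Z w 0 1 \<le> u * Z w 0 0" "a * Z w 0 0 \<le> Z w 1 0"
    "Z w 1 0 \<le> b * Z w 0 0" "Z w 1 1 = 0"
    if "w \<in> L (Suc n)" for w
    using g that by (auto simp: msg_bounds_def)
  have spL: "\<omega> w = 0 \<or> \<omega> w = 1" "\<omega> (butlast w) = 0 \<or> \<omega> (butlast w) = 1" if "w \<in> L (Suc n)" for w
    using that sp butlast_in_T by (auto simp: L_def B_def)
  have lo: "0 \<le> Z w 0 0 * edge_msg l a (\<omega> (butlast w)) (\<omega> w) \<and>
    Z w 0 0 * edge_msg l a (\<omega> (butlast w)) (\<omega> w) \<le> Z w (\<omega> (butlast w)) (\<omega> w)"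
    if "w \<in> L (Suc n)" for w
    using z[OF that] spL[OF that] pos by (auto simp: edge_msg_def mult_ac)
  have up: "Z w (\<omega> (butlast w)) (\<omega> w) \<le> Z w 0 0 * edge_msg u b (\<omega> (butlast w)) (\<omega> w)"
    if "w \<in> L (Suc n)" for w
    using z[OF that] spL[OF that] by (auto simp: edge_msg_def mult_ac)
  have "(\<Prod>w\<in>L (Suc n). Z w 0 0) * ball_weight n (\<lambda>_. edge_msg l a) \<omega> =
     (\<Prod>v\<in>B n. node_weight v \<omega>) * (\<Prod>w\<in>L (Suc n). Z w 0 0 * edge_msg l a (\<omega> (butlast w)) (\<omega> w))"
    by (simp add: ball_weight_def prod.distrib mult_ac)
  also have "\<dots> \<le> ball_weight n Z \<omega>"
    unfolding ball_weight_def using Wp lo by (intro mult_left_mono prod_mono) auto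
  finally show "(\<Prod>w\<in>L (Suc n). Z w 0 0) * ball_weight n (\<lambda>_. edge_msg l a) \<omega> \<le> ball_weight n Z \<omega>" .
  have "ball_weight n Z \<omega> \<le> (\<Prod>v\<in>B n. node_weight v \<omega>) * (\<Prod>w\<in>L (Suc n). Z w 0 0 *
    edge_msg u b (\<omega> (butlast w)) (\<omega> w))"
    unfolding ball_weight_def using Wp lo up by (intro mult_left_mono prod_mono)
      (auto intro: order_trans)
  also have "\<dots> = (\<Prod>w\<in>L (Suc n). Z w 0 0) * ball_weight n (\<lambda>_. edge_msg u b) \<omega>"
    by (simp add: ball_weight_def prod.distrib mult_ac)
  finally show "ball_weight n Z \<omega> \<le> (\<Prod>w\<in>L (Suc n). Z w 0 0) * ball_weight n (\<lambda>_. edge_msg u b) \<omega>" .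
  show "0 \<le> ball_weight n (\<lambda>_. edge_msg l a) \<omega>"
    unfolding ball_weight_def using pos by (intro mult_nonneg_nonneg[OF Wp] prod_nonneg)
      (auto simp: edge_msg_def)
qed

definition partition_fun :: "nat \<Rightarrow> (node \<Rightarrow> nat \<Rightarrow> nat \<Rightarrow> real) \<Rightarrow> real" where
  "partition_fun n Z = (\<Sum>\<omega>\<in>configs (B (Suc n)). ball_weight n Z \<omega>)"

lemma ball_weight_nonneg:
  assumes "\<omega> \<in> configs (B (Suc n))" "\<And>w s t. w \<in> L (Suc n) \<Longrightarrow> 0 \<le> Z w s t"
  shows "0 \<le> ball_weight n Z \<omega>"
proof -
  have "0 \<le> node_weight v \<omega>" if "v \<in> B n" for v
    using assms(1) that by (rule node_weight_nonneg_B)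
  then show ?thesis using assms(2) by (auto simp: ball_weight_def intro!: mult_nonneg_nonneg
    prod_nonneg)
qed

lemma partition_fun_pos:
  assumes "\<And>w s t. w \<in> L (Suc n) \<Longrightarrow> 0 \<le> Z w s t" "\<And>w. w \<in> L (Suc n) \<Longrightarrow> 0 < Z w 0 0"
  shows "0 < partition_fun n Z"
proof -
  let ?z = "restrict (\<lambda>_. 0) (B (Suc n)) :: node \<Rightarrow> nat"
  have z: "?z \<in> configs (B (Suc n))" by (auto simp: configs_def)
  have zv: "?z v = 0" if "v \<in> B (Suc n)" for v using that by simp
  have node_weight: "node_weight v ?z = \<theta> 0" if "v \<in> B n" for v
  proof -
    have "?z u = 0" if "u \<in> neighbors v" for u using neighbors_B[OF \<open>v \<in> B n\<close>] that by auto
    moreover have "?z v = 0" using \<open>v \<in> B n\<close> B_mono[of n "Suc n"] by auto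
    ultimately show ?thesis by (simp add: node_weight_def spin_weight_def)
  qed
  have Zz: "Z w (?z (butlast w)) (?z w) = Z w 0 0" if "w \<in> L (Suc n)" for w
  proof -
    have "w \<in> B (Suc n)" "butlast w \<in> B (Suc n)" using that butlast_in_T by (auto simp: L_def B_def)
    then show ?thesis by (simp only: zv)
  qed
  have "ball_weight n Z ?z = (\<Prod>v\<in>B n. \<theta> 0) * (\<Prod>w\<in>L (Suc n). Z w 0 0)"
    unfolding ball_weight_def using node_weight Zz by (intro arg_cong2[of _ _ _ _ "(*)"] prod.cong
      refl) auto
  also have "\<dots> > 0" using assms(2) theta_pos[of 0] by (auto intro!: mult_pos_pos prod_pos)
  finally have "0 < ball_weight n Z ?z" .
  then show ?thesis unfolding partition_fun_def
    using z assms(1) by (intro sum_pos2[of _ ?z] finite_configs finite_B ball_weight_nonneg) auto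
qed

lemma ball_weight_ratio_bounds:
  assumes g: "msg_bounds (Suc n) (l, u, a, b) Z" and pos: "0 \<le> l"
    "0 \<le> a" and \<omega>: "\<omega> \<in> configs (B (Suc n))"
  shows "ball_weight n (\<lambda>_. edge_msg l a) \<omega> / partition_fun n (\<lambda>_. edge_msg u b) \<le>
    ball_weight n Z \<omega> / partition_fun n Z"
    and "ball_weight n Z \<omega> / partition_fun n Z \<le> ball_weight n (\<lambda>_.
      edge_msg u b) \<omega> / partition_fun n (\<lambda>_. edge_msg l a)"
proof -
  define P where "P = (\<Prod>w\<in>L (Suc n). Z w 0 0)"
  have P: "0 < P" unfolding P_def using g by (intro prod_pos) (auto simp: msg_bounds_def)
  have Zl: "0 < partition_fun n (\<lambda>_. edge_msg l a)" using pos
    by (intro partition_fun_pos) (auto simp: edge_msg_def)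
  have ZL: "P * partition_fun n (\<lambda>_. edge_msg l a) \<le> partition_fun n Z" and ZU: "partition_fun n Z \<le>
    P * partition_fun n (\<lambda>_. edge_msg u b)"
    unfolding partition_fun_def P_def sum_distrib_left using ball_weight_bounds[OF g pos]
      by (auto intro!: sum_mono)
  have Zp: "0 < partition_fun n Z" using ZL Zl P by (meson less_le_trans mult_pos_pos)
  have Zu: "0 < partition_fun n (\<lambda>_. edge_msg u b)" using ZU Zp P
    by (metis less_le_trans zero_less_mult_pos)
  note d = ball_weight_bounds[OF g pos \<omega>, folded P_def]
  have "ball_weight n (\<lambda>_. edge_msg l a) \<omega> / partition_fun n (\<lambda>_. edge_msg u b) =
    (P * ball_weight n (\<lambda>_. edge_msg l a) \<omega>) / (P * partition_fun n (\<lambda>_. edge_msg u b))"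
    using P by simp
  also have "\<dots> \<le> ball_weight n Z \<omega> / partition_fun n Z"
    using d ZU Zp P by (intro frac_le) (auto intro: order_trans[OF mult_nonneg_nonneg[OF
      less_imp_le[OF P] d(3)]])
  finally show "ball_weight n (\<lambda>_. edge_msg l a) \<omega> / partition_fun n (\<lambda>_. edge_msg u b) \<le>
    ball_weight n Z \<omega> / partition_fun n Z" .
  have "ball_weight n Z \<omega> / partition_fun n Z \<le> (P * ball_weight n (\<lambda>_. edge_msg u b) \<omega>) / (P *
    partition_fun n (\<lambda>_. edge_msg l a))"
    using d ZL Zl P by (intro frac_le mult_pos_pos) (auto intro: order_trans[OF
      mult_nonneg_nonneg[OF less_imp_le[OF P] d(3)]] order_trans)
  then show "ball_weight n Z \<omega> / partition_fun n Z \<le> ball_weight n (\<lambda>_.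
    edge_msg u b) \<omega> / partition_fun n (\<lambda>_. edge_msg l a)"
    using P by simp
qed

section \<open>Finite volumes\<close>

text \<open>The message sent from level \<open>N + 1\<close> under the boundary condition \<open>\<eta>\<close>.
  It vanishes unless the spin
  is the prescribed one, so that a sum over all spins of level \<open>N + 1\<close> selects \<open>\<eta>\<close>.\<close>

definition boundary_msg :: "(node \<Rightarrow> nat) \<Rightarrow> node \<Rightarrow> nat \<Rightarrow> nat \<Rightarrow> real" where
  "boundary_msg \<eta> v s t = (if t = \<eta> v then spin_weight t (s + (\<Sum>u\<in>children v. \<eta> u)) else 0)"

lemma affected_B: "affected (B n) = B (Suc n)"
proof (intro set_eqI iffI)
  fix i assume "i \<in> affected (B n)"
  then show "i \<in> B (Suc n)" using neighbors_length by (fastforce simp: affected_def nbhd_eq B_def)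
next
  fix i assume i: "i \<in> B (Suc n)"
  then have "i \<in> B n \<or> (i \<noteq> [] \<and> butlast i \<in> B n)"
    using butlast_in_T by (auto simp: B_def)
  then show "i \<in> affected (B n)" using i by (auto simp: affected_def nbhd_eq B_def neighbors_eq)
qed

text \<open>The Hamiltonian of the ball of radius \<open>N\<close> involves the nodes up to level \<open>N + 1\<close>. The weight of
  a node of level \<open>N + 1\<close> depends on the spins in the ball only through its parent, and is the
  message that this node sends.\<close>

lemma volume_weight_eq_ball_weight:
  assumes \<nu>: "\<nu> \<in> configs (B N)" and \<eta>: "\<eta> \<in> configs (bdry \<Delta> (B N))"
  shows "exp_neg (hamiltonian \<Delta> lam \<theta> (B N) (merge (B N) (bdry \<Delta> (B N)) (\<nu>, \<eta>))) =
    ball_weight N (boundary_msg \<eta>) (merge (B N) (L (Suc N)) (\<nu>, restrict \<eta> (L (Suc N))))"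
proof -
  let ?m = "merge (B N) (bdry \<Delta> (B N)) (\<nu>, \<eta>)"
  let ?m' = "merge (B N) (L (Suc N)) (\<nu>, restrict \<eta> (L (Suc N)))"
  have mB: "?m v = \<nu> v" "?m' v = \<nu> v" if "v \<in> B N" for v using that by (auto simp: merge_def)
  have mL: "?m v = \<eta> v" if "v \<in> L (Suc N) \<or> v \<in> L (Suc (Suc N))" for v
    using that unfolding bdry_B by (auto simp: merge_def L_def B_def)
  have mL': "?m' v = \<eta> v" if "v \<in> L (Suc N)" for v
    using that by (auto simp: merge_def L_def B_def)
  have same: "?m v = ?m' v" if "v \<in> B (Suc N)" for v
    using that mB mL mL' unfolding B_Suc by auto
  have fin: "finite (B N)" "B N \<subseteq> T" by (auto simp: finite_B B_subset_T)
  have "exp_neg (hamiltonian \<Delta> lam \<theta> (B N) ?m) = (\<Prod>i\<in>B (Suc N). node_weight i ?m)"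
    unfolding affected_B[symmetric]
    using configs_spin[OF merge_configs[OF \<nu> \<eta>]] by (intro exp_neg_hamiltonian fin) blast
  also have "\<dots> = (\<Prod>i\<in>B N. node_weight i ?m) * (\<Prod>i\<in>L (Suc N). node_weight i ?m)"
    unfolding B_Suc by (intro prod.union_disjoint finite_B finite_L B_L_disjoint)
  also have "(\<Prod>i\<in>B N. node_weight i ?m) = (\<Prod>i\<in>B N. node_weight i ?m')"
    using neighbors_B B_mono[of N "Suc N"] by (intro prod.cong refl node_weight_cong same)
      (auto simp: nbhd_eq)
  also have "(\<Prod>i\<in>L (Suc N). node_weight i ?m) = (\<Prod>i\<in>L (Suc N).
    boundary_msg \<eta> i (?m' (butlast i)) (?m' i))"
  proof (intro prod.cong refl)
    fix i assume i: "i \<in> L (Suc N)"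
    have iT: "i \<in> T" "i \<noteq> []" "butlast i \<in> B N" using i butlast_in_T by (auto simp: L_def B_def)
    have "(\<Sum>u\<in>children i. ?m u) = (\<Sum>u\<in>children i. \<eta> u)"
      using i L_Suc[of "Suc N"] by (intro sum.cong refl mL) auto
    then show "node_weight i ?m = boundary_msg \<eta> i (?m' (butlast i)) (?m' i)"
      unfolding node_weight_child[OF iT(1,2)] using mB[OF iT(3)] mL[of i] mL'[of i] i
        by (simp add: boundary_msg_def)
  qed
  finally show ?thesis by (simp only: ball_weight_def)
qed

lemma volume_sum_eq_ball_weight_sum:
  assumes \<eta>: "\<eta> \<in> configs (bdry \<Delta> (B N))"
  shows "(\<Sum>\<nu> | \<nu> \<in> configs (B N) \<and> Q \<nu>. exp_neg (hamiltonian \<Delta> lam \<theta> (B N) (merge (B N) (bdry \<Delta> (B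
    N)) (\<nu>, \<eta>)))) =
    (\<Sum>\<xi> | \<xi> \<in> configs (B (Suc N)) \<and> Q (restrict \<xi> (B N)). ball_weight N (boundary_msg \<eta>) \<xi>)"
proof -
  let ?m = "\<lambda>\<nu> \<zeta>. merge (B N) (L (Suc N)) (\<nu>, \<zeta>)"
  let ?e = "restrict \<eta> (L (Suc N))"
  have e: "?e \<in> configs (L (Suc N))"
    using \<eta> by (intro restrict_configs[OF _ \<eta>]) (auto simp: bdry_B)
  have r: "restrict (?m \<nu> \<zeta>) (B N) = \<nu>" if "\<nu> \<in> configs (B N)" for \<nu> \<zeta>
    using that by (auto simp: configs_def PiE_iff extensional_def merge_def fun_eq_iff)
  have "(\<Sum>\<xi> | \<xi> \<in> configs (B (Suc N)) \<and> Q (restrict \<xi> (B N)). ball_weight N (boundary_msg \<eta>) \<xi>) =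
    (\<Sum>\<xi>\<in>configs (B (Suc N)). if Q (restrict \<xi> (B N)) then ball_weight N (boundary_msg \<eta>) \<xi> else 0)"
    by (rule sum.inter_filter) (simp add: finite_configs finite_B)
  also have "\<dots> = (\<Sum>\<nu>\<in>configs (B N). \<Sum>\<zeta>\<in>configs (L (Suc N)).
    if Q \<nu> then ball_weight N (boundary_msg \<eta>) (?m \<nu> \<zeta>) else 0)"
    unfolding B_Suc sum_configs_Un[OF B_L_disjoint] by (intro sum.cong refl) (simp add: r)
  also have "\<dots> = (\<Sum>\<nu>\<in>configs (B N). if Q \<nu> then ball_weight N (boundary_msg \<eta>) (?m \<nu> ?e) else 0)"
  proof (intro sum.cong refl)
    fix \<nu> assume \<nu>: "\<nu> \<in> configs (B N)"
    have "ball_weight N (boundary_msg \<eta>) (?m \<nu> \<zeta>) = 0" if "\<zeta> \<in> configs (L (Suc N)) - {?e}" for \<zeta>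
    proof -
      have "\<exists>w\<in>L (Suc N). \<zeta> w \<noteq> ?e w"
        using that configs_eqI[OF _ e, of \<zeta>] by blast
      then obtain w where w: "w \<in> L (Suc N)" "\<zeta> w \<noteq> ?e w" by blast
      then have "?m \<nu> \<zeta> w \<noteq> \<eta> w" using B_L_disjoint[of N] by (auto simp: merge_def)
      then have "boundary_msg \<eta> w (?m \<nu> \<zeta> (butlast w)) (?m \<nu> \<zeta> w) = 0" by (simp add: boundary_msg_def)
      then show ?thesis using w(1) finite_L by (auto simp: ball_weight_def)
    qed
    then have "(\<Sum>\<zeta>\<in>configs (L (Suc N)). if Q \<nu> then ball_weight N (boundary_msg \<eta>) (?m \<nu> \<zeta>) else 0) =
      (\<Sum>\<zeta>\<in>{?e}. if Q \<nu> then ball_weight N (boundary_msg \<eta>) (?m \<nu> \<zeta>) else 0)"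
      using e by (intro sum.mono_neutral_right finite_configs finite_L) auto
    then show "(\<Sum>\<zeta>\<in>configs (L (Suc N)). if Q \<nu> then ball_weight N (boundary_msg \<eta>) (?m \<nu> \<zeta>) else 0) =
      (if Q \<nu> then ball_weight N (boundary_msg \<eta>) (?m \<nu> ?e) else 0)" by simp
  qed
  also have "\<dots> = (\<Sum>\<nu> | \<nu> \<in> configs (B N) \<and> Q \<nu>. ball_weight N (boundary_msg \<eta>) (?m \<nu> ?e))"
    by (rule sum.inter_filter[symmetric]) (simp add: finite_configs finite_B)
  also have "\<dots> = (\<Sum>\<nu> | \<nu> \<in> configs (B N) \<and> Q \<nu>. exp_neg (hamiltonian \<Delta> lam \<theta> (B N) (merge (B N)
    (bdry \<Delta> (B N)) (\<nu>, \<eta>))))"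
    using volume_weight_eq_ball_weight[OF _ \<eta>] by (intro sum.cong refl) auto
  finally show ?thesis by simp
qed

text \<open>Finite-volume probabilities on a smaller ball come from pushing the boundary messages inwards
  level by level.\<close>

lemma finite_volume_prob_eq:
  assumes \<eta>: "\<eta> \<in> configs (bdry \<Delta> (B (m + k)))" and \<omega>: "\<omega> \<in> configs (B (Suc m))" and k: "k \<noteq> 0"
  shows "finite_volume_prob \<Delta> lam \<theta> (B (m + k)) \<eta> (B (Suc m)) \<omega> =
    ball_weight m ((msg_step ^^ k) (boundary_msg \<eta>)) \<omega> / partition_fun m ((msg_step ^^ k)
      (boundary_msg \<eta>))"
proof -
  have sub: "B (m + k) \<inter> B (Suc m) = B (Suc m)" "B (Suc m) \<subseteq> B (Suc (m + k))"
    using k by (auto simp: B_def)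
  have n: "(\<Sum>\<nu> | \<nu> \<in> configs (B (m + k)) \<and> restrict \<nu> (B (Suc m)) = \<omega>.
    exp_neg (hamiltonian \<Delta> lam \<theta> (B (m + k)) (merge (B (m + k)) (bdry \<Delta> (B (m + k))) (\<nu>, \<eta>)))) =
    ball_weight m ((msg_step ^^ k) (boundary_msg \<eta>)) \<omega>"
    unfolding volume_sum_eq_ball_weight_sum[OF \<eta>] restrict_restrict sub(1)
      by (rule ball_weight_marginal_iterate[OF \<omega>])
  have "(\<Sum>\<nu>\<in>configs (B (m + k)).
    exp_neg (hamiltonian \<Delta> lam \<theta> (B (m + k)) (merge (B (m + k)) (bdry \<Delta> (B (m + k))) (\<nu>, \<eta>)))) =
    (\<Sum>\<xi>\<in>configs (B (Suc (m + k))). ball_weight (m + k) (boundary_msg \<eta>) \<xi>)"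
    using volume_sum_eq_ball_weight_sum[OF \<eta>, of "\<lambda>_. True"] by simp
  also have "\<dots> = partition_fun m ((msg_step ^^ k) (boundary_msg \<eta>))"
    unfolding partition_fun_def using sub by (subst sum_configs_fibres[of "B (Suc m)"])
      (auto simp: finite_B ball_weight_marginal_iterate intro!: sum.cong)
  finally show ?thesis unfolding finite_volume_prob_def n by simp
qed

text \<open>A boundary condition can force infinite ratios at level \<open>N + 1\<close>: an occupied boundary node has
  \<open>Z v 0 0 = 0\<close>. One level further in the ratios are finite. If \<open>k\<close> children of \<open>v\<close> are occupied, then
  \<open>b = \<theta> (k + 1) / \<theta> k\<close>; moreover \<open>a = 0\<close> if \<open>k > 0\<close>, and if \<open>k = 0\<close> the factors of \<open>a\<close> are quotients
  of consecutive entries of \<open>\<theta>\<close>. So the initial bounds hold uniformly in \<open>\<eta>\<close>.\<close>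

lemma msg_bounds_boundary:
  assumes \<eta>: "\<eta> \<in> hardcore_configs \<Delta> (bdry \<Delta> (B N))" and N: "N \<noteq> 0"
  shows "msg_bounds N (0, amax, bmin, bmax) (msg_step (boundary_msg \<eta>))"
  unfolding msg_bounds_def prod.case
proof (intro ballI)
  fix v assume v: "v \<in> L N"
  define C where "C = children v"
  have C: "finite C" "card C = \<Delta> - 1"
    using v N card_children[of v] finite_children by (auto simp: C_def L_def)
  have CL: "C \<subseteq> L (Suc N)" using v by (auto simp: C_def L_Suc)
  have \<eta>c: "\<eta> \<in> configs (L (Suc N) \<union> L (Suc (Suc N)))" using \<eta>
    by (simp add: hardcore_configs_def bdry_B)
  have sp: "\<eta> u = 0 \<or> \<eta> u = 1" if "u \<in> L (Suc N) \<or> u \<in> L (Suc (Suc N))" for u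
    using configs_spin[OF \<eta>c] that by blast
  define k where "k = (\<Sum>u\<in>C. \<eta> u)"
  have kle: "k \<le> \<Delta> - 1" unfolding k_def C(2)[symmetric] using sp CL by (intro sum_spins_le) auto
  define q where "q u = (\<Sum>w\<in>children u. \<eta> w)" for u
  have qle: "q u \<le> \<Delta> - 1" if "u \<in> C" for u
  proof -
    have u: "u \<in> T" "u \<noteq> []" "u \<in> L (Suc N)" using that CL by (auto simp: L_def)
    have "card (children u) = \<Delta> - 1" using card_children[OF u(1)] u(2) by simp
    moreover have "q u \<le> card (children u)"
      unfolding q_def using u sp L_Suc[of "Suc N"] by (intro sum_spins_le) auto
    ultimately show ?thesis by simp
  qed
  have q0: "q u = 0" if "u \<in> C" "\<eta> u = 1" for u
  proof -
    have u: "u \<in> L (Suc N)" using that CL by auto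
    have "\<eta> w = 0" if w: "w \<in> children u" for w
    proof -
      have w2: "w \<in> L (Suc (Suc N))" using w u L_Suc[of "Suc N"] by auto
      have "tree_adj \<Delta> u w" using w u by (auto simp: tree_adj_def children_def L_def)
      then have "\<eta> w \<noteq> 1" using \<eta> u w2 \<open>\<eta> u = 1\<close> unfolding hardcore_configs_def bdry_B by blast
      then show ?thesis using sp w2 by blast
    qed
    then show ?thesis by (simp add: q_def)
  qed
  have Z: "boundary_msg \<eta> u s t = (if t = \<eta> u then spin_weight t (s + q u) else 0)" for u s t
    by (simp add: boundary_msg_def q_def)
  define P where "P = (\<Prod>u\<in>C. boundary_msg \<eta> u 0 (\<eta> u))"
  have Pu: "0 < boundary_msg \<eta> u 0 (\<eta> u)" if "u \<in> C" for u
    using sp[of u] that CL q0[OF that] qle[OF that] lam_pos theta_pos[of "q u"]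
      by (auto simp: Z spin_weight_def)
  have P: "0 < P" unfolding P_def using Pu by (intro prod_pos) auto
  \<comment> \<open>only the prescribed configuration contributes\<close>
  have S0: "msg_step (boundary_msg \<eta>) v s 0 = \<theta> (s + k) * P" for s
  proof -
    let ?e = "restrict \<eta> C"
    have e: "?e \<in> configs C" using CL by (intro restrict_configs[OF _ \<eta>c]) auto
    have "msg_step (boundary_msg \<eta>) v s 0 = (\<Sum>\<zeta>\<in>{?e}. spin_weight 0 (s + (\<Sum>u\<in>C. \<zeta> u)) *
      (\<Prod>u\<in>C. boundary_msg \<eta> u 0 (\<zeta> u)))"
      unfolding msg_step_def msg_def C_def[symmetric]
    proof (intro sum.mono_neutral_right ballI)
      fix \<zeta> assume \<zeta>: "\<zeta> \<in> configs C - {?e}"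
      then have "\<exists>w\<in>C. \<zeta> w \<noteq> ?e w" using configs_eqI[OF _ e, of \<zeta>] by blast
      then obtain w where w: "w \<in> C" "\<zeta> w \<noteq> \<eta> w" by auto
      then have "(\<Prod>u\<in>C. boundary_msg \<eta> u 0 (\<zeta> u)) = 0" using C(1) by (auto simp: boundary_msg_def)
      then show "spin_weight 0 (s + (\<Sum>u\<in>C. \<zeta> u)) * (\<Prod>u\<in>C. boundary_msg \<eta> u 0 (\<zeta> u)) = 0" by simp
    qed (use e C finite_configs in auto)
    also have "\<dots> = \<theta> (s + k) * P" by (simp add: k_def P_def spin_weight_def)
    finally show ?thesis .
  qed
  have S1: "0 \<le> (\<Prod>u\<in>C. boundary_msg \<eta> u 1 0)" "lam * (\<Prod>u\<in>C. boundary_msg \<eta> u 1 0) \<le> amax * (\<theta> k * P)"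
  proof -
    have nn: "0 \<le> boundary_msg \<eta> u 1 0" if "u \<in> C" for u
    proof -
      have "0 < \<theta> (Suc (q u))" using qle[OF that] Delta by (intro theta_pos) auto
      then show ?thesis by (auto simp: Z spin_weight_def)
    qed
    then show "0 \<le> (\<Prod>u\<in>C. boundary_msg \<eta> u 1 0)" by (intro prod_nonneg) auto
    show "lam * (\<Prod>u\<in>C. boundary_msg \<eta> u 1 0) \<le> amax * (\<theta> k * P)"
    proof (cases "\<exists>u\<in>C. \<eta> u = 1")
      case True
      then obtain u where "u \<in> C" "boundary_msg \<eta> u 1 0 = 0" by (auto simp: boundary_msg_def)
      then have "(\<Prod>u\<in>C. boundary_msg \<eta> u 1 0) = 0" using C(1) by (intro prod_zero) auto
      moreover have "0 \<le> amax * (\<theta> k * P)" using amax_pos theta_pos[of k] kle P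
        by (simp add: less_imp_le)
      ultimately show ?thesis by simp
    next
      case False
      then have z: "\<eta> u = 0" if "u \<in> C" for u using that sp CL by blast
      then have k0: "k = 0" by (simp add: k_def)
      have "(\<Prod>u\<in>C. boundary_msg \<eta> u 1 0) \<le> (\<Prod>u\<in>C. bmax * boundary_msg \<eta> u 0 (\<eta> u))"
      proof (intro prod_mono conjI nn)
        fix u assume u: "u \<in> C"
        have "\<theta> (Suc (q u)) / \<theta> (q u) \<le> bmax" "0 < \<theta> (q u)"
          using qle[OF u] Delta by (auto intro!: theta_ratio_bounds theta_pos)
        then show "boundary_msg \<eta> u 1 0 \<le> bmax * boundary_msg \<eta> u 0 (\<eta> u)"
          using z[OF u] by (simp add: Z spin_weight_def divide_simps)
      qed
      also have "\<dots> = bmax ^ (\<Delta> - 1) * P" using C by (simp add: prod.distrib P_def)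
      finally have "lam * (\<Prod>u\<in>C. boundary_msg \<eta> u 1 0) \<le> lam * (bmax ^ (\<Delta> - 1) * P)"
        using lam_pos by simp
      also have "\<dots> = amax * (\<theta> k * P)" using k0 theta_pos[of 0] by (simp add: amax_def)
      finally show ?thesis .
    qed
  qed
  have tk: "0 < \<theta> k" "bmin \<le> \<theta> (Suc k) / \<theta> k" "\<theta> (Suc k) / \<theta> k \<le> bmax"
    using kle Delta by (auto intro!: theta_ratio_bounds theta_pos)
  then have tk': "bmin * \<theta> k \<le> \<theta> (Suc k)" "\<theta> (Suc k) \<le> bmax * \<theta> k"
    by (simp_all add: divide_simps)
  show "0 < msg_step (boundary_msg \<eta>) v 0 0 \<and> 0 * msg_step (boundary_msg \<eta>) v 0 0 \<le>
    msg_step (boundary_msg \<eta>) v 0 1 \<and>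
    msg_step (boundary_msg \<eta>) v 0 1 \<le> amax * msg_step (boundary_msg \<eta>) v 0 0 \<and>
    bmin * msg_step (boundary_msg \<eta>) v 0 0 \<le> msg_step (boundary_msg \<eta>) v 1 0 \<and>
      msg_step (boundary_msg \<eta>) v 1 0 \<le> bmax * msg_step (boundary_msg \<eta>) v 0 0 \<and>
    msg_step (boundary_msg \<eta>) v 1 1 = 0"
    unfolding S0 msg_step_1 C_def[symmetric]
    using tk(1) P S1 lam_pos mult_right_mono[OF tk'(1), of P] mult_right_mono[OF tk'(2), of P]
    by (simp add: mult_ac)
qed

lemma msg_bounds_iterate:
  assumes \<eta>: "\<eta> \<in> hardcore_configs \<Delta> (bdry \<Delta> (B (Suc m + k)))"
  shows "msg_bounds (Suc m) (bounds k) ((msg_step ^^ Suc k) (boundary_msg \<eta>))"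
proof -
  have "j \<le> k \<Longrightarrow> msg_bounds (Suc m + k - j) (bounds j) ((msg_step ^^ Suc j) (boundary_msg \<eta>))" for j
  proof (induction j)
    case 0
    then show ?case using msg_bounds_boundary[OF \<eta>] by (simp add: bounds_def)
  next
    case (Suc j)
    have e: "Suc m + k - j = Suc (Suc m + k - Suc j)" using Suc.prems by simp
    have b: "bounds j = (lo j, up j, al j, be j)" by (simp add: lo_def up_def al_def be_def)
    have "msg_bounds (Suc (Suc m + k - Suc j)) (lo j, up j, al j, be j) ((msg_step ^^ Suc j)
      (boundary_msg \<eta>))"
      using Suc unfolding e b by simp
    then have "msg_bounds (Suc m + k - Suc j) (bound_step (lo j, up j, al j, be j)) (msg_step
      ((msg_step ^^ Suc j) (boundary_msg \<eta>)))"
      using bounds_order[of j] Suc.prems by (intro msg_bounds_step) auto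
    then show ?case unfolding b[symmetric] by (simp add: bounds_def)
  qed
  from this[of k] show ?thesis by simp
qed

lemma finite_volume_bounds:
  assumes \<eta>: "\<eta> \<in> hardcore_configs \<Delta> (bdry \<Delta> (B (m + Suc k)))" and \<omega>: "\<omega> \<in> configs (B (Suc m))"
  defines "p \<equiv> finite_volume_prob \<Delta> lam \<theta> (B (m + Suc k)) \<eta> (B (Suc m)) \<omega>"
  shows "ball_weight m (\<lambda>_. edge_msg (lo k) (al k)) \<omega> / partition_fun m (\<lambda>_.
    edge_msg (up k) (be k)) \<le> p"
    and "p \<le> ball_weight m (\<lambda>_. edge_msg (up k) (be k)) \<omega> / partition_fun m (\<lambda>_.
      edge_msg (lo k) (al k))"
proof -
  have "\<eta> \<in> configs (bdry \<Delta> (B (m + Suc k)))" using \<eta> by (simp add: hardcore_configs_def)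
  then have p: "p = ball_weight m ((msg_step ^^ Suc k) (boundary_msg \<eta>)) \<omega> / partition_fun m
    ((msg_step ^^ Suc k) (boundary_msg \<eta>))"
    unfolding p_def using \<omega> by (intro finite_volume_prob_eq) auto
  have "msg_bounds (Suc m) (lo k, up k, al k, be k) ((msg_step ^^ Suc k) (boundary_msg \<eta>))"
    using msg_bounds_iterate[of \<eta> m k] \<eta> by (simp add: lo_def up_def al_def be_def)
  from ball_weight_ratio_bounds[OF this _ _ \<omega>] bounds_order[of k]
  show "ball_weight m (\<lambda>_. edge_msg (lo k) (al k)) \<omega> / partition_fun m (\<lambda>_.
    edge_msg (up k) (be k)) \<le> p"
    and "p \<le> ball_weight m (\<lambda>_. edge_msg (up k) (be k)) \<omega> / partition_fun m (\<lambda>_.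
      edge_msg (lo k) (al k))"
    unfolding p by auto
qed

lemma tendsto_edge_msg: "(a \<longlongrightarrow> x) F \<Longrightarrow> (b \<longlongrightarrow> y) F \<Longrightarrow> ((\<lambda>k. edge_msg (a k) (b k) s t) \<longlongrightarrow> edge_msg x y s t)
  F"
  by (simp add: edge_msg_def)

lemma tendsto_ball_weight: "(a \<longlongrightarrow> x) F \<Longrightarrow> (b \<longlongrightarrow> y) F \<Longrightarrow> ((\<lambda>k. ball_weight n (\<lambda>_.
  edge_msg (a k) (b k)) \<omega>) \<longlongrightarrow> ball_weight n (\<lambda>_. edge_msg x y) \<omega>) F"
  unfolding ball_weight_def by (intro tendsto_intros tendsto_edge_msg)

lemma tendsto_partition_fun: "(a \<longlongrightarrow> x) F \<Longrightarrow> (b \<longlongrightarrow> y) F \<Longrightarrow> ((\<lambda>k. partition_fun n (\<lambda>_.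
  edge_msg (a k) (b k))) \<longlongrightarrow> partition_fun n (\<lambda>_. edge_msg x y)) F"
  unfolding partition_fun_def by (intro tendsto_sum tendsto_ball_weight)

end

section \<open>Measures on configurations of the tree\<close>

definition cylinder_prob :: "(node \<Rightarrow> nat) measure \<Rightarrow> node set \<Rightarrow> (node \<Rightarrow> nat) \<Rightarrow> real" where
  "cylinder_prob \<mu> S \<omega> = measure \<mu> {\<sigma> \<in> space \<mu>. restrict \<sigma> S = \<omega>}"

text \<open>Kolmogorov extension for spins. The spins are embedded in the reals, where the extension
  theorem for Polish spaces applies, and the resulting real-valued field is mapped back to spins
  by \<open>c\<close>.\<close>

lemma extension_of_consistent_pmfs:
  fixes U :: "nat \<Rightarrow> node set" and p :: "nat \<Rightarrow> (node \<Rightarrow> nat) pmf"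
  assumes U: "\<And>n. finite (U n)" "\<And>n. U n \<subseteq> U (Suc n)" "(\<Union>n. U n) = V"
    and supp: "\<And>n. set_pmf (p n) \<subseteq> configs (U n)"
    and cons: "\<And>n. map_pmf (\<lambda>\<xi>. restrict \<xi> (U n)) (p (Suc n)) = p n"
  shows "\<exists>\<mu>. prob_space \<mu> \<and> sets \<mu> = sets (Pi\<^sub>M V (\<lambda>_. count_space {0, 1})) \<and>
    (\<forall>n. \<forall>\<omega>\<in>configs (U n). cylinder_prob \<mu> (U n) \<omega> = pmf (p n) \<omega>)"
proof -
  define r :: "(node \<Rightarrow> nat) \<Rightarrow> node \<Rightarrow> real" where "r \<xi> = (\<lambda>i. real (\<xi> i))" for \<xi>
  define R where "R J n = distr (measure_pmf (p n)) (Pi\<^sub>M J (\<lambda>_. borel)) (\<lambda>\<xi>. restrict (r \<xi>) J)"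
    for J n
  define k where "k J = (LEAST n. J \<subseteq> U n)" for J
  have Umono: "m \<le> n \<Longrightarrow> U m \<subseteq> U n" for m n
    by (rule lift_Suc_mono_le[of U]) (use U(2) in auto)
  have meas: "(\<lambda>\<xi>. restrict (r \<xi>) J) \<in> measurable (measure_pmf q) (Pi\<^sub>M J (\<lambda>_. borel))" for J q
    by (intro measurable_restrict) auto
  have cons': "map_pmf (\<lambda>\<xi>. restrict \<xi> (U m)) (p n) = p m" if "m \<le> n" for m n
    using that
  proof (induction n rule: dec_induct)
    case base
    have "map_pmf (\<lambda>\<xi>. restrict \<xi> (U m)) (p m) = map_pmf (\<lambda>\<xi>. \<xi>) (p m)"
      using supp[of m] by (intro map_pmf_cong refl) (auto simp: restrict_id_configs)
    then show ?case unfolding map_pmf_ident .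
  next
    case (step n)
    have "map_pmf (\<lambda>\<xi>. restrict \<xi> (U m)) (p (Suc n)) = map_pmf (\<lambda>\<xi>. restrict \<xi> (U m)) (map_pmf (\<lambda>\<xi>.
      restrict \<xi> (U n)) (p (Suc n)))"
      using Umono[OF step.hyps(1)] by (simp add: map_pmf_comp Int_absorb1)
    then show ?case by (simp only: cons step.IH)
  qed
  have R_eq: "R J n = R J m" if "J \<subseteq> U m" "m \<le> n" for J m n
  proof -
    have rr: "restrict (r (restrict \<xi> (U m))) J = restrict (r \<xi>) J" for \<xi>
      using that(1) by (auto simp: r_def fun_eq_iff)
    have "R J m = distr (distr (measure_pmf (p n)) (count_space UNIV) (\<lambda>\<xi>.
      restrict \<xi> (U m))) (Pi\<^sub>M J (\<lambda>_. borel)) (\<lambda>\<xi>. restrict (r \<xi>) J)"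
      unfolding R_def cons'[OF that(2), symmetric] map_pmf_rep_eq ..
    also have "\<dots> = R J n"
      unfolding R_def by (subst distr_distr) (auto simp: o_def rr space_PiM intro!:
        measurable_restrict)
    finally show ?thesis ..
  qed
  have ex: "\<exists>n. J \<subseteq> U n" if "finite J" "J \<subseteq> V" for J
    using that
  proof (induction J rule: finite_induct)
    case (insert j J)
    then obtain n where n: "J \<subseteq> U n" by auto
    obtain m where m: "j \<in> U m" using insert.prems U(3) by auto
    have "insert j J \<subseteq> U (max m n)" using n m Umono[of m "max m n"] Umono[of n "max m n"] by auto
    then show ?case ..
  qed simp
  have k: "J \<subseteq> U (k J)" if "finite J" "J \<subseteq> V" for J
    unfolding k_def using ex[OF that] by (rule LeastI_ex)
  have R_any: "R J (k J) = R J n" if "finite J" "J \<subseteq> V" "J \<subseteq> U n" for J n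
    using R_eq[OF k[OF that(1,2)], of n] R_eq[OF that(3), of "k J"] by (metis nle_le)
  interpret PP: polish_projective V "\<lambda>J. R J (k J)"
  proof (intro polish_projective.intro projective_family.intro)
    fix J H :: "node set" assume JH: "J \<subseteq> H" "finite H" "H \<subseteq> V"
    then have J: "finite J" "J \<subseteq> V" by (auto intro: finite_subset)
    have "distr (R H (k H)) (Pi\<^sub>M J (\<lambda>_. borel)) (\<lambda>f. restrict f J) = R J (k H)"
      unfolding R_def using JH
      by (subst distr_distr) (auto simp: o_def Int_absorb1 meas space_PiM intro!:
        measurable_restrict_subset)
    also have "\<dots> = R J (k J)"
      using JH J k[OF JH(2,3)] by (intro R_any[symmetric]) auto
    finally show "R J (k J) = distr (R H (k H)) (Pi\<^sub>M J (\<lambda>_. borel)) (\<lambda>f. restrict f J)" ..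
  next
    fix J :: "node set" assume "finite J" "J \<subseteq> V"
    show "prob_space (R J (k J))"
      unfolding R_def by (rule measure_pmf.prob_space_distr[OF meas])
  qed
  define c :: "(node \<Rightarrow> real) \<Rightarrow> node \<Rightarrow> nat" where "c \<sigma> = (\<lambda>i\<in>V. if \<sigma> i = 1 then 1 else 0)" for \<sigma>
  define \<mu> where "\<mu> = distr PP.lim (Pi\<^sub>M V (\<lambda>_. count_space {0, 1::nat})) c"
  have c: "c \<in> measurable PP.lim (Pi\<^sub>M V (\<lambda>_. count_space {0, 1::nat}))"
  proof -
    have "(\<lambda>\<sigma>::node \<Rightarrow> real. if \<sigma> i = 1 then 1 else 0 :: nat) \<in> measurable (Pi\<^sub>M V (\<lambda>_.
      borel)) (count_space {0, 1})" if "i \<in> V" for i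
    proof -
      have s: "{\<sigma> \<in> space (Pi\<^sub>M V (\<lambda>_. borel)). \<sigma> i = (1::real)} \<in> sets (Pi\<^sub>M V (\<lambda>_. borel))"
        using that by measurable
      show ?thesis by (rule measurable_If[OF _ _ s]) auto
    qed
    then have "c \<in> measurable (Pi\<^sub>M V (\<lambda>_. borel)) (Pi\<^sub>M V (\<lambda>_. count_space {0, 1::nat}))"
      unfolding c_def by (intro measurable_restrict) auto
    then show ?thesis
      by (subst measurable_cong_sets[OF PP.sets_lim refl])
  qed
  have "cylinder_prob \<mu> (U n) \<omega> = pmf (p n) \<omega>" if \<omega>: "\<omega> \<in> configs (U n)" for n \<omega>
  proof -
    have UV: "U n \<subseteq> V" using U(3) by auto
    define A where "A = (\<lambda>i. if \<omega> i = 1 then {1::real} else - {1})"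
    have AS: "Pi\<^sub>E (U n) A \<in> sets (Pi\<^sub>M (U n) (\<lambda>_. borel))"
      by (intro sets_PiM_I_finite U) (auto simp: A_def)
    have cylset: "{\<sigma> \<in> space \<mu>. restrict \<sigma> (U n) = \<omega>} \<in> sets (Pi\<^sub>M V (\<lambda>_. count_space {0, 1::nat}))"
    proof -
      have "{\<sigma> \<in> space \<mu>. restrict \<sigma> (U n) = \<omega>} = prod_emb V (\<lambda>_.
        count_space {0, 1::nat}) (U n) (\<Pi>\<^sub>E i\<in>U n. {\<omega> i})"
        using \<omega> by (auto simp: \<mu>_def prod_emb_def space_PiM PiE_iff configs_def extensional_def
          fun_eq_iff)
      also have "\<dots> \<in> sets (Pi\<^sub>M V (\<lambda>_. count_space {0, 1::nat}))"
        using \<omega> by (intro sets_PiM_I U UV) (auto simp: configs_def PiE_iff)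
      finally show ?thesis .
    qed
    have "cylinder_prob \<mu> (U n) \<omega> = measure PP.lim (c -` {\<sigma> \<in> space \<mu>. restrict \<sigma> (U n) =
      \<omega>} \<inter> space PP.lim)"
      unfolding cylinder_prob_def \<mu>_def by (rule measure_distr[OF c]) (use cylset in \<open>simp add:
        \<mu>_def\<close>)
    also have "c -` {\<sigma> \<in> space \<mu>. restrict \<sigma> (U n) = \<omega>} \<inter> space PP.lim =
      prod_emb V (\<lambda>_. borel) (U n) (Pi\<^sub>E (U n) A)"
    proof (intro set_eqI)
      fix \<sigma> :: "node \<Rightarrow> real"
      have "restrict (c \<sigma>) (U n) = \<omega> \<longleftrightarrow> (\<forall>i\<in>U n. c \<sigma> i = \<omega> i)"
        using \<omega> by (auto simp: configs_def PiE_iff extensional_def fun_eq_iff restrict_def)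
      also have "\<dots> \<longleftrightarrow> (\<forall>i\<in>U n. \<sigma> i \<in> A i)"
      proof (intro ball_cong refl)
        fix i assume i: "i \<in> U n"
        with UV have "i \<in> V" by auto
        with configs_spin[OF \<omega> i] show "c \<sigma> i = \<omega> i \<longleftrightarrow> \<sigma> i \<in> A i" by (auto simp: c_def A_def)
      qed
      finally have e: "restrict (c \<sigma>) (U n) = \<omega> \<longleftrightarrow> (\<forall>i\<in>U n. \<sigma> i \<in> A i)" .
      have "c \<sigma> \<in> space \<mu>"
        by (auto simp: \<mu>_def space_PiM c_def)
      then show "\<sigma> \<in> c -` {\<sigma> \<in> space \<mu>. restrict \<sigma> (U n) = \<omega>} \<inter> space PP.lim \<longleftrightarrow>
        \<sigma> \<in> prod_emb V (\<lambda>_. borel) (U n) (Pi\<^sub>E (U n) A)"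
        using e by (auto simp: prod_emb_def space_PiM PiE_iff)
    qed
    also have "measure PP.lim (prod_emb V (\<lambda>_. borel) (U n) (Pi\<^sub>E (U n) A)) =
      measure (R (U n) (k (U n))) (Pi\<^sub>E (U n) A)"
      by (rule PP.measure_lim_emb[OF UV U(1) AS])
    also have "\<dots> = measure (R (U n) n) (Pi\<^sub>E (U n) A)"
      using R_any[OF U(1) UV, of n] by simp
    also have "\<dots> = measure (measure_pmf (p n)) ((\<lambda>\<xi>. restrict (r \<xi>) (U n)) -` Pi\<^sub>E (U n) A \<inter> space
      (measure_pmf (p n)))"
      unfolding R_def by (rule measure_distr[OF meas AS])
    also have "\<dots> = measure (measure_pmf (p n)) ((\<lambda>\<xi>. restrict (r \<xi>) (U n)) -` Pi\<^sub>E (U n) A \<inter> set_pmf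
      (p n))"
      by (simp add: measure_Int_set_pmf)
    also have "(\<lambda>\<xi>. restrict (r \<xi>) (U n)) -` Pi\<^sub>E (U n) A \<inter> set_pmf (p n) = {\<omega>} \<inter> set_pmf (p n)"
    proof (intro set_eqI)
      fix \<xi> :: "node \<Rightarrow> nat"
      show "\<xi> \<in> (\<lambda>\<xi>. restrict (r \<xi>) (U n)) -` Pi\<^sub>E (U n) A \<inter> set_pmf (p n) \<longleftrightarrow> \<xi> \<in> {\<omega>} \<inter> set_pmf (p n)"
      proof (cases "\<xi> \<in> set_pmf (p n)")
        case True
        then have \<xi>: "\<xi> \<in> configs (U n)" using supp by auto
        have "restrict (r \<xi>) (U n) \<in> Pi\<^sub>E (U n) A \<longleftrightarrow> (\<forall>i\<in>U n. real (\<xi> i) \<in> A i)"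
          by (auto simp: PiE_iff r_def)
        also have "\<dots> \<longleftrightarrow> (\<forall>i\<in>U n. \<xi> i = \<omega> i)"
        proof (intro ball_cong refl)
          fix i assume i: "i \<in> U n"
          show "real (\<xi> i) \<in> A i \<longleftrightarrow> \<xi> i = \<omega> i"
            using configs_spin[OF \<omega> i] configs_spin[OF \<xi> i] by (auto simp: A_def)
        qed
        also have "\<dots> \<longleftrightarrow> \<xi> = \<omega>"
          using configs_eqI[OF \<xi> \<omega>] by auto
        finally show ?thesis using True by simp
      qed simp
    qed
    also have "measure (measure_pmf (p n)) ({\<omega>} \<inter> set_pmf (p n)) = pmf (p n) \<omega>"
      by (simp add: measure_Int_set_pmf measure_pmf_single)
    finally show ?thesis .
  qed
  moreover have "prob_space \<mu>"
    unfolding \<mu>_def by (rule PP.P.prob_space_distr[OF c])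
  moreover have "sets \<mu> = sets (Pi\<^sub>M V (\<lambda>_. count_space {0, 1}))" by (simp add: \<mu>_def)
  ultimately show ?thesis by blast
qed

lemma extension_of_consistent_densities:
  fixes U :: "nat \<Rightarrow> node set" and q :: "nat \<Rightarrow> (node \<Rightarrow> nat) \<Rightarrow> real"
  assumes U: "\<And>n. finite (U n)" "\<And>n. U n \<subseteq> U (Suc n)" "(\<Union>n. U n) = V"
    and nonneg: "\<And>n \<omega>. \<omega> \<in> configs (U n) \<Longrightarrow> 0 \<le> q n \<omega>"
    and total: "\<And>n. (\<Sum>\<omega>\<in>configs (U n). q n \<omega>) = 1"
    and cons: "\<And>n \<omega>. \<omega> \<in> configs (U n) \<Longrightarrow> (\<Sum>\<xi> | \<xi> \<in> configs (U (Suc n)) \<and> restrict \<xi> (U n) =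
      \<omega>. q (Suc n) \<xi>) = q n \<omega>"
  shows "\<exists>\<mu>. prob_space \<mu> \<and> sets \<mu> = sets (Pi\<^sub>M V (\<lambda>_. count_space {0, 1})) \<and>
    (\<forall>n. \<forall>\<omega>\<in>configs (U n). cylinder_prob \<mu> (U n) \<omega> = q n \<omega>)"
proof -
  define q' where "q' n \<omega> = (if \<omega> \<in> configs (U n) then q n \<omega> else 0)" for n \<omega>
  define p where "p n = embed_pmf (q' n)" for n
  have fin: "finite (configs (U n))" for n by (intro finite_configs U)
  have "(\<integral>\<^sup>+ x. ennreal (q' n x) \<partial>count_space UNIV) = 1" for n
  proof -
    have "(\<integral>\<^sup>+ x. ennreal (q' n x) \<partial>count_space UNIV) = (\<Sum>x\<in>configs (U n). ennreal (q' n x))"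
      by (rule nn_integral_count_space'[OF fin]) (auto simp: q'_def)
    also have "\<dots> = ennreal (\<Sum>x\<in>configs (U n). q' n x)"
      by (rule sum_ennreal) (auto simp: q'_def nonneg)
    also have "(\<Sum>x\<in>configs (U n). q' n x) = 1" using total[of n] by (simp add: q'_def)
    finally show ?thesis by simp
  qed
  then have p: "pmf (p n) \<omega> = q' n \<omega>" for n \<omega>
    unfolding p_def by (intro pmf_embed_pmf) (auto simp: q'_def nonneg)
  have supp: "set_pmf (p n) \<subseteq> configs (U n)" for n
    by (auto simp: set_pmf_iff p q'_def split: if_splits)
  have "map_pmf (\<lambda>\<xi>. restrict \<xi> (U n)) (p (Suc n)) = p n" for n
  proof (rule pmf_eqI)
    fix \<omega>
    let ?A = "{\<xi>. \<xi> \<in> configs (U (Suc n)) \<and> restrict \<xi> (U n) = \<omega>}"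
    have "(\<lambda>\<xi>. restrict \<xi> (U n)) -` {\<omega>} \<inter> set_pmf (p (Suc n)) = ?A \<inter> set_pmf (p (Suc n))"
      using supp[of "Suc n"] by auto
    from arg_cong[OF this, of "measure (measure_pmf (p (Suc n)))"]
    have "pmf (map_pmf (\<lambda>\<xi>. restrict \<xi> (U n)) (p (Suc n))) \<omega> = measure (measure_pmf (p (Suc n))) ?A"
      unfolding pmf_map measure_Int_set_pmf .
    also have "\<dots> = (\<Sum>\<xi>\<in>?A. pmf (p (Suc n)) \<xi>)"
      by (rule measure_measure_pmf_finite) (use fin in auto)
    also have "\<dots> = (\<Sum>\<xi>\<in>?A. q (Suc n) \<xi>)"
      by (intro sum.cong refl) (auto simp: p q'_def)
    also have "\<dots> = pmf (p n) \<omega>"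
    proof (cases "\<omega> \<in> configs (U n)")
      case True
      then show ?thesis by (simp add: cons p q'_def)
    next
      case False
      then have e: "?A = {}" using restrict_configs[OF U(2)[of n]] by blast
      show ?thesis unfolding e using False by (simp add: p q'_def)
    qed
    finally show "pmf (map_pmf (\<lambda>\<xi>. restrict \<xi> (U n)) (p (Suc n))) \<omega> = pmf (p n) \<omega>" .
  qed
  from extension_of_consistent_pmfs[of U, OF U supp this] show ?thesis
    by (simp add: p q'_def)
qed

locale config_measure = prob_space \<mu> for \<mu> :: "(node \<Rightarrow> nat) measure" +
  fixes \<Delta> :: nat
  assumes sets_mu: "sets \<mu> = sets (config_space \<Delta>)"
begin

lemma space_mu: "space \<mu> = configs (tree_nodes \<Delta>)"
  using sets_eq_imp_space_eq[OF sets_mu] by (simp add: space_config_space)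

lemma cylinder_measurable:
  assumes "finite S" "S \<subseteq> tree_nodes \<Delta>"
  shows "{\<sigma> \<in> space \<mu>. restrict \<sigma> S = \<omega>} \<in> sets \<mu>"
proof (cases "\<omega> \<in> configs S")
  case True
  have "{\<sigma> \<in> space \<mu>. restrict \<sigma> S = \<omega>} = prod_emb (tree_nodes \<Delta>) (\<lambda>_.
    count_space {0, 1::nat}) S (\<Pi>\<^sub>E i\<in>S. {\<omega> i})"
    using True by (auto simp: space_mu prod_emb_def PiE_iff configs_def extensional_def fun_eq_iff)
  also have "\<dots> \<in> sets \<mu>"
    unfolding sets_mu config_space_def using True assms
      by (intro sets_PiM_I) (auto simp: configs_def PiE_iff)
  finally show ?thesis .
next
  case False
  then have "{\<sigma> \<in> space \<mu>. restrict \<sigma> S = \<omega>} = {}"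
    using restrict_configs[OF assms(2)] by (auto simp: space_mu)
  then show ?thesis by (simp only: sets.empty_sets)
qed

lemma measure_restrict_in:
  assumes "finite S" "S \<subseteq> tree_nodes \<Delta>"
  shows "measure \<mu> {\<sigma> \<in> space \<mu>. restrict \<sigma> S \<in> X} = (\<Sum>\<xi> | \<xi> \<in> configs S \<and>
    \<xi> \<in> X. cylinder_prob \<mu> S \<xi>)"
proof -
  let ?A = "{\<xi>. \<xi> \<in> configs S \<and> \<xi> \<in> X}"
  have "{\<sigma> \<in> space \<mu>. restrict \<sigma> S \<in> X} = (\<Union>\<xi>\<in>?A. {\<sigma> \<in> space \<mu>. restrict \<sigma> S = \<xi>})"
    using restrict_configs[OF assms(2)] by (auto simp: space_mu)
  also have "measure \<mu> \<dots> = (\<Sum>\<xi>\<in>?A. cylinder_prob \<mu> S \<xi>)"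
    unfolding cylinder_prob_def using assms
    by (intro finite_measure_finite_Union) (auto simp: finite_configs disjoint_family_on_def
      cylinder_measurable)
  finally show ?thesis .
qed

lemma measurable_restrict_in:
  assumes "finite S" "S \<subseteq> tree_nodes \<Delta>"
  shows "{\<sigma> \<in> space \<mu>. restrict \<sigma> S \<in> X} \<in> sets \<mu>"
proof -
  let ?A = "{\<xi>. \<xi> \<in> configs S \<and> \<xi> \<in> X}"
  have "{\<sigma> \<in> space \<mu>. restrict \<sigma> S \<in> X} = (\<Union>\<xi>\<in>?A. {\<sigma> \<in> space \<mu>. restrict \<sigma> S = \<xi>})"
    using restrict_configs[OF assms(2)] by (auto simp: space_mu)
  also have "\<dots> \<in> sets \<mu>" using assms by (intro sets.finite_UN)
    (auto simp: finite_configs cylinder_measurable)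
  finally show ?thesis .
qed

lemma cylinder_prob_marginal:
  assumes "finite U" "U \<subseteq> tree_nodes \<Delta>" "S \<subseteq> U"
  shows "cylinder_prob \<mu> S \<omega> = (\<Sum>\<xi> | \<xi> \<in> configs U \<and> restrict \<xi> S = \<omega>. cylinder_prob \<mu> U \<xi>)"
proof -
  have "{\<sigma> \<in> space \<mu>. restrict \<sigma> S = \<omega>} = {\<sigma> \<in> space \<mu>. restrict \<sigma> U \<in> {\<xi>. restrict \<xi> S = \<omega>}}"
    using assms(3) by (simp add: Int_absorb1)
  then show ?thesis
    unfolding cylinder_prob_def[of \<mu> S] using measure_restrict_in[OF assms(1,2), of "{\<xi>.
      restrict \<xi> S = \<omega>}"] by simp
qed

end

text \<open>Every finite set of nodes lies in some \<open>U n\<close>, so the probabilities of the configurations on the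
  sets \<open>U n\<close> determine a measure.\<close>

lemma config_measure_eqI:
  assumes "config_measure \<mu> \<Delta>" "config_measure \<mu>' \<Delta>"
    and U: "\<And>n. finite (U n)" "\<And>J. finite J \<Longrightarrow> J \<subseteq> tree_nodes \<Delta> \<Longrightarrow> \<exists>n::nat. J \<subseteq> U n"
      "\<And>n. U n \<subseteq> tree_nodes \<Delta>"
    and eq: "\<And>n \<omega>. \<omega> \<in> configs (U n) \<Longrightarrow> cylinder_prob \<mu> (U n) \<omega> = cylinder_prob \<mu>' (U n) \<omega>"
  shows "\<mu> = \<mu>'"
proof -
  interpret \<mu>: config_measure \<mu> \<Delta> by fact
  interpret \<mu>': config_measure \<mu>' \<Delta> by fact
  show ?thesis
  proof (rule measure_eqI_PiM_infinite)
    show "sets \<mu> = sets (Pi\<^sub>M (tree_nodes \<Delta>) (\<lambda>_. count_space {0, 1}))"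
      "sets \<mu>' = sets (Pi\<^sub>M (tree_nodes \<Delta>) (\<lambda>_. count_space {0, 1}))"
      using \<mu>.sets_mu \<mu>'.sets_mu by (simp_all add: config_space_def)
    show "finite_measure \<mu>" by unfold_locales
    fix A J assume J: "finite J" "J \<subseteq> tree_nodes \<Delta>" and A: "\<And>i. i \<in> J \<Longrightarrow>
      A i \<in> sets (count_space {0, 1::nat})"
    obtain n where n: "J \<subseteq> U n" using U(2)[OF J] by blast
    let ?X = "{\<xi>. restrict \<xi> J \<in> Pi\<^sub>E J A}"
    have E: "prod_emb (tree_nodes \<Delta>) (\<lambda>_. count_space {0, 1}) J (Pi\<^sub>E J A) =
      {\<sigma> \<in> configs (tree_nodes \<Delta>). restrict \<sigma> (U n) \<in> ?X}"
    proof -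
      have "restrict (restrict \<sigma> (U n)) J = restrict \<sigma> J" for \<sigma> :: "node \<Rightarrow> nat"
        using n by (simp add: Int_absorb1)
      then show ?thesis
        unfolding prod_emb_def configs_def
        by (intro set_eqI) (simp only: Int_iff vimage_eq mem_Collect_eq space_count_space
          conj_commute)
    qed
    have "measure \<mu> {\<sigma> \<in> configs (tree_nodes \<Delta>). restrict \<sigma> (U n) \<in> ?X} =
      measure \<mu>' {\<sigma> \<in> configs (tree_nodes \<Delta>). restrict \<sigma> (U n) \<in> ?X}"
      using \<mu>.measure_restrict_in[OF U(1) U(3), of n ?X] \<mu>'.measure_restrict_in[OF U(1) U(3), of n
        ?X] eq[of _ n]
      unfolding \<mu>.space_mu \<mu>'.space_mu by simp
    then show "emeasure \<mu> (prod_emb (tree_nodes \<Delta>) (\<lambda>_. count_space {0, 1}) J (Pi\<^sub>E J A)) =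
      emeasure \<mu>' (prod_emb (tree_nodes \<Delta>) (\<lambda>_. count_space {0, 1}) J (Pi\<^sub>E J A))"
      unfolding E \<mu>.emeasure_eq_measure \<mu>'.emeasure_eq_measure by simp
  qed
qed

context log_convex_model
begin

section \<open>A unique solution forces a unique Gibbs measure\<close>

lemma gibbs_config_measure: "gibbs_measure \<Delta> lam \<theta> \<mu> \<Longrightarrow> config_measure \<mu> \<Delta>"
  by (auto simp: gibbs_measure_def config_measure_def config_measure_axioms_def)

lemma finite_subset_B:
  assumes "finite J" "J \<subseteq> T"
  shows "\<exists>n. J \<subseteq> B n"
proof -
  have "J \<subseteq> B (Max (insert 0 (length ` J)))"
    using assms by (auto simp: B_def)
  then show ?thesis ..
qed

lemma hardcore_restrict:
  assumes "\<sigma> \<in> hardcore_configs \<Delta> T" "V \<subseteq> T"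
  shows "restrict \<sigma> V \<in> hardcore_configs \<Delta> V"
proof -
  have "restrict \<sigma> V \<in> configs V"
    using assms by (intro restrict_configs[of V T]) (auto simp: hardcore_configs_def)
  then show ?thesis using assms by (auto simp: hardcore_configs_def)
qed

text \<open>A Gibbs measure is concentrated on hard-core configurations, so no mass is lost by summing only
  over hard-core boundary conditions.\<close>

lemma gibbs_boundary_total:
  assumes g: "gibbs_measure \<Delta> lam \<theta> \<mu>" and V: "finite V" "V \<subseteq> T"
  shows "(\<Sum>\<eta>\<in>hardcore_configs \<Delta> V. cylinder_prob \<mu> V \<eta>) = 1"
proof -
  interpret config_measure \<mu> \<Delta> using g by (rule gibbs_config_measure)
  have "AE \<sigma> in \<mu>. \<sigma> \<in> hardcore_configs \<Delta> T" using g by (simp add: gibbs_measure_def)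
  then have "AE \<sigma> in \<mu>. \<sigma> \<in> {\<sigma> \<in> space \<mu>. restrict \<sigma> V \<in> hardcore_configs \<Delta> V}"
    using AE_space by eventually_elim (use hardcore_restrict V in auto)
  then have "measure \<mu> {\<sigma> \<in> space \<mu>. restrict \<sigma> V \<in> hardcore_configs \<Delta> V} = 1"
    using prob_eq_1[OF measurable_restrict_in[OF V]] by blast
  moreover have "{\<xi>. \<xi> \<in> configs V \<and> \<xi> \<in> hardcore_configs \<Delta> V} = hardcore_configs \<Delta> V"
    by (auto simp: hardcore_configs_def)
  ultimately show ?thesis using measure_restrict_in[OF V, of "hardcore_configs \<Delta> V"] by simp
qed

text \<open>The probability is an average of finite-volume probabilities over boundary conditions, all of
  which obey the same bounds.\<close>

lemma gibbs_cylinder_bounds: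
  assumes g: "gibbs_measure \<Delta> lam \<theta> \<mu>" and \<omega>: "\<omega> \<in> configs (B (Suc m))"
  shows "ball_weight m (\<lambda>_. edge_msg (lo k) (al k)) \<omega> / partition_fun m (\<lambda>_.
    edge_msg (up k) (be k)) \<le> cylinder_prob \<mu> (B (Suc m)) \<omega>"
    and "cylinder_prob \<mu> (B (Suc m)) \<omega> \<le> ball_weight m (\<lambda>_.
      edge_msg (up k) (be k)) \<omega> / partition_fun m (\<lambda>_. edge_msg (lo k) (al k))"
proof -
  let ?N = "m + Suc k"
  let ?V = "bdry \<Delta> (B ?N)"
  let ?p = "\<lambda>\<eta>. finite_volume_prob \<Delta> lam \<theta> (B ?N) \<eta> (B (Suc m)) \<omega>"
  define a where "a = ball_weight m (\<lambda>_. edge_msg (lo k) (al k)) \<omega> / partition_fun m (\<lambda>_.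
    edge_msg (up k) (be k))"
  define b where "b = ball_weight m (\<lambda>_. edge_msg (up k) (be k)) \<omega> / partition_fun m (\<lambda>_.
    edge_msg (lo k) (al k))"
  have fin: "finite (B ?N)" "B ?N \<subseteq> T" "B (Suc m) \<subseteq> B ?N"
    by (auto simp: finite_B B_subset_T B_mono)
  have V: "finite ?V" "?V \<subseteq> T" using finite_bdry[OF fin(1,2)] bdry_subset_T by auto
  have eq: "cylinder_prob \<mu> (B (Suc m)) \<omega> = (\<Sum>\<eta>\<in>hardcore_configs \<Delta> ?V. ?p \<eta> * cylinder_prob \<mu> ?V \<eta>)"
    using g fin \<omega> unfolding gibbs_measure_def cylinder_prob_def by blast
  have tot: "(\<Sum>\<eta>\<in>hardcore_configs \<Delta> ?V. cylinder_prob \<mu> ?V \<eta>) = 1"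
    using gibbs_boundary_total[OF g V] .
  have nn: "0 \<le> cylinder_prob \<mu> ?V \<eta>" for \<eta> by (simp add: cylinder_prob_def)
  have p: "a \<le> ?p \<eta>" "?p \<eta> \<le> b" if "\<eta> \<in> hardcore_configs \<Delta> ?V" for \<eta>
    unfolding a_def b_def using finite_volume_bounds[OF that \<omega>] by auto
  have "a = (\<Sum>\<eta>\<in>hardcore_configs \<Delta> ?V. a * cylinder_prob \<mu> ?V \<eta>)"
    using tot by (simp add: sum_distrib_left[symmetric])
  also have "\<dots> \<le> cylinder_prob \<mu> (B (Suc m)) \<omega>"
    unfolding eq using p nn by (intro sum_mono mult_right_mono) auto
  finally show "ball_weight m (\<lambda>_. edge_msg (lo k) (al k)) \<omega> / partition_fun m (\<lambda>_.
    edge_msg (up k) (be k)) \<le> cylinder_prob \<mu> (B (Suc m)) \<omega>"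
    unfolding a_def .
  have "cylinder_prob \<mu> (B (Suc m)) \<omega> \<le> (\<Sum>\<eta>\<in>hardcore_configs \<Delta> ?V. b * cylinder_prob \<mu> ?V \<eta>)"
    unfolding eq using p nn by (intro sum_mono mult_right_mono) auto
  also have "\<dots> = b" using tot by (simp add: sum_distrib_left[symmetric])
  finally show "cylinder_prob \<mu> (B (Suc m)) \<omega> \<le> ball_weight m (\<lambda>_.
    edge_msg (up k) (be k)) \<omega> / partition_fun m (\<lambda>_. edge_msg (lo k) (al k))"
    unfolding b_def .
qed

lemma edge_msg_nonneg: "0 \<le> a \<Longrightarrow> 0 \<le> b \<Longrightarrow> 0 \<le> edge_msg a b s t"
  by (simp add: edge_msg_def)

text \<open>With \<open>(x, y)\<close> also \<open>(y, x)\<close> is a solution. Hence uniqueness gives \<open>x =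
  y\<close>: the lower and the upper
  bounds have the same limit, which then is the probability under every Gibbs measure.\<close>

lemma gibbs_measure_unique:
  assumes un: "\<And>p p'. p \<in> system_solutions \<Delta> lam \<theta> \<Longrightarrow> p' \<in> system_solutions \<Delta> lam \<theta> \<Longrightarrow> p = p'"
    and g: "gibbs_measure \<Delta> lam \<theta> \<mu>" "gibbs_measure \<Delta> lam \<theta> \<mu>'"
  shows "\<mu> = \<mu>'"
proof -
  obtain x y where lim: "lo \<longlonglongrightarrow> x" "up \<longlonglongrightarrow> y" "al \<longlonglongrightarrow> f x" "be \<longlonglongrightarrow> f y"
    and sol: "(x, y) \<in> system_solutions \<Delta> lam \<theta>"
    by (rule bounds_limits)
  have "(y, x) \<in> system_solutions \<Delta> lam \<theta>" using sol by (simp add: solutions_iff)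
  then have xy: "y = x" using un[OF sol] by auto
  have x0: "0 \<le> x" using sol by (simp add: solutions_iff)
  have Z0: "partition_fun m (\<lambda>_. edge_msg x (f x)) \<noteq> 0" for m
    using x0 f_pos[OF x0] by (intro less_imp_neq[THEN not_sym] partition_fun_pos edge_msg_nonneg)
      (auto simp: edge_msg_def)
  have val: "cylinder_prob \<mu> (B (Suc m)) \<omega> = ball_weight m (\<lambda>_.
    edge_msg x (f x)) \<omega> / partition_fun m (\<lambda>_. edge_msg x (f x))"
    if g: "gibbs_measure \<Delta> lam \<theta> \<mu>" and \<omega>: "\<omega> \<in> configs (B (Suc m))" for \<mu> m \<omega>
  proof (rule antisym)
    have "(\<lambda>k. ball_weight m (\<lambda>_. edge_msg (up k) (be k)) \<omega> / partition_fun m (\<lambda>_.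
      edge_msg (lo k) (al k)))
      \<longlonglongrightarrow> ball_weight m (\<lambda>_. edge_msg x (f x)) \<omega> / partition_fun m (\<lambda>_. edge_msg x (f x))"
      using lim Z0 unfolding xy by (intro tendsto_divide tendsto_ball_weight tendsto_partition_fun)
    then show "cylinder_prob \<mu> (B (Suc m)) \<omega> \<le> ball_weight m (\<lambda>_.
      edge_msg x (f x)) \<omega> / partition_fun m (\<lambda>_. edge_msg x (f x))"
      by (rule LIMSEQ_le_const) (use gibbs_cylinder_bounds(2)[OF g \<omega>] in blast)
    have "(\<lambda>k. ball_weight m (\<lambda>_. edge_msg (lo k) (al k)) \<omega> / partition_fun m (\<lambda>_.
      edge_msg (up k) (be k)))
      \<longlonglongrightarrow> ball_weight m (\<lambda>_. edge_msg x (f x)) \<omega> / partition_fun m (\<lambda>_. edge_msg x (f x))"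
      using lim Z0 unfolding xy by (intro tendsto_divide tendsto_ball_weight tendsto_partition_fun)
    then show "ball_weight m (\<lambda>_. edge_msg x (f x)) \<omega> / partition_fun m (\<lambda>_. edge_msg x (f x)) \<le>
      cylinder_prob \<mu> (B (Suc m)) \<omega>"
      by (rule LIMSEQ_le_const2) (use gibbs_cylinder_bounds(1)[OF g \<omega>] in blast)
  qed
  show ?thesis
  proof (rule config_measure_eqI[OF g[THEN gibbs_config_measure], of "\<lambda>n. B (Suc n)"])
    show "\<exists>n. J \<subseteq> B (Suc n)" if "finite J" "J \<subseteq> T" for J
      using finite_subset_B[OF that] B_mono[of _ "Suc _"] by (meson le_SucI order_refl order_trans)
  qed (use val g finite_B B_subset_T in auto)
qed

section \<open>Every solution gives a Gibbs measure\<close>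

lemma ball_weight_not_hardcore:
  assumes "i \<in> B n" "j \<in> neighbors i" "\<xi> i = 1" "\<xi> j = 1"
  shows "ball_weight n Z \<xi> = 0"
proof -
  have "\<xi> j \<le> (\<Sum>u\<in>neighbors i. \<xi> u)"
    using assms B_subset_T by (intro member_le_sum finite_neighbors) auto
  then have "node_weight i \<xi> = 0" using assms by (simp add: node_weight_def spin_weight_def)
  then show ?thesis using assms(1) finite_B by (auto simp: ball_weight_def)
qed

lemma exp_neg_nonneg: "0 \<le> exp_neg h" by (simp add: exp_neg_def)

text \<open>Take a ball that contains \<open>\<Lambda>\<close> and its boundary in its interior. The density on this ball is the
  product of \<open>h\<close>, the Boltzmann weight of \<open>\<Lambda>\<close>, which depends on the spins in \<open>\<Lambda>\<close> and on its boundary,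
  and of \<open>G\<close>, which does not depend on the spins in \<open>\<Lambda>\<close>. So conditioning on the boundary leaves the
  finite-volume distribution of \<open>\<Lambda>\<close>.\<close>

lemma gibbs_of_message_density:
  assumes cm: "config_measure \<mu> \<Delta>"
    and cylinder_prob: "\<And>n \<omega>. \<omega> \<in> configs (B (Suc n)) \<Longrightarrow>
      cylinder_prob \<mu> (B (Suc n)) \<omega> = ball_weight n Z \<omega> / partition_fun n Z"
  shows "gibbs_measure \<Delta> lam \<theta> \<mu>"
proof -
  interpret config_measure \<mu> \<Delta> by fact
  have AE1: "AE \<sigma> in \<mu>. \<not> (tree_adj \<Delta> i j \<and> \<sigma> i = 1 \<and> \<sigma> j = 1)" for i j
  proof (cases "tree_adj \<Delta> i j")
    case True
    then have ij: "j \<in> neighbors i" "i \<in> T" by (auto simp: neighbors_def tree_adj_def)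
    define n where "n = length i"
    have i: "i \<in> B n" using ij by (simp add: B_def n_def)
    have j: "j \<in> B (Suc n)" "i \<in> B (Suc n)" using neighbors_B[OF i] ij i B_mono[of n "Suc n"] by auto
    let ?X = "{\<xi>::node \<Rightarrow> nat. \<xi> i = 1 \<and> \<xi> j = 1}"
    have "measure \<mu> {\<sigma> \<in> space \<mu>. restrict \<sigma> (B (Suc n)) \<in> ?X} =
      (\<Sum>\<xi> | \<xi> \<in> configs (B (Suc n)) \<and> \<xi> \<in> ?X. cylinder_prob \<mu> (B (Suc n)) \<xi>)"
      by (rule measure_restrict_in[OF finite_B B_subset_T])
    also have "\<dots> = 0"
      by (intro sum.neutral) (use cylinder_prob ball_weight_not_hardcore[OF i ij(1)] in auto)
    finally have "AE \<sigma> in \<mu>. \<sigma> \<notin> {\<sigma> \<in> space \<mu>. restrict \<sigma> (B (Suc n)) \<in> ?X}"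
      using prob_eq_0[OF measurable_restrict_in[OF finite_B B_subset_T]] by blast
    then show ?thesis using AE_space by eventually_elim (use j in auto)
  qed simp
  then have "AE \<sigma> in \<mu>. \<forall>i j. \<not> (tree_adj \<Delta> i j \<and> \<sigma> i = 1 \<and> \<sigma> j = 1)"
    unfolding AE_all_countable by blast
  then have AE: "AE \<sigma> in \<mu>. \<sigma> \<in> hardcore_configs \<Delta> T"
    using AE_space by eventually_elim (auto simp: hardcore_configs_def space_mu)
  have spec: "cylinder_prob \<mu> S \<omega> = (\<Sum>\<eta>\<in>hardcore_configs \<Delta> (bdry \<Delta> \<Lambda>).
    finite_volume_prob \<Delta> lam \<theta> \<Lambda> \<eta> S \<omega> * cylinder_prob \<mu> (bdry \<Delta> \<Lambda>) \<eta>)"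
    if \<Lambda>: "finite \<Lambda>" "\<Lambda> \<subseteq> T" and S: "S \<subseteq> \<Lambda>" and \<omega>: "\<omega> \<in> configs S" for \<Lambda> S \<omega>
  proof -
    define V where "V = bdry \<Delta> \<Lambda>"
    have Vf: "finite V" "V \<subseteq> T" "\<Lambda> \<inter> V = {}" using finite_bdry[OF \<Lambda>] bdry_subset_T[of \<Lambda>]
      by (auto simp: V_def)
    obtain n where n: "\<Lambda> \<union> V \<subseteq> B n" using finite_subset_B[of "\<Lambda> \<union> V"] \<Lambda> Vf by auto
    define U where "U = B (Suc n)"
    define R where "R = U - (\<Lambda> \<union> V)"
    have U: "U = \<Lambda> \<union> (V \<union> R)" "finite U" "U \<subseteq> T" and disj: "\<Lambda> \<inter> (V \<union> R) = {}" "V \<inter> R = {}"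
      using n B_mono[of n "Suc n"] Vf by (auto simp: U_def R_def finite_B dest: subsetD[OF
        B_subset_T])
    have SU: "S \<subseteq> U" "V \<subseteq> U" using S unfolding U(1) by auto
    define m where "m \<nu> \<eta> \<zeta> = merge \<Lambda> (V \<union> R) (\<nu>, merge V R (\<eta>, \<zeta>))" for \<nu> \<eta> \<zeta> :: "node \<Rightarrow> nat"
    have split: "(\<Sum>\<xi>\<in>configs U. F \<xi>) = (\<Sum>\<eta>\<in>configs V. \<Sum>\<nu>\<in>configs \<Lambda>. \<Sum>\<zeta>\<in>configs R. F (m \<nu> \<eta> \<zeta>))"
      for F :: "_ \<Rightarrow> real"
      unfolding U(1) sum_configs_Un[OF disj(1)] sum_configs_Un[OF disj(2)] m_def by (rule sum.swap)
    have mv: "i \<in> \<Lambda> \<Longrightarrow> m \<nu> \<eta> \<zeta> i = \<nu> i" "i \<in> V \<Longrightarrow> m \<nu> \<eta> \<zeta> i = \<eta> i" "i \<notin> \<Lambda> \<Longrightarrow> m \<nu> \<eta> \<zeta> i = m \<nu>' \<eta> \<zeta> i"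
      for i \<nu> \<nu>' \<eta> \<zeta>
      using disj Vf(3) by (auto simp: m_def merge_def)
    define h where "h \<nu> \<eta> = exp_neg (hamiltonian \<Delta> lam \<theta> \<Lambda> (merge \<Lambda> V (\<nu>, \<eta>)))" for \<nu> \<eta>
    have h0: "0 \<le> h \<nu> \<eta>" for \<nu> \<eta> by (simp add: h_def exp_neg_nonneg)
    have IB: "affected \<Lambda> \<subseteq> B n"
    proof
      fix i assume i: "i \<in> affected \<Lambda>"
      have "nbhd \<Delta> i \<subseteq> \<Lambda> \<union> V" using nbhd_affected_subset[OF \<Lambda>(2) i] by (simp add: V_def)
      then show "i \<in> B n" using n by (auto simp: nbhd_eq)
    qed
    define G where "G \<xi> = (\<Prod>i\<in>B n - affected \<Lambda>. node_weight i \<xi>) *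
      (\<Prod>u\<in>L (Suc n). Z u (\<xi> (butlast u)) (\<xi> u))" for \<xi>
    have Gm: "G (m \<nu> \<eta> \<zeta>) = G (m \<nu>' \<eta> \<zeta>)" for \<nu> \<nu>' \<eta> \<zeta>
    proof -
      have "node_weight i (m \<nu> \<eta> \<zeta>) = node_weight i (m \<nu>' \<eta> \<zeta>)" if "i \<in> B n - affected \<Lambda>" for i
      proof (rule node_weight_cong)
        fix u assume "u \<in> nbhd \<Delta> i"
        then have "u \<notin> \<Lambda>" using that by (auto simp: affected_def B_def)
        then show "m \<nu> \<eta> \<zeta> u = m \<nu>' \<eta> \<zeta> u" by (rule mv(3))
      qed
      moreover have "m \<nu> \<eta> \<zeta> u = m \<nu>' \<eta> \<zeta> u \<and> m \<nu> \<eta> \<zeta> (butlast u) =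
        m \<nu>' \<eta> \<zeta> (butlast u)" if u: "u \<in> L (Suc n)" for u
      proof (intro conjI mv(3))
        show "u \<notin> \<Lambda>" using n u by (auto simp: B_def L_def)
        show "butlast u \<notin> \<Lambda>"
        proof
          assume b: "butlast u \<in> \<Lambda>"
          have "u \<in> neighbors (butlast u)"
            using u by (cases u rule: rev_cases) (auto simp: L_def neighbors_def tree_adj_def intro:
              prefix_in_T)
          then have "u \<in> \<Lambda> \<union> V" using b u unfolding V_def
            by (auto simp: bdry_iff[OF \<Lambda>(2)] L_def)
          then show False using n u by (auto simp: B_def L_def)
        qed
      qed
      ultimately show ?thesis unfolding G_def by (intro arg_cong2[of _ _ _ _ "(*)"] prod.cong refl)
        auto
    qed
    have factor: "ball_weight n Z (m \<nu> \<eta> \<zeta>) = h \<nu> \<eta> * G (m (\<lambda>_. 0) \<eta> \<zeta>)"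
      if \<nu>: "\<nu> \<in> configs \<Lambda>" and \<eta>: "\<eta> \<in> configs V" for \<nu> \<eta> \<zeta>
    proof -
      have "h \<nu> \<eta> = (\<Prod>i\<in>affected \<Lambda>. node_weight i (merge \<Lambda> V (\<nu>, \<eta>)))"
        unfolding h_def using configs_spin[OF merge_configs[OF \<nu> \<eta>]]
        by (intro exp_neg_hamiltonian \<Lambda>) (auto simp: V_def)
      also have "\<dots> = (\<Prod>i\<in>affected \<Lambda>. node_weight i (m \<nu> \<eta> \<zeta>))"
      proof (intro prod.cong refl node_weight_cong)
        fix i u assume "i \<in> affected \<Lambda>" "u \<in> nbhd \<Delta> i"
        then have "u \<in> \<Lambda> \<union> V" using nbhd_affected_subset[OF \<Lambda>(2)] by (auto simp: V_def)
        then show "merge \<Lambda> V (\<nu>, \<eta>) u = m \<nu> \<eta> \<zeta> u" using mv Vf(3) by (auto simp: merge_def)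
      qed
      finally have h: "h \<nu> \<eta> = (\<Prod>i\<in>affected \<Lambda>. node_weight i (m \<nu> \<eta> \<zeta>))" .
      have "(\<Prod>i\<in>B n. node_weight i (m \<nu> \<eta> \<zeta>)) = (\<Prod>i\<in>B n - affected \<Lambda>. node_weight i (m \<nu> \<eta> \<zeta>)) *
        (\<Prod>i\<in>affected \<Lambda>. node_weight i (m \<nu> \<eta> \<zeta>))"
        by (rule prod.subset_diff[OF IB finite_B])
      then show ?thesis unfolding Gm[of "\<lambda>_. 0" \<eta> \<zeta> \<nu>] h by (simp add: ball_weight_def G_def mult_ac)
    qed
    define A where "A \<eta> = (\<Sum>\<nu>\<in>configs \<Lambda>. if restrict \<nu> S = \<omega> then h \<nu> \<eta> else 0)" for \<eta>
    define H where "H \<eta> = (\<Sum>\<nu>\<in>configs \<Lambda>. h \<nu> \<eta>)" for \<eta>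
    define g where "g \<eta> = (\<Sum>\<zeta>\<in>configs R. G (m (\<lambda>_. 0) \<eta> \<zeta>)) / partition_fun n Z" for \<eta>
    have cylU: "cylinder_prob \<mu> U \<xi> = ball_weight n Z \<xi> / partition_fun n Z" if "\<xi> \<in> configs U" for \<xi>
      using cylinder_prob that by (simp add: U_def)
    have filt: "(\<Sum>\<xi> | \<xi> \<in> configs U \<and> Q \<xi>. cylinder_prob \<mu> U \<xi>) =
      (\<Sum>\<eta>\<in>configs V. \<Sum>\<nu>\<in>configs \<Lambda>. \<Sum>\<zeta>\<in>configs R. if Q (m \<nu> \<eta> \<zeta>) then h \<nu> \<eta> *
        G (m (\<lambda>_. 0) \<eta> \<zeta>) / partition_fun n Z else 0)" for Q
    proof -
      have "(\<Sum>\<xi> | \<xi> \<in> configs U \<and> Q \<xi>. cylinder_prob \<mu> U \<xi>) =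
        (\<Sum>\<xi>\<in>configs U. if Q \<xi> then cylinder_prob \<mu> U \<xi> else 0)"
        by (rule sum.inter_filter[OF finite_configs[OF U(2)]])
      also have "\<dots> = (\<Sum>\<xi>\<in>configs U. if Q \<xi> then ball_weight n Z \<xi> / partition_fun n Z else 0)"
        by (intro sum.cong refl) (simp add: cylU)
      also have "\<dots> = (\<Sum>\<eta>\<in>configs V. \<Sum>\<nu>\<in>configs \<Lambda>. \<Sum>\<zeta>\<in>configs R.
        if Q (m \<nu> \<eta> \<zeta>) then ball_weight n Z (m \<nu> \<eta> \<zeta>) / partition_fun n Z else 0)"
        by (rule split)
      also have "\<dots> = (\<Sum>\<eta>\<in>configs V. \<Sum>\<nu>\<in>configs \<Lambda>. \<Sum>\<zeta>\<in>configs R. if Q (m \<nu> \<eta> \<zeta>) then h \<nu> \<eta> *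
        G (m (\<lambda>_. 0) \<eta> \<zeta>) / partition_fun n Z else 0)"
        using factor by (intro sum.cong refl) auto
      finally show ?thesis .
    qed
    have rS: "restrict (m \<nu> \<eta> \<zeta>) S = restrict \<nu> S" for \<nu> \<eta> \<zeta>
    proof
      fix i show "restrict (m \<nu> \<eta> \<zeta>) S i = restrict \<nu> S i" using mv(1) S by (cases "i \<in> S") auto
    qed
    have rV: "restrict (m \<nu> \<eta> \<zeta>) V = \<eta>" if "\<eta> \<in> configs V" for \<nu> \<eta> \<zeta>
    proof -
      have "restrict (m \<nu> \<eta> \<zeta>) V = restrict \<eta> V"
      proof
        fix i show "restrict (m \<nu> \<eta> \<zeta>) V i = restrict \<eta> V i" using mv(2) by (cases "i \<in> V") auto
      qed
      then show ?thesis using restrict_id_configs[OF that] by simp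
    qed
    have L1: "cylinder_prob \<mu> S \<omega> = (\<Sum>\<eta>\<in>configs V. A \<eta> * g \<eta>)"
    proof -
      have "cylinder_prob \<mu> S \<omega> = (\<Sum>\<xi> | \<xi> \<in> configs U \<and> restrict \<xi> S = \<omega>. cylinder_prob \<mu> U \<xi>)"
        by (rule cylinder_prob_marginal[OF U(2,3) SU(1)])
      also have "\<dots> = (\<Sum>\<eta>\<in>configs V. \<Sum>\<nu>\<in>configs \<Lambda>. \<Sum>\<zeta>\<in>configs R. (if restrict \<nu> S =
        \<omega> then h \<nu> \<eta> else 0) * (G (m (\<lambda>_. 0) \<eta> \<zeta>) / partition_fun n Z))"
        unfolding filt rS by (intro sum.cong refl) simp
      also have "\<dots> = (\<Sum>\<eta>\<in>configs V. A \<eta> * g \<eta>)"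
        unfolding A_def g_def by (simp add: sum_product sum_divide_distrib)
      finally show ?thesis .
    qed
    have L2: "cylinder_prob \<mu> V \<eta> = H \<eta> * g \<eta>" if \<eta>: "\<eta> \<in> configs V" for \<eta>
    proof -
      have "cylinder_prob \<mu> V \<eta> = (\<Sum>\<xi> | \<xi> \<in> configs U \<and> restrict \<xi> V = \<eta>. cylinder_prob \<mu> U \<xi>)"
        by (rule cylinder_prob_marginal[OF U(2,3) SU(2)])
      also have "\<dots> = (\<Sum>\<eta>'\<in>configs V. if \<eta>' = \<eta> then \<Sum>\<nu>\<in>configs \<Lambda>. \<Sum>\<zeta>\<in>configs R. h \<nu> \<eta>' *
        G (m (\<lambda>_. 0) \<eta>' \<zeta>) / partition_fun n Z else 0)"
        unfolding filt by (intro sum.cong refl) (simp add: rV)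
      also have "\<dots> = (\<Sum>\<nu>\<in>configs \<Lambda>. \<Sum>\<zeta>\<in>configs R. h \<nu> \<eta> * G (m (\<lambda>_. 0) \<eta> \<zeta>) / partition_fun n Z)"
        using \<eta> Vf finite_configs by simp
      also have "\<dots> = H \<eta> * g \<eta>"
        unfolding H_def g_def by (simp add: sum_product sum_divide_distrib)
      finally show ?thesis .
    qed
    have fvp: "finite_volume_prob \<Delta> lam \<theta> \<Lambda> \<eta> S \<omega> = A \<eta> / H \<eta>" for \<eta>
    proof -
      have "(\<Sum>\<nu> | \<nu> \<in> configs \<Lambda> \<and> restrict \<nu> S = \<omega>. h \<nu> \<eta>) = A \<eta>"
        unfolding A_def by (rule sum.inter_filter) (simp add: finite_configs \<Lambda>)
      then show ?thesis unfolding finite_volume_prob_def h_def H_def V_def by simp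
    qed
    \<comment> \<open>If \<open>H \<eta> = 0\<close>, then \<open>A \<eta> / H \<eta>\<close> is \<open>0\<close> by convention, which is harmless as then \<open>A \<eta> = 0\<close>.\<close>
    have AH: "0 \<le> A \<eta>" "A \<eta> \<le> H \<eta>" for \<eta>
      unfolding A_def H_def using h0 by (auto intro!: sum_nonneg sum_mono)
    \<comment> \<open>The average over \<open>\<eta>\<close> runs over hard-core boundary conditions only; the other ones have weight
      zero.\<close>
    have zero: "A \<eta> * g \<eta> = 0" if \<eta>: "\<eta> \<in> configs V" "\<eta> \<notin> hardcore_configs \<Delta> V" for \<eta>
    proof -
      obtain i j where ij: "i \<in> V" "j \<in> V" "tree_adj \<Delta> i j" "\<eta> i = 1" "\<eta> j = 1"
        using \<eta> by (auto simp: hardcore_configs_def)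
      have "h \<nu> \<eta> * G (m (\<lambda>_. 0) \<eta> \<zeta>) = 0" if "\<nu> \<in> configs \<Lambda>" for \<nu> \<zeta>
        unfolding factor[OF that \<eta>(1), symmetric]
        using ij n mv(2) by (intro ball_weight_not_hardcore[of i _ j]) (auto simp: neighbors_def)
      then show ?thesis
        unfolding A_def g_def times_divide_eq_right sum_product by (auto intro!: sum.neutral)
    qed
    have "cylinder_prob \<mu> S \<omega> = (\<Sum>\<eta>\<in>hardcore_configs \<Delta> V. A \<eta> * g \<eta>)"
      unfolding L1 using zero Vf
      by (intro sum.mono_neutral_right finite_configs) (auto simp: hardcore_configs_def)
    also have "\<dots> = (\<Sum>\<eta>\<in>hardcore_configs \<Delta> V. finite_volume_prob \<Delta> lam \<theta> \<Lambda> \<eta> S \<omega> *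
      cylinder_prob \<mu> V \<eta>)"
    proof (intro sum.cong refl)
      fix \<eta> assume "\<eta> \<in> hardcore_configs \<Delta> V"
      then have "\<eta> \<in> configs V" by (simp add: hardcore_configs_def)
      then show "A \<eta> * g \<eta> = finite_volume_prob \<Delta> lam \<theta> \<Lambda> \<eta> S \<omega> * cylinder_prob \<mu> V \<eta>"
        using AH[of \<eta>] by (cases "H \<eta> = 0") (auto simp: fvp L2)
    qed
    finally show ?thesis by (simp add: V_def)
  qed
  show ?thesis
    unfolding gibbs_measure_def using AE sets_mu prob_space_axioms spec unfolding cylinder_prob_def
      by auto
qed

text \<open>The messages of a solution: the two levels of the period alternate along the tree.\<close>

definition sol_msg :: "real \<Rightarrow> real \<Rightarrow> node \<Rightarrow> nat \<Rightarrow> nat \<Rightarrow> real" where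
  "sol_msg x y v = (if even (length v) then edge_msg x (f y) else edge_msg y (f x))"

text \<open>The equations of the system say that these messages reproduce themselves up to the factor
  \<open>D y\<close>.\<close>

lemma msg_solution:
  assumes xy: "0 \<le> x" "0 \<le> y" "x = lam * f x ^ (\<Delta> - 1) / D y" and C: "finite C" "card C = \<Delta> - 1"
    and Z: "\<And>u. u \<in> C \<Longrightarrow> Z u = edge_msg y (f x)" and st: "s = 0 \<or> s = 1" "t = 0 \<or> t = 1"
  shows "msg Z C s t = D y * edge_msg x (f y) s t"
proof -
  have e: "child_sum \<theta> C (\<lambda>u. Z u 0) j = binomial_sum \<theta> (\<Delta> - 1) y j" for j
    unfolding C(2)[symmetric] using Z C by (intro child_sum_const) (auto simp: edge_msg_def)
  have p: "(\<Prod>u\<in>C. Z u 1 0) = f x ^ (\<Delta> - 1)"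
    using Z C by (simp add: edge_msg_def)
  have Dy: "D y > 0" using xy by (intro D_pos)
  have f: "binomial_sum \<theta> (\<Delta> - 1) y 1 = D y * f y" using Dy by (simp add: f_def D_def)
  have x: "lam * f x ^ (\<Delta> - 1) = D y * x" using xy(3) Dy by (simp add: divide_simps mult_ac)
  have "msg Z C s 0 = D y * edge_msg x (f y) s 0"
    unfolding msg_0 e using st f by (auto simp: edge_msg_def D_def)
  moreover have "msg Z C s 1 = D y * edge_msg x (f y) s 1"
    unfolding msg_1[OF C(1)] p using st x by (auto simp: edge_msg_def)
  ultimately show ?thesis using st by auto
qed

lemma sol_msg_nonneg: "0 \<le> x \<Longrightarrow> 0 \<le> y \<Longrightarrow> 0 \<le> sol_msg x y v s t"
  using f_pos[of x] f_pos[of y] by (auto simp: sol_msg_def intro!: edge_msg_nonneg)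

lemma partition_fun_sol_pos: "0 \<le> x \<Longrightarrow> 0 \<le> y \<Longrightarrow> 0 < partition_fun n (sol_msg x y)"
  by (intro partition_fun_pos sol_msg_nonneg) (auto simp: sol_msg_def edge_msg_def)

lemma ball_weight_sol_msg_step:
  assumes sol: "(x, y) \<in> system_solutions \<Delta> lam \<theta>"
  obtains K where "K > 0" "\<And>\<omega>. \<omega> \<in> configs (B (Suc n)) \<Longrightarrow>
    ball_weight n (msg_step (sol_msg x y)) \<omega> = K * ball_weight n (sol_msg x y) \<omega>"
proof -
  have xy: "0 \<le> x" "0 \<le> y" "x = lam * f x ^ (\<Delta> - 1) / D y" "y = lam * f y ^ (\<Delta> - 1) / D x"
    using sol by (auto simp: solutions_iff)
  define k where "k v = (if even (length v) then D y else D x)" for v :: node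
  have k0: "0 < k v" for v using xy by (simp add: k_def D_pos)
  have step: "msg_step (sol_msg x y) v s t = k v * sol_msg x y v s t" if v: "v \<in> L (Suc n)" and st:
    "s = 0 \<or> s = 1" "t = 0 \<or> t = 1" for v s t
  proof -
    have c: "finite (children v)" "card (children v) = \<Delta> - 1"
      using v card_children[of v] by (auto simp: finite_children L_def)
    have len: "length u = Suc (length v)" if "u \<in> children v"
      for u using that by (auto simp: children_def)
    show ?thesis
    proof (cases "even (length v)")
      case True
      then show ?thesis unfolding msg_step_def
        using msg_solution[OF xy(1,2,3) c _ st, of "sol_msg x y"] len
          by (auto simp: k_def sol_msg_def)
    next
      case False
      then show ?thesis unfolding msg_step_def
        using msg_solution[OF xy(2,1,4) c _ st, of "sol_msg x y"] len
          by (auto simp: k_def sol_msg_def)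
    qed
  qed
  have "ball_weight n (msg_step (sol_msg x y)) \<omega> = (\<Prod>u\<in>L (Suc n). k u) *
    ball_weight n (sol_msg x y) \<omega>" if \<omega>: "\<omega> \<in> configs (B (Suc n))" for \<omega>
  proof -
    have sp: "\<omega> w = 0 \<or> \<omega> w = 1" "\<omega> (butlast w) = 0 \<or> \<omega> (butlast w) = 1" if "w \<in> L (Suc n)" for w
      using that configs_spin[OF \<omega>] butlast_in_T by (auto simp: L_def B_def)
    have "(\<Prod>u\<in>L (Suc n). msg_step (sol_msg x y) u (\<omega> (butlast u)) (\<omega> u)) =
      (\<Prod>u\<in>L (Suc n). k u * sol_msg x y u (\<omega> (butlast u)) (\<omega> u))"
      using step sp by (intro prod.cong refl) auto
    then show ?thesis by (simp add: ball_weight_def prod.distrib mult_ac)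
  qed
  moreover have "0 < (\<Prod>u\<in>L (Suc n). k u)" using k0 by (intro prod_pos) auto
  ultimately show ?thesis using that by blast
qed

text \<open>As the messages are fixed by \<open>msg_step\<close> up to a constant factor, the normalized weights of the
  balls are consistent.\<close>

lemma solution_measure:
  assumes sol: "(x, y) \<in> system_solutions \<Delta> lam \<theta>"
  obtains \<mu> where "config_measure \<mu> \<Delta>"
    "\<And>n \<omega>. \<omega> \<in> configs (B (Suc n)) \<Longrightarrow> cylinder_prob \<mu> (B (Suc n)) \<omega> =
      ball_weight n (sol_msg x y) \<omega> / partition_fun n (sol_msg x y)"
proof -
  have xy: "0 \<le> x" "0 \<le> y" using sol by (auto simp: solutions_iff)
  let ?Z = "sol_msg x y"
  have "\<exists>\<mu>. prob_space \<mu> \<and> sets \<mu> = sets (Pi\<^sub>M T (\<lambda>_. count_space {0, 1})) \<and>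
    (\<forall>n. \<forall>\<omega>\<in>configs (B (Suc n)). cylinder_prob \<mu> (B (Suc n)) \<omega> =
      ball_weight n ?Z \<omega> / partition_fun n ?Z)"
  proof (rule extension_of_consistent_densities[of "\<lambda>n. B (Suc n)"])
    show "(\<Union>n. B (Suc n)) = T"
    proof (intro set_eqI iffI)
      fix v assume "v \<in> T"
      then have "v \<in> B (Suc (length v))" by (simp add: B_def)
      then show "v \<in> (\<Union>n. B (Suc n))" by blast
    qed (auto simp: B_def)
    show "0 \<le> ball_weight n ?Z \<omega> / partition_fun n ?Z" if "\<omega> \<in> configs (B (Suc n))" for n \<omega>
      using that xy partition_fun_sol_pos[OF xy, of n] by (intro divide_nonneg_pos
        ball_weight_nonneg sol_msg_nonneg)
    show "(\<Sum>\<omega>\<in>configs (B (Suc n)). ball_weight n ?Z \<omega> / partition_fun n ?Z) = 1" for n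
      using partition_fun_sol_pos[OF xy, of n] by (simp add: sum_divide_distrib[symmetric]
        partition_fun_def)
    fix n \<omega> assume \<omega>: "\<omega> \<in> configs (B (Suc n))"
    obtain K where K: "K > 0" "\<And>\<omega>. \<omega> \<in> configs (B (Suc n)) \<Longrightarrow>
      ball_weight n (msg_step ?Z) \<omega> = K * ball_weight n ?Z \<omega>"
      using ball_weight_sol_msg_step[OF sol] by blast
    have "partition_fun (Suc n) ?Z = (\<Sum>\<omega>\<in>configs (B (Suc n)). ball_weight n (msg_step ?Z) \<omega>)"
      unfolding partition_fun_def
      by (subst sum_configs_fibres[of "B (Suc n)"]) (auto simp: finite_B B_mono ball_weight_marginal
        intro!: sum.cong)
    also have "\<dots> = K * partition_fun n ?Z" using K by (simp add: partition_fun_def sum_distrib_left)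
    finally have Z: "partition_fun (Suc n) ?Z = K * partition_fun n ?Z" .
    have "(\<Sum>\<xi> | \<xi> \<in> configs (B (Suc (Suc n))) \<and> restrict \<xi> (B (Suc n)) =
      \<omega>. ball_weight (Suc n) ?Z \<xi> / partition_fun (Suc n) ?Z) =
        ball_weight n (msg_step ?Z) \<omega> / partition_fun (Suc n) ?Z"
      unfolding sum_divide_distrib[symmetric] ball_weight_marginal[OF \<omega>] ..
    also have "\<dots> = ball_weight n ?Z \<omega> / partition_fun n ?Z"
      unfolding Z K(2)[OF \<omega>] using K(1) by simp
    finally show "(\<Sum>\<xi> | \<xi> \<in> configs (B (Suc (Suc n))) \<and> restrict \<xi> (B (Suc n)) =
      \<omega>. ball_weight (Suc n) ?Z \<xi> / partition_fun (Suc n) ?Z) =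
        ball_weight n ?Z \<omega> / partition_fun n ?Z" .
  qed (auto simp: finite_B B_mono)
  then show ?thesis
    using that by (auto simp: config_measure_def config_measure_axioms_def config_space_def)
qed

section \<open>A Gibbs measure determines its solution\<close>

text \<open>Across the edge between the root and its child \<open>[0]\<close>, the child sends \<open>edge_msg y (f x)\<close> and the
  root, which has \<open>\<Delta> - 1\<close> further children, sends \<open>D y * edge_msg x (f y)\<close>. The joint law of the two
  spins is proportional to the product of the two messages.\<close>

lemma root_edge_marginal:
  assumes sol: "(x, y) \<in> system_solutions \<Delta> lam \<theta>"
    and cm: "config_measure \<mu> \<Delta>"
    and cylinder_prob: "\<And>n \<omega>. \<omega> \<in> configs (B (Suc n)) \<Longrightarrow>
      cylinder_prob \<mu> (B (Suc n)) \<omega> = ball_weight n (sol_msg x y) \<omega> / partition_fun n (sol_msg x y)"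
    and st: "s = 0 \<or> s = 1" "t = 0 \<or> t = 1"
  defines "\<omega> \<equiv> (\<lambda>v\<in>{[], [0]}. if v = [] then s else t)"
  shows "cylinder_prob \<mu> {[], [0]} \<omega> = edge_msg y (f x) s t * edge_msg x (f y) t s *
    D y / partition_fun 0 (sol_msg x y)"
proof -
  interpret config_measure \<mu> \<Delta> by fact
  have xy: "0 \<le> x" "0 \<le> y" "x = lam * f x ^ (\<Delta> - 1) / D y"
    using sol by (auto simp: solutions_iff)
  let ?Z = "sol_msg x y"
  let ?e = "[0] :: node"
  let ?E = "{[], ?e}"
  define C where "C = L 1 - {?e}"
  have eL: "?e \<in> L 1" using Delta by (auto simp: L_def tree_nodes_def)
  have B1: "B (Suc 0) = insert [] (L 1)" using B_Suc[of 0] by (simp add: B_0)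
  have L1: "L 1 = insert ?e C" "?e \<notin> C" "finite C" "[] \<notin> C" "[] \<notin> L 1"
    using eL finite_L[of 1] by (auto simp: C_def L_def)
  have chr: "L 1 = children []" using L_Suc[of 0] by (simp add: L_def Nil_in_tree_nodes cong:
    conj_cong)
  have cardC: "card C = \<Delta> - 1"
    using card_children[OF Nil_in_tree_nodes[of \<Delta>]] eL finite_L[of 1] unfolding chr[symmetric] C_def
      by simp
  have diff: "B (Suc 0) - ?E = C" using L1 unfolding B1 by auto
  have sub: "?E \<subseteq> B (Suc 0)" using eL B1 by auto
  have \<omega>: "\<omega> \<in> configs ?E" using st by (auto simp: \<omega>_def configs_def)
  have val: "ball_weight 0 ?Z (merge ?E C (\<omega>, \<zeta>)) = ?Z ?e s t * (spin_weight s (t + (\<Sum>u\<in>C. \<zeta> u)) *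
    (\<Prod>u\<in>C. ?Z u s (\<zeta> u)))" for \<zeta>
  proof -
    let ?m = "merge ?E C (\<omega>, \<zeta>)"
    have m: "?m [] = s" "?m ?e = t" "\<And>u. u \<in> C \<Longrightarrow> ?m u = \<zeta> u"
      using L1 by (auto simp: merge_def \<omega>_def)
    have nb0: "neighbors [] = L 1" using neighbors_eq[OF Nil_in_tree_nodes[of \<Delta>]] chr by simp
    have "(\<Sum>u\<in>neighbors []. ?m u) = t + (\<Sum>u\<in>C. \<zeta> u)"
      unfolding nb0 L1(1) using L1 m by simp
    then have node_weight: "node_weight [] ?m = spin_weight s (t + (\<Sum>u\<in>C. \<zeta> u))"
      using m by (simp add: node_weight_def)
    have bl: "butlast u = []" if "u \<in> L 1" for u using that by (cases u) (auto simp: L_def)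
    have "(\<Prod>u\<in>L (Suc 0). ?Z u (?m (butlast u)) (?m u)) = (\<Prod>u\<in>insert ?e C. ?Z u s (?m u))"
      using bl m by (intro prod.cong) (auto simp: L1(1)[symmetric])
    also have "\<dots> = ?Z ?e s t * (\<Prod>u\<in>C. ?Z u s (\<zeta> u))" using L1 m by simp
    finally show ?thesis using node_weight by (simp add: ball_weight_def B_0)
  qed
  have "cylinder_prob \<mu> ?E \<omega> = (\<Sum>\<xi> | \<xi> \<in> configs (B (Suc 0)) \<and> restrict \<xi> ?E =
    \<omega>. cylinder_prob \<mu> (B (Suc 0)) \<xi>)"
    by (rule cylinder_prob_marginal[OF finite_B B_subset_T sub])
  also have "\<dots> = (\<Sum>\<xi> | \<xi> \<in> configs (B (Suc 0)) \<and> restrict \<xi> ?E =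
    \<omega>. ball_weight 0 ?Z \<xi>) / partition_fun 0 ?Z"
    unfolding sum_divide_distrib by (intro sum.cong refl) (use cylinder_prob in auto)
  also have "(\<Sum>\<xi> | \<xi> \<in> configs (B (Suc 0)) \<and> restrict \<xi> ?E = \<omega>. ball_weight 0 ?Z \<xi>) =
    ?Z ?e s t * msg ?Z C t s"
    unfolding sum_configs_restrict[OF sub \<omega>] diff val msg_def sum_distrib_left ..
  also have "msg ?Z C t s = D y * edge_msg x (f y) t s"
    using L1 by (intro msg_solution xy cardC st) (auto simp: sol_msg_def C_def L_def)
  also have "?Z ?e = edge_msg y (f x)" by (simp add: sol_msg_def)
  finally show ?thesis by (simp add: mult_ac)
qed

text \<open>\<open>f\<close> is positive and nondecreasing, so \<open>x * f x\<close> is strictly increasing.\<close>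

lemma mult_f_inj:
  assumes "0 \<le> x" "0 \<le> x'" "x * f x = x' * f x'"
  shows "x = x'"
proof -
  have "x * f x < x' * f x'" if "0 \<le> x" "x < x'" for x x'
  proof -
    have "x * f x \<le> x * f x'" using that f_mono[of x x'] by (intro mult_left_mono) auto
    also have "\<dots> < x' * f x'" using that f_pos[of x'] by simp
    finally show ?thesis .
  qed
  then show ?thesis using assms by (metis linorder_neqE_linordered_idom less_irrefl)
qed

lemma solution_determined:
  assumes sol: "(x, y) \<in> system_solutions \<Delta> lam \<theta>" "(x', y') \<in> system_solutions \<Delta> lam \<theta>"
    and cm: "config_measure \<mu> \<Delta>"
    and cylinder_prob: "\<And>n \<omega>. \<omega> \<in> configs (B (Suc n)) \<Longrightarrow>
      cylinder_prob \<mu> (B (Suc n)) \<omega> = ball_weight n (sol_msg x y) \<omega> / partition_fun n (sol_msg x y)"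
    and cylinder_prob': "\<And>n \<omega>. \<omega> \<in> configs (B (Suc n)) \<Longrightarrow>
      cylinder_prob \<mu> (B (Suc n)) \<omega> = ball_weight n (sol_msg x' y') \<omega> / partition_fun n (sol_msg x'
        y')"
  shows "(x, y) = (x', y')"
proof -
  have xy: "0 \<le> x" "0 \<le> y" "0 \<le> x'" "0 \<le> y'" using sol by (auto simp: solutions_iff)
  define c where "c = D y / partition_fun 0 (sol_msg x y)"
  define c' where "c' = D y' / partition_fun 0 (sol_msg x' y')"
  have c0: "c > 0" "c' > 0" unfolding c_def c'_def using xy partition_fun_sol_pos D_pos by auto
  have eq: "edge_msg y (f x) s t * edge_msg x (f y) t s * c =
    edge_msg y' (f x') s t * edge_msg x' (f y') t s * c'"
    if "s = 0 \<or> s = 1" "t = 0 \<or> t = 1" for s t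
    using root_edge_marginal[OF sol(1) cm cylinder_prob that] root_edge_marginal[OF sol(2) cm
      cylinder_prob' that]
    by (simp add: c_def c'_def)
  \<comment> \<open>both spins \<open>0\<close>: the messages are \<open>1\<close>, so the normalizations agree\<close>
  have cc: "c = c'" using eq[of 0 0] by (simp add: edge_msg_def)
  have "x * f x = x' * f x'" "y * f y = y' * f y'"
    using eq[of 1 0] eq[of 0 1] c0 unfolding cc by (auto simp: edge_msg_def mult_ac)
  then show ?thesis using mult_f_inj xy by blast
qed

end

theorem theorem4:
  fixes \<Delta> :: nat and lam :: real and \<theta> :: "nat \<Rightarrow> real"
  assumes "\<Delta> \<ge> 3" and "lam > 0"
    and "\<forall>k\<in>{0..\<Delta>}. \<theta> k > 0" and "log_convex \<Delta> \<theta>"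
  shows "(\<exists>p. p \<in> system_solutions \<Delta> lam \<theta>) \<and>
    (uniqueness_regime \<Delta> lam \<theta> \<longleftrightarrow> (\<exists>!p. p \<in> system_solutions \<Delta> lam \<theta>))"
proof -
  interpret log_convex_model \<Delta> lam \<theta>
  proof
    fix k assume k: "k + 2 \<le> \<Delta>"
    then have "k + 1 \<in> {1..\<Delta> - 1}" by auto
    then have "\<theta> (k + 1 + 1) / \<theta> (k + 1) \<ge> \<theta> (k + 1) / \<theta> (k + 1 - 1)"
      using assms(4) unfolding log_convex_def by blast
    moreover have "\<theta> k > 0" "\<theta> (Suc k) > 0" using assms(3) k by auto
    ultimately show "(\<theta> (Suc k))\<^sup>2 \<le> \<theta> k * \<theta> (Suc (Suc k))"
      by (simp add: divide_simps power2_eq_square mult_ac)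
  qed (use assms in auto)
  obtain x y where sol: "(x, y) \<in> system_solutions \<Delta> lam \<theta>" using bounds_limits by blast
  have "uniqueness_regime \<Delta> lam \<theta> \<longleftrightarrow> (\<exists>!p. p \<in> system_solutions \<Delta> lam \<theta>)"
  proof
    assume "uniqueness_regime \<Delta> lam \<theta>"
    then have un: "\<mu> = \<mu>'" if "gibbs_measure \<Delta> lam \<theta> \<mu>" "gibbs_measure \<Delta> lam \<theta> \<mu>'" for \<mu> \<mu>'
      using that unfolding uniqueness_regime_def by blast
    have "p = p'" if p: "p \<in> system_solutions \<Delta> lam \<theta>" "p' \<in> system_solutions \<Delta> lam \<theta>" for p p'
    proof -
      obtain x y x' y' where pp: "p = (x, y)" "p' = (x', y')" by (cases p, cases p')
      obtain \<mu> where \<mu>: "config_measure \<mu> \<Delta>"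
        "\<And>n \<omega>. \<omega> \<in> configs (B (Suc n)) \<Longrightarrow> cylinder_prob \<mu> (B (Suc n)) \<omega> =
          ball_weight n (sol_msg x y) \<omega> / partition_fun n (sol_msg x y)"
        using solution_measure p(1) unfolding pp by blast
      obtain \<mu>' where \<mu>': "config_measure \<mu>' \<Delta>"
        "\<And>n \<omega>. \<omega> \<in> configs (B (Suc n)) \<Longrightarrow> cylinder_prob \<mu>' (B (Suc n)) \<omega> =
          ball_weight n (sol_msg x' y') \<omega> / partition_fun n (sol_msg x' y')"
        using solution_measure p(2) unfolding pp by blast
      have "\<mu>' = \<mu>" using gibbs_of_message_density[OF \<mu>] gibbs_of_message_density[OF \<mu>'] by (intro un)
      with \<mu>'(2) have "\<And>n \<omega>. \<omega> \<in> configs (B (Suc n)) \<Longrightarrow> cylinder_prob \<mu> (B (Suc n)) \<omega> =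
        ball_weight n (sol_msg x' y') \<omega> / partition_fun n (sol_msg x' y')"
        by simp
      from solution_determined[OF p[unfolded pp] \<mu> this] show ?thesis by (simp add: pp)
    qed
    then show "\<exists>!p. p \<in> system_solutions \<Delta> lam \<theta>" using sol by blast
  next
    assume "\<exists>!p. p \<in> system_solutions \<Delta> lam \<theta>"
    then have "p = p'" if "p \<in> system_solutions \<Delta> lam \<theta>" "p' \<in> system_solutions \<Delta> lam \<theta>" for p p'
      using that by blast
    note un = gibbs_measure_unique[OF this]
    obtain \<mu> where "config_measure \<mu> \<Delta>"
      "\<And>n \<omega>. \<omega> \<in> configs (B (Suc n)) \<Longrightarrow> cylinder_prob \<mu> (B (Suc n)) \<omega> =
        ball_weight n (sol_msg x y) \<omega> / partition_fun n (sol_msg x y)"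
      using solution_measure[OF sol] by blast
    then have "gibbs_measure \<Delta> lam \<theta> \<mu>" by (rule gibbs_of_message_density)
    then show "uniqueness_regime \<Delta> lam \<theta>" unfolding uniqueness_regime_def using un by blast
  qed
  then show ?thesis using sol by blast
qed

end
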